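(* Let $a,\sigma>0$ and suppose that $V\colon\mathbb{R}^n\to\mathbb{R}$ is bounded from below and in $\mathcal{D}^{(2)}$. For $t>0$ and $x\in\mathbb{R}^n$, set $$A_t^x:=-\int_0^t\nabla V(X_s^x)\frac{\sinh(a(t-s))}{\sinh(at)}\,ds+\frac{2ae^{-at}}{\sigma^2(1-e^{-2at})}\,(X_t^x-e^{-at}x).$$ Let $f\in\mathbb{L}^2(\gamma)\setminus\{0\}$ be non-negative. Then $$\nabla(\log P_t^Vf)(x)=\mathbb{E}_{f,x}(A_t^x)$$ and $$\begin{aligned}&\mathrm{Hess}(\log P_t^Vf)(x)+\frac{2ae^{-2at}}{\sigma^2(1-e^{-2at})}\,\mathrm{Id}\\&\quad=-\int_0^t\Bigl(\frac{\sinh(a(t-s))}{\sinh(at)}\Bigr)^2\mathbb{E}_{f,x}\bigl(\mathrm{Hess}V(X_s^x)\bigr)\,ds+\mathbb{E}_{f,x}(A_t^x\otimes A_t^x)-\mathbb{E}_{f,x}(A_t^x)\otimes\mathbb{E}_{f,x}(A_t^x).\end{aligned}$$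
   Context: $\mathcal{D}^{(k)}$ denotes the set of $\mathcal{C}^k$ real-valued functions which, together with their derivatives (up to order $k$), have polynomial growth. For $u,v\in\mathbb{R}^n$, $u\otimes v:=uv^T$; $\mathrm{Id}$ is the $n\times n$ identity matrix; $\nabla$ and $\mathrm{Hess}$ are Euclidean. Let $(B_t)_{t\ge0}$ be a standard Brownian motion on $\mathbb{R}^n$ on a filtered probability space $(\Omega,\mathbb{P})$. For $x\in\mathbb{R}^n$, $(X_s^x)_{s\ge0}$ is the unique strong solution of $X_t^x=x+\sigma B_t-a\int_0^tX_s^x\,ds$ (the Ornstein-Uhlenbeck process with generator $\frac12\sigma^2\Delta-ax\cdot\nabla$). Its equilibrium measure is $\gamma(dy)=\bigl(\frac{\pi\sigma^2}{a}\bigr)^{-n/2}\exp\bigl(-\frac{a|y|^2}{\sigma^2}\bigr)dy$. For $f\in\mathbb{L}^2(\gamma)$, $$P_t^Vf(x)=\mathbb{E}\Bigl[f(X_t^x)e^{-\int_0^tV(X_s^x)\,ds}\Bigr].$$ For $t>0$, $x\in\mathbb{R}^n$ and non-negative $f\in\mathbb{L}^2(\gamma)\setminus\{0\}$, $\mathbb{E}_{f,x}$ is the expectation with respect to the probability measure $\mathbb{Q}_{f,x}$ on $\Omega$ (depending also on $t$ and $V$) given by $$\mathbb{Q}_{f,x}(\Gamma)=\frac{1}{P_t^Vf(x)}\int_\Gamma f(X_t^x)e^{-\int_0^tV(X_s^x)ds}\,d\mathbb{P}.$$ *)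

theory Defs
  imports "HOL-Probability.Probability"
begin

section \<open>Euclidean calculus\<close>

definition grad :: "(real ^ 'n \<Rightarrow> real) \<Rightarrow> real ^ 'n \<Rightarrow> real ^ 'n" where
  "grad g x = (\<chi> i. frechet_derivative g (at x) (axis i 1))"

definition Hess :: "(real ^ 'n \<Rightarrow> real) \<Rightarrow> real ^ 'n \<Rightarrow> real ^ 'n ^ 'n" where
  "Hess g x = jacobian (grad g) (at x)"

definition outer :: "real ^ 'n \<Rightarrow> real ^ 'n \<Rightarrow> real ^ 'n ^ 'n" (infixl \<open>\<otimes>\<^sub>v\<close> 70) where
  "u \<otimes>\<^sub>v v = (\<chi> i j. u $ i * v $ j)"

definition poly_growth :: "(real ^ 'n \<Rightarrow> real) \<Rightarrow> bool" where
  "poly_growth g \<longleftrightarrow> (\<exists>C (m::nat). \<forall>x. \<bar>g x\<bar> \<le> C * (1 + norm x) ^ m)"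

text \<open>The class of \<open>C\<^sup>k\<close> functions all of whose partial derivatives of order at most \<open>k\<close>
  have polynomial growth. A function is \<open>C\<^sup>k\<^sup>+\<^sup>1\<close> iff it is differentiable everywhere and
  its first partial derivatives are \<open>C\<^sup>k\<close>.\<close>

primrec D_class :: "nat \<Rightarrow> (real ^ 'n \<Rightarrow> real) \<Rightarrow> bool" where
  "D_class 0 g \<longleftrightarrow> continuous_on UNIV g \<and> poly_growth g"
| "D_class (Suc k) g \<longleftrightarrow>
     (\<forall>x. g differentiable at x) \<and> poly_growth g \<and> (\<forall>i. D_class k (\<lambda>x. grad g x $ i))"


section \<open>Brownian motion and the Ornstein-Uhlenbeck process\<close>

text \<open>Time is indexed by \<^typ>\<open>real\<close>, but only nonnegative times matter: a filtration on
  \<open>[0, \<infinity>)\<close> can be extended to negative times by \<open>F 0\<close>.\<close>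

definition filtered_prob_space :: "'w measure \<Rightarrow> (real \<Rightarrow> 'w measure) \<Rightarrow> bool" where
  "filtered_prob_space M F \<longleftrightarrow>
     prob_space M \<and> filtration (space M) F \<and> (\<forall>t. subalgebra M (F t))"

text \<open>All sample paths are required to be continuous (not just almost all): neither \<open>M\<close> nor
  \<open>F\<close> is assumed to be complete, and this keeps time integrals along the paths measurable.\<close>

definition brownian_motion ::
  "'w measure \<Rightarrow> (real \<Rightarrow> 'w measure) \<Rightarrow> (real \<Rightarrow> 'w \<Rightarrow> real ^ 'n) \<Rightarrow> bool" where
  "brownian_motion M F B \<longleftrightarrow>
     filtered_prob_space M F \<and>
     (\<forall>t\<ge>0. B t \<in> borel_measurable (F t)) \<and>
     (\<forall>\<omega>\<in>space M. continuous_on {0..} (\<lambda>t. B t \<omega>)) \<and>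
     (AE \<omega> in M. B 0 \<omega> = 0) \<and>
     (\<forall>s\<ge>0. \<forall>t>s.
        prob_space.indep_set M (sets (F s))
          (sets (vimage_algebra (space M) (\<lambda>\<omega>. B t \<omega> - B s \<omega>) borel)) \<and>
        distributed M lborel (\<lambda>\<omega>. B t \<omega> - B s \<omega>)
          (\<lambda>z. ennreal (\<Prod>i\<in>UNIV. normal_density 0 (sqrt (t - s)) (z $ i))))"

text \<open>\<open>Y\<close> is a strong solution of \<open>Y\<^sub>t = x + \<sigma> B\<^sub>t - a \<integral>\<^sub>0\<^sup>t Y\<^sub>s ds\<close>, driven by
  the given Brownian motion. It is unique up to indistinguishability.\<close>

definition OU_solution ::
  "'w measure \<Rightarrow> (real \<Rightarrow> 'w measure) \<Rightarrow> (real \<Rightarrow> 'w \<Rightarrow> real ^ 'n) \<Rightarrow> real \<Rightarrow> real \<Rightarrow>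
   real ^ 'n \<Rightarrow> (real \<Rightarrow> 'w \<Rightarrow> real ^ 'n) \<Rightarrow> bool" where
  "OU_solution M F B a \<sigma> x Y \<longleftrightarrow>
     (\<forall>t\<ge>0. Y t \<in> borel_measurable (F t)) \<and>
     (\<forall>\<omega>\<in>space M. continuous_on {0..} (\<lambda>t. Y t \<omega>)) \<and>
     (AE \<omega> in M. \<forall>t\<ge>0.
        Y t \<omega> = x + \<sigma> *\<^sub>R B t \<omega> - a *\<^sub>R (LBINT s:{0..t}. Y s \<omega>))"

definition equilibrium :: "real \<Rightarrow> real \<Rightarrow> (real ^ 'n) measure" where
  "equilibrium a \<sigma> = density lborel (\<lambda>y. ennreal
     ((pi * \<sigma>\<^sup>2 / a) powr (- (real CARD('n) / 2)) * exp (- (a * (norm y)\<^sup>2 / \<sigma>\<^sup>2))))"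

text \<open>Square-integrable functions, represented by Borel functions.\<close>

definition L2_space :: "'b measure \<Rightarrow> ('b \<Rightarrow> real) set" where
  "L2_space N = {f \<in> borel_measurable N. integrable N (\<lambda>y. (f y)\<^sup>2)}"


section \<open>Feynman-Kac semigroup\<close>

text \<open>Throughout, \<open>X x\<close> is the process started at \<open>x\<close>.\<close>

definition FK_weight ::
  "(real ^ 'n \<Rightarrow> real \<Rightarrow> 'w \<Rightarrow> real ^ 'n) \<Rightarrow> (real ^ 'n \<Rightarrow> real) \<Rightarrow> real \<Rightarrow> (real ^ 'n \<Rightarrow> real) \<Rightarrow>
   real ^ 'n \<Rightarrow> 'w \<Rightarrow> real" where
  "FK_weight X V t f x \<omega> = f (X x t \<omega>) * exp (- (LBINT s:{0..t}. V (X x s \<omega>)))"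

definition FK_semigroup ::
  "'w measure \<Rightarrow> (real ^ 'n \<Rightarrow> real \<Rightarrow> 'w \<Rightarrow> real ^ 'n) \<Rightarrow> (real ^ 'n \<Rightarrow> real) \<Rightarrow> real \<Rightarrow>
   (real ^ 'n \<Rightarrow> real) \<Rightarrow> real ^ 'n \<Rightarrow> real" where
  "FK_semigroup M X V t f x = (\<integral>\<omega>. FK_weight X V t f x \<omega> \<partial>M)"

definition FK_measure ::
  "'w measure \<Rightarrow> (real ^ 'n \<Rightarrow> real \<Rightarrow> 'w \<Rightarrow> real ^ 'n) \<Rightarrow> (real ^ 'n \<Rightarrow> real) \<Rightarrow> real \<Rightarrow>
   (real ^ 'n \<Rightarrow> real) \<Rightarrow> real ^ 'n \<Rightarrow> 'w measure" where
  "FK_measure M X V t f x =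
     density M (\<lambda>\<omega>. ennreal (FK_weight X V t f x \<omega> / FK_semigroup M X V t f x))"

definition A_process ::
  "(real ^ 'n \<Rightarrow> real \<Rightarrow> 'w \<Rightarrow> real ^ 'n) \<Rightarrow> (real ^ 'n \<Rightarrow> real) \<Rightarrow> real \<Rightarrow> real \<Rightarrow> real \<Rightarrow>
   real ^ 'n \<Rightarrow> 'w \<Rightarrow> real ^ 'n" where
  "A_process X V a \<sigma> t x \<omega> =
     - (LBINT s:{0..t}. (sinh (a * (t - s)) / sinh (a * t)) *\<^sub>R grad V (X x s \<omega>))
     + (2 * a * exp (- a * t) / (\<sigma>\<^sup>2 * (1 - exp (- 2 * a * t)))) *\<^sub>R
         (X x t \<omega> - exp (- a * t) *\<^sub>R x)"

end

theory Submission
  imports Defs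
begin

text \<open>
  Since \<open>f\<close> is merely square integrable, the starting point \<open>x\<close> cannot be differentiated inside
  \<open>f(X\<^sub>t\<^sup>x)\<close>. The idea is to condition on the endpoint, so that \<open>x\<close> enters only through smooth
  functions. Put \<open>\<alpha>\<^sub>s = sinh(a(t-s)) / sinh(at)\<close>, \<open>\<beta>\<^sub>s = sinh(as) / sinh(at)\<close>, and let \<open>Y = X\<^sup>0\<close>. The
  equation is linear, so \<open>X\<^sub>s\<^sup>x = exp(-as) x + Y\<^sub>s\<close>, and therefore \<open>X\<^sub>s\<^sup>x = \<alpha>\<^sub>s x + \<beta>\<^sub>s X\<^sub>t\<^sup>x + Z\<^sub>s\<close> with the
  bridge \<open>Z\<^sub>s = Y\<^sub>s - \<beta>\<^sub>s Y\<^sub>t\<close>. The bridge is independent of \<open>Y\<^sub>t\<close>, which is centred Gaussian with variance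
  \<open>v = \<sigma>\<^sup>2 (1 - exp(-2at)) / (2a)\<close> in each coordinate. With the corresponding density \<open>g\<^sub>v\<close>,
  \<open>P\<^sub>t\<^sup>V f(x)\<close> is thus the integral over \<open>z\<close> (Lebesgue measure) and over the bridge (its law) of
  \<open>f(z) exp(- \<integral>\<^sub>0\<^sup>t V(\<alpha>\<^sub>s x + \<beta>\<^sub>s z + Z\<^sub>s) ds) g\<^sub>v(z - exp(-at) x)\<close> (lemmas \<open>distr_endpoint\<close> and \<open>FK_semigroup_eq\<close>).

  The logarithmic gradient in \<open>x\<close> of this integrand is \<open>A\<^sub>t\<^sup>x\<close>, evaluated at the endpoint \<open>z\<close>
  (\<open>dens_derivative\<close>), and the derivative of \<open>A\<^sub>t\<^sup>x\<close> in the same sense is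
  \<open>- \<integral>\<^sub>0\<^sup>t \<alpha>\<^sub>s\<^sup>2 Hess V ds - (exp(-2at) / v) Id\<close> (\<open>score_derivative\<close>). Differentiating twice under the
  integral sign (\<open>integral_dens_derivative\<close>, \<open>integral_dens_score_derivative\<close>) and applying the quotient rule
  to the logarithm gives both formulas.

  Two points need work. The first is the independence (\<open>gauss_indep_bridge\<close>). The increment
  \<open>Y\<^sub>s - exp(-a(s-r)) Y\<^sub>r\<close> is a pathwise limit of weighted sums of Brownian increments after time \<open>r\<close>,
  so it is Gaussian and independent of the past (\<open>gauss_indep_ou_increment\<close>); independence for finitely many
  times then follows by induction from an identity between Gaussian densities
  (\<open>nn_integral_gdens_split\<close>, \<open>bridge_fdd\<close>). The second is the domination that justifies differentiating under
  the integral (\<open>domination\<close>): it combines the polynomial growth of the derivatives of \<open>V\<close>, the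
  moments of the bridge, and the fact that \<open>g\<^sub>v\<close> decays faster than the square root of the equilibrium
  density.
\<close>

section \<open>Centred Gaussian densities\<close>

text \<open>The density of the centred Gaussian law with covariance \<open>v Id\<close>. It is the form in which the
  law of Brownian increments is given; it is used for \<open>v > 0\<close> only.\<close>

definition gdens :: "real \<Rightarrow> real ^ 'n \<Rightarrow> real" where
  "gdens v z = (\<Prod>i\<in>UNIV. normal_density 0 (sqrt v) (z $ i))"

lemma gdens_measurable [measurable]: "gdens v \<in> borel_measurable borel"
  unfolding gdens_def by measurable

lemma gdens_nonneg [simp]: "0 \<le> gdens v z"
  unfolding gdens_def by (intro prod_nonneg) simp

lemma gdens_eq:
  fixes z :: "real ^ 'n"
  assumes "v > 0"
  shows "gdens v z = (1 / sqrt (2 * pi * v)) ^ CARD('n) * exp (- (norm z)\<^sup>2 / (2 * v))"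
proof -
  have "(norm z)\<^sup>2 = (\<Sum>i\<in>UNIV. (z $ i)\<^sup>2)"
    by (simp add: norm_vec_def L2_set_def sum_nonneg)
  then show ?thesis
    using assms
    by (simp add: gdens_def normal_density_def prod.distrib prod_dividef exp_sum[symmetric] sum_negf sum_divide_distrib power_one_over)
qed

lemma gdens_pos: "v > 0 \<Longrightarrow> 0 < gdens v z"
  by (simp add: gdens_eq)

lemma Basis_vec_real: "(Basis :: (real ^ 'n) set) = range (\<lambda>i. axis i 1)"
  by (auto simp: Basis_vec_def)

lemma inj_axis_1: "inj (\<lambda>i. axis i (1::real) :: real ^ 'n)"
  by (auto simp: inj_def axis_eq_axis)

lemma nn_integral_lborel_vec_prod:
  fixes g :: "real \<Rightarrow> real"
  assumes [measurable]: "g \<in> borel_measurable borel" and "\<And>x. 0 \<le> g x"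
  shows "(\<integral>\<^sup>+z. ennreal (\<Prod>i\<in>UNIV. g ((z :: real ^ 'n) $ i)) \<partial>lborel)
    = (\<integral>\<^sup>+x. ennreal (g x) \<partial>lborel) ^ CARD('n)"
proof -
  have "(\<Prod>i\<in>UNIV. g ((z :: real ^ 'n) $ i)) = (\<Prod>b\<in>Basis. g (z \<bullet> b))" for z
    unfolding Basis_vec_real by (subst prod.reindex[OF inj_axis_1]) (simp add: inner_axis)
  then have "(\<integral>\<^sup>+z. ennreal (\<Prod>i\<in>UNIV. g ((z :: real ^ 'n) $ i)) \<partial>lborel)
    = (\<integral>\<^sup>+z. (\<Prod>b\<in>Basis. ennreal (g ((z :: real ^ 'n) \<bullet> b))) \<partial>lborel)"
    using assms by (simp add: prod_ennreal)
  also have "\<dots> = (\<Prod>b\<in>(Basis :: (real^'n) set). (\<integral>\<^sup>+x. g x \<partial>lborel))"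
    by (subst nn_integral_lborel_prod) auto
  also have "\<dots> = (\<integral>\<^sup>+x. ennreal (g x) \<partial>lborel) ^ CARD('n)"
    by simp
  finally show ?thesis .
qed

lemma nn_integral_gdens:
  assumes "v > 0"
  shows "(\<integral>\<^sup>+z. gdens v (z :: real ^ 'n) \<partial>lborel) = 1"
proof -
  have "(\<integral>\<^sup>+x. normal_density 0 (sqrt v) x \<partial>lborel) = 1"
    using assms by (subst nn_integral_eq_integral) auto
  then show ?thesis
    unfolding gdens_def by (subst nn_integral_lborel_vec_prod) auto
qed

lemma prob_space_gdens: "v > 0 \<Longrightarrow> prob_space (density lborel (\<lambda>z. ennreal (gdens v (z :: real ^ 'n))))"
  by (intro prob_spaceI) (simp add: emeasure_density nn_integral_gdens)

text \<open>If \<open>Y\<close> and \<open>R\<close> are independent and centred Gaussian with variances \<open>p\<close> and \<open>q\<close>, then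
  \<open>U = e Y + R\<close> and \<open>W = Y - (e p / T) U\<close> are independent and centred Gaussian with variances
  \<open>T = e\<^sup>2 p + q\<close> and \<open>p q / T\<close>. The following identity between densities, in dimension one, is the
  reason; the change of variables is made in \<open>nn_integral_gdens_split\<close>.\<close>

lemma normal_density_split:
  assumes "p > 0" "q > 0" and T: "T = e\<^sup>2 * p + q"
  shows "normal_density 0 (sqrt p) (w + e * p / T * u)
       * normal_density 0 (sqrt q) (u - e * (w + e * p / T * u))
     = normal_density 0 (sqrt T) u * normal_density 0 (sqrt (p * q / T)) w"
proof -
  have "T > 0" using assms by (simp add: add_nonneg_pos)
  have 1: "sqrt (2 * pi * p) * sqrt (2 * pi * q) = sqrt (2 * pi * T) * sqrt (2 * pi * (p * q / T))"
    using \<open>T > 0\<close> by (simp flip: real_sqrt_mult)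
  have a: "u - e * (w + e * p / T * u) = q / T * u - e * w"
  proof -
    have "e\<^sup>2 * p / T + q / T = 1"
      unfolding add_divide_distrib[symmetric] T[symmetric] using \<open>T > 0\<close> by simp
    then have "u = (e\<^sup>2 * p / T + q / T) * u" by simp
    then show ?thesis by (simp add: algebra_simps power2_eq_square)
  qed
  have b: "(w + e * p / T * u)\<^sup>2 / p + (q / T * u - e * w)\<^sup>2 / q = u\<^sup>2 / T + w\<^sup>2 / (p * q / T)"
  proof -
    have "(w + e * p / T * u)\<^sup>2 / p + (q / T * u - e * w)\<^sup>2 / q
      = w\<^sup>2 * ((e\<^sup>2 * p + q) / (p * q)) + u\<^sup>2 * (e\<^sup>2 * p + q) / T\<^sup>2"
      using assms(1,2) \<open>T > 0\<close> by (simp add: field_simps power2_eq_square)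
    also have "\<dots> = u\<^sup>2 / T + w\<^sup>2 / (p * q / T)"
      unfolding T[symmetric] using assms(1,2) \<open>T > 0\<close> by (simp add: field_simps power2_eq_square)
    finally show ?thesis .
  qed
  have "- (w + e * p / T * u)\<^sup>2 / (2 * p) + - (q / T * u - e * w)\<^sup>2 / (2 * q)
     = - ((w + e * p / T * u)\<^sup>2 / p + (q / T * u - e * w)\<^sup>2 / q) / 2"
    by (simp add: field_simps)
  also have "\<dots> = - u\<^sup>2 / (2 * T) + - w\<^sup>2 / (2 * (p * q / T))"
    unfolding b by (simp add: field_simps)
  finally have 2: "- (w + e * p / T * u)\<^sup>2 / (2 * p) + - (q / T * u - e * w)\<^sup>2 / (2 * q)
     = - u\<^sup>2 / (2 * T) + - w\<^sup>2 / (2 * (p * q / T))" .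
  have "normal_density 0 (sqrt p) (w + e * p / T * u)
       * normal_density 0 (sqrt q) (q / T * u - e * w)
     = 1 / (sqrt (2 * pi * p) * sqrt (2 * pi * q))
       * exp (- (w + e * p / T * u)\<^sup>2 / (2 * p) + - (q / T * u - e * w)\<^sup>2 / (2 * q))"
    using assms(1,2) by (simp add: normal_density_def mult_exp_exp)
  also have "\<dots> = normal_density 0 (sqrt T) u * normal_density 0 (sqrt (p * q / T)) w"
    unfolding 1 2 exp_add using assms(1,2) \<open>T > 0\<close> by (simp add: normal_density_def)
  finally show ?thesis unfolding a .
qed

lemma gdens_split:
  assumes "p > 0" "q > 0" and T: "T = e\<^sup>2 * p + q"
  shows "gdens p (w + (e * p / T) *\<^sub>R u) * gdens q (u - e *\<^sub>R (w + (e * p / T) *\<^sub>R u))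
     = gdens T u * gdens (p * q / T) w"
  unfolding gdens_def prod.distrib[symmetric]
  using normal_density_split[OF assms] by (intro prod.cong) simp_all

lemma nn_integral_lborel_translate:
  fixes c :: "'a::euclidean_space"
  assumes [measurable]: "g \<in> borel_measurable borel"
  shows "(\<integral>\<^sup>+x. g x \<partial>lborel) = (\<integral>\<^sup>+x. g (x + c) \<partial>lborel)"
proof -
  have "(\<integral>\<^sup>+x. g x \<partial>lborel) = (\<integral>\<^sup>+x. g x \<partial>(distr lborel borel (\<lambda>x. c + x)))"
    by (simp add: lborel_distr_plus)
  then show ?thesis by (simp add: nn_integral_distr add.commute)
qed

text \<open>Only translations are needed: substitute \<open>r = u - e y\<close>, and then \<open>y = w + (e p / T) u\<close>.\<close>

lemma nn_integral_gdens_split: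
  fixes \<phi> :: "real ^ 'n \<Rightarrow> real ^ 'n \<Rightarrow> ennreal"
  assumes "p > 0" "q > 0" and T: "T = e\<^sup>2 * p + q"
    and [measurable]: "(\<lambda>(u, w). \<phi> u w) \<in> borel_measurable (borel \<Otimes>\<^sub>M borel)"
  shows "(\<integral>\<^sup>+y. \<integral>\<^sup>+r. \<phi> (e *\<^sub>R y + r) (y - (e * p / T) *\<^sub>R (e *\<^sub>R y + r)) * gdens q r * gdens p y \<partial>lborel \<partial>lborel)
    = (\<integral>\<^sup>+u. \<integral>\<^sup>+w. \<phi> u w * gdens (p * q / T) w * gdens T u \<partial>lborel \<partial>lborel)"
proof -
  define \<beta> where "\<beta> = e * p / T"
  have "(\<integral>\<^sup>+y. \<integral>\<^sup>+r. \<phi> (e *\<^sub>R y + r) (y - \<beta> *\<^sub>R (e *\<^sub>R y + r)) * gdens q r * gdens p y \<partial>lborel \<partial>lborel)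
      = (\<integral>\<^sup>+y. \<integral>\<^sup>+u. \<phi> u (y - \<beta> *\<^sub>R u) * gdens q (u - e *\<^sub>R y) * gdens p y \<partial>lborel \<partial>lborel)"
  proof (rule nn_integral_cong)
    fix y :: "real ^ 'n"
    show "(\<integral>\<^sup>+r. \<phi> (e *\<^sub>R y + r) (y - \<beta> *\<^sub>R (e *\<^sub>R y + r)) * gdens q r * gdens p y \<partial>lborel)
      = (\<integral>\<^sup>+u. \<phi> u (y - \<beta> *\<^sub>R u) * gdens q (u - e *\<^sub>R y) * gdens p y \<partial>lborel)"
      by (subst nn_integral_lborel_translate[of "\<lambda>u. \<phi> u (y - \<beta> *\<^sub>R u) * gdens q (u - e *\<^sub>R y) * gdens p y" "e *\<^sub>R y"])
        (auto simp: add.commute)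
  qed
  also have "\<dots> = (\<integral>\<^sup>+u. \<integral>\<^sup>+y. \<phi> u (y - \<beta> *\<^sub>R u) * gdens q (u - e *\<^sub>R y) * gdens p y \<partial>lborel \<partial>lborel)"
    by (intro lborel_pair.Fubini') measurable
  also have "\<dots> = (\<integral>\<^sup>+u. \<integral>\<^sup>+w. \<phi> u w * gdens (p * q / T) w * gdens T u \<partial>lborel \<partial>lborel)"
  proof (rule nn_integral_cong)
    fix u :: "real ^ 'n"
    have "(\<integral>\<^sup>+y. \<phi> u (y - \<beta> *\<^sub>R u) * gdens q (u - e *\<^sub>R y) * gdens p y \<partial>lborel)
      = (\<integral>\<^sup>+w. \<phi> u w * gdens q (u - e *\<^sub>R (w + \<beta> *\<^sub>R u)) * gdens p (w + \<beta> *\<^sub>R u) \<partial>lborel)"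
      by (subst nn_integral_lborel_translate[of _ "\<beta> *\<^sub>R u"]) auto
    also have "\<dots> = (\<integral>\<^sup>+w. \<phi> u w * (ennreal (gdens p (w + \<beta> *\<^sub>R u) * gdens q (u - e *\<^sub>R (w + \<beta> *\<^sub>R u)))) \<partial>lborel)"
      by (intro nn_integral_cong) (simp add: ennreal_mult ac_simps)
    also have "\<dots> = (\<integral>\<^sup>+w. \<phi> u w * gdens (p * q / T) w * gdens T u \<partial>lborel)"
      unfolding \<beta>_def gdens_split[OF assms(1-3)]
      by (intro nn_integral_cong) (simp add: ennreal_mult ac_simps)
    finally show "(\<integral>\<^sup>+y. \<phi> u (y - \<beta> *\<^sub>R u) * gdens q (u - e *\<^sub>R y) * gdens p y \<partial>lborel)
      = (\<integral>\<^sup>+w. \<phi> u w * gdens (p * q / T) w * gdens T u \<partial>lborel)" .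
  qed
  finally show ?thesis unfolding \<beta>_def .
qed

lemma nn_integral_gdens_scale:
  fixes \<phi> :: "real ^ 'n \<Rightarrow> ennreal"
  assumes c: "c > 0" and v: "v > 0" and [measurable]: "\<phi> \<in> borel_measurable borel"
  shows "(\<integral>\<^sup>+y. \<phi> y * gdens (c\<^sup>2 * v) y \<partial>lborel) = (\<integral>\<^sup>+y. \<phi> (c *\<^sub>R y) * gdens v y \<partial>lborel)"
proof -
  have g: "gdens (c\<^sup>2 * v) (c *\<^sub>R y) * c ^ CARD('n) = gdens v y" for y :: "real ^ 'n"
  proof -
    have "c\<^sup>2 * v > 0" using c v by simp
    have "(1 / sqrt (2 * pi * (c\<^sup>2 * v))) * c = 1 / sqrt (2 * pi * v)"
      using c v by (simp add: real_sqrt_mult)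
    then have "(1 / sqrt (2 * pi * (c\<^sup>2 * v))) ^ CARD('n) * c ^ CARD('n) = (1 / sqrt (2 * pi * v)) ^ CARD('n)"
      by (simp only: power_mult_distrib[symmetric])
    moreover have "- (norm (c *\<^sub>R y))\<^sup>2 / (2 * (c\<^sup>2 * v)) = - (norm y)\<^sup>2 / (2 * v)"
      using c v by (simp add: power_mult_distrib)
    moreover have "A * e * C = (A * C) * e" for A e C :: real by (simp only: ac_simps)
    ultimately show ?thesis
      unfolding gdens_eq[OF v] gdens_eq[OF \<open>c\<^sup>2 * v > 0\<close>] by (simp only:)
  qed
  have "(\<integral>\<^sup>+y. \<phi> y * gdens (c\<^sup>2 * v) y \<partial>lborel)
    = (\<integral>\<^sup>+y. \<phi> y * gdens (c\<^sup>2 * v) y \<partial>density (distr lborel borel (\<lambda>x :: real^'n. 0 + c *\<^sub>R x)) (\<lambda>_. \<bar>c\<bar> ^ DIM(real^'n)))"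
    using c by (subst lborel_affine[of c 0]) auto
  also have "\<dots> = (\<integral>\<^sup>+y. ennreal (c ^ CARD('n)) * (\<phi> (c *\<^sub>R y) * gdens (c\<^sup>2 * v) (c *\<^sub>R y)) \<partial>lborel)"
    using c by (simp add: nn_integral_density nn_integral_distr)
  also have "\<dots> = (\<integral>\<^sup>+y. \<phi> (c *\<^sub>R y) * gdens v y \<partial>lborel)"
  proof (rule nn_integral_cong)
    fix y :: "real ^ 'n"
    have "ennreal (c ^ CARD('n)) * (\<phi> (c *\<^sub>R y) * gdens (c\<^sup>2 * v) (c *\<^sub>R y))
      = \<phi> (c *\<^sub>R y) * (ennreal (gdens (c\<^sup>2 * v) (c *\<^sub>R y)) * ennreal (c ^ CARD('n)))"
      by (simp only: ac_simps)
    then show "ennreal (c ^ CARD('n)) * (\<phi> (c *\<^sub>R y) * gdens (c\<^sup>2 * v) (c *\<^sub>R y)) = \<phi> (c *\<^sub>R y) * gdens v y"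
      using c by (simp flip: ennreal_mult add: g)
  qed
  finally show ?thesis .
qed

lemma power_mult_exp_bounded:
  fixes b :: real
  assumes "b > 0"
  obtains C where "C > 0" "\<And>r. 0 \<le> r \<Longrightarrow> (1 + r) ^ N * exp (- b * r\<^sup>2) \<le> C"
proof -
  have "(1 + r) ^ N * exp (- b * r\<^sup>2) \<le> exp ((real N)\<^sup>2 / (4 * b))" if "0 \<le> r" for r
  proof -
    \<comment> \<open>Bound the power by \<open>exp (N r)\<close> and complete the square.\<close>
    have "(1 + r) ^ N \<le> exp r ^ N"
      using that by (intro power_mono) auto
    then have "(1 + r) ^ N * exp (- b * r\<^sup>2) \<le> exp (real N * r) * exp (- b * r\<^sup>2)"
      by (intro mult_right_mono) (auto simp: exp_of_nat_mult)
    also have "\<dots> = exp (real N * r - b * r\<^sup>2)"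
      by (simp add: mult_exp_exp)
    also have "\<dots> \<le> exp ((real N)\<^sup>2 / (4 * b))"
    proof -
      have "0 \<le> b * (r - real N / (2 * b))\<^sup>2" using assms by simp
      also have "b * (r - real N / (2 * b))\<^sup>2 = b * r\<^sup>2 - real N * r + (real N)\<^sup>2 / (4 * b)"
        using assms by (simp add: power2_eq_square field_simps)
      finally show ?thesis by simp
    qed
    finally show ?thesis .
  qed
  then show thesis using that[of "exp ((real N)\<^sup>2 / (4 * b))"] by simp
qed

lemma integrable_power_mult_gauss:
  assumes "b > 0"
  shows "integrable lborel (\<lambda>z. (1 + norm (z :: real ^ 'n)) ^ N * exp (- b * (norm z)\<^sup>2))"
proof -
  obtain C where C: "C > 0" "\<And>r. 0 \<le> r \<Longrightarrow> (1 + r) ^ N * exp (- (b/2) * r\<^sup>2) \<le> C"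
    using power_mult_exp_bounded[of "b/2" N] assms by auto
  define v where "v = 1 / b"
  have v: "v > 0" using assms by (simp add: v_def)
  have "integrable lborel (gdens v :: real ^ 'n \<Rightarrow> real)"
    by (intro integrableI_nonneg) (auto simp: nn_integral_gdens[OF v])
  then have "integrable lborel (\<lambda>z. C * sqrt (2 * pi * v) ^ CARD('n) * gdens v (z :: real ^ 'n))"
    by simp
  then show ?thesis
  proof (rule Bochner_Integration.integrable_bound)
    show "AE z in lborel. norm ((1 + norm (z :: real ^ 'n)) ^ N * exp (- b * (norm z)\<^sup>2))
      \<le> norm (C * sqrt (2 * pi * v) ^ CARD('n) * gdens v z)"
    proof (intro AE_I2)
      fix z :: "real ^ 'n"
      have "(1 + norm z) ^ N * exp (- b * (norm z)\<^sup>2)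
         = ((1 + norm z) ^ N * exp (- (b/2) * (norm z)\<^sup>2)) * exp (- (b/2) * (norm z)\<^sup>2)"
        by (simp add: mult.assoc mult_exp_exp)
      also have "\<dots> \<le> C * exp (- (b/2) * (norm z)\<^sup>2)"
        by (intro mult_right_mono C) auto
      also have "\<dots> = C * sqrt (2 * pi * v) ^ CARD('n) * gdens v z"
        using v by (simp add: gdens_eq power_one_over) (simp add: v_def)
      finally show "norm ((1 + norm z) ^ N * exp (- b * (norm z)\<^sup>2))
         \<le> norm (C * sqrt (2 * pi * v) ^ CARD('n) * gdens v z)"
        using C v by (simp add: abs_mult)
    qed
  qed simp
qed

section \<open>Measurability and differentiation of integrals\<close>

text \<open>A process with continuous paths is jointly measurable, as the limit of its discretisations
  in time.\<close>

lemma measurable_continuous_process: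
  fixes Z :: "real \<Rightarrow> 'w \<Rightarrow> 'b::metric_space"
  assumes [measurable]: "\<And>s. Z s \<in> borel_measurable G"
    and cont: "\<And>\<omega>. \<omega> \<in> space G \<Longrightarrow> continuous_on UNIV (\<lambda>s. Z s \<omega>)"
  shows "(\<lambda>p. Z (fst p) (snd p)) \<in> borel_measurable (borel \<Otimes>\<^sub>M G)"
proof (rule borel_measurable_LIMSEQ_metric)
  define d where "d n s = real_of_int \<lfloor>real (Suc n) * s\<rfloor> / real (Suc n)" for n and s :: real
  show "(\<lambda>p. Z (d n (fst p)) (snd p)) \<in> borel_measurable (borel \<Otimes>\<^sub>M G)" for n
    unfolding d_def
    by (rule measurable_compose_countable[where f = "\<lambda>i p. Z (real_of_int i / real (Suc n)) (snd p)"]) measurable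
  fix p :: "real \<times> 'w" assume p: "p \<in> space (borel \<Otimes>\<^sub>M G)"
  have "(\<lambda>n. d n (fst p)) \<longlonglongrightarrow> fst p"
  proof (rule tendsto_sandwich[of "\<lambda>n. fst p - 1 / real (Suc n)" _ _ "\<lambda>n. fst p"])
    show "\<forall>\<^sub>F n in sequentially. fst p - 1 / real (Suc n) \<le> d n (fst p)"
    proof (intro always_eventually allI)
      fix n
      have "real (Suc n) * fst p - 1 \<le> real_of_int \<lfloor>real (Suc n) * fst p\<rfloor>" by linarith
      then have "(real (Suc n) * fst p - 1) / real (Suc n) \<le> d n (fst p)"
        unfolding d_def by (intro divide_right_mono) auto
      then show "fst p - 1 / real (Suc n) \<le> d n (fst p)"
        by (simp add: diff_divide_distrib del: of_nat_Suc)
    qed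
    show "\<forall>\<^sub>F n in sequentially. d n (fst p) \<le> fst p"
    proof (intro always_eventually allI)
      fix n
      have "d n (fst p) \<le> real (Suc n) * fst p / real (Suc n)"
        unfolding d_def by (intro divide_right_mono) linarith+
      then show "d n (fst p) \<le> fst p" by (simp del: of_nat_Suc)
    qed
    show "(\<lambda>n. fst p - 1 / real (Suc n)) \<longlonglongrightarrow> fst p"
      using tendsto_diff[OF tendsto_const LIMSEQ_Suc[OF lim_1_over_n[where 'a = real]], of "fst p"] by simp
  qed simp
  moreover have "isCont (\<lambda>s. Z s (snd p)) (fst p)"
    using cont[of "snd p"] p by (auto simp: space_pair_measure continuous_on_eq_continuous_at)
  ultimately show "(\<lambda>n. Z (d n (fst p)) (snd p)) \<longlonglongrightarrow> Z (fst p) (snd p)"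
    by (rule isCont_tendsto_compose[rotated])
qed

text \<open>Differentiation under the integral sign with respect to a parameter in a Euclidean space: by the
  mean value inequality the difference quotients are dominated, too.\<close>

lemma has_derivative_integral_dominated:
  fixes h :: "'a::euclidean_space \<Rightarrow> 'p \<Rightarrow> 'b::{banach, second_countable_topology}"
  assumes r: "r > 0"
    and int: "\<And>x. x \<in> ball x0 r \<Longrightarrow> integrable \<mu> (h x)"
    and der: "\<And>p x. p \<in> space \<mu> \<Longrightarrow> x \<in> ball x0 r \<Longrightarrow> ((\<lambda>x. h x p) has_derivative h' x p) (at x)"
    and meas: "\<And>k. (\<lambda>p. h' x0 p k) \<in> borel_measurable \<mu>"
    and dom: "\<And>p x k. p \<in> space \<mu> \<Longrightarrow> x \<in> ball x0 r \<Longrightarrow> norm (h' x p k) \<le> D p * norm k"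
    and D: "integrable \<mu> D"
  shows "((\<lambda>x. \<integral>p. h x p \<partial>\<mu>) has_derivative (\<lambda>k. \<integral>p. h' x0 p k \<partial>\<mu>)) (at x0)"
proof -
  have x0: "x0 \<in> ball x0 r" using r by simp
  have int': "integrable \<mu> (\<lambda>p. h' x0 p k)" for k
    by (rule Bochner_Integration.integrable_bound[of _ "\<lambda>p. D p * norm k"])
      (use D meas dom[OF _ x0] in \<open>auto intro!: order_trans[OF _ abs_ge_self]\<close>)
  have lin: "bounded_linear (h' x0 p)" if "p \<in> space \<mu>" for p
    using der[OF that x0] by (rule has_derivative_bounded_linear)
  have bl: "bounded_linear (\<lambda>k. \<integral>p. h' x0 p k \<partial>\<mu>)"
  proof (rule bounded_linear_intro[where K = "\<integral>p. D p \<partial>\<mu>"])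
    show "(\<integral>p. h' x0 p (k + l) \<partial>\<mu>) = (\<integral>p. h' x0 p k \<partial>\<mu>) + (\<integral>p. h' x0 p l \<partial>\<mu>)" for k l
      unfolding Bochner_Integration.integral_add[OF int' int', symmetric]
      using lin by (intro Bochner_Integration.integral_cong) (auto simp: linear_simps)
    show "(\<integral>p. h' x0 p (c *\<^sub>R k) \<partial>\<mu>) = c *\<^sub>R (\<integral>p. h' x0 p k \<partial>\<mu>)" for c k
      unfolding integral_scaleR_right[symmetric]
      using lin by (intro Bochner_Integration.integral_cong) (auto simp: linear_simps)
    show "norm (\<integral>p. h' x0 p k \<partial>\<mu>) \<le> norm k * (\<integral>p. D p \<partial>\<mu>)" for k
    proof -
      have "norm (\<integral>p. h' x0 p k \<partial>\<mu>) \<le> (\<integral>p. D p * norm k \<partial>\<mu>)"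
        by (rule order_trans[OF integral_norm_bound integral_mono]) (use D int' dom[OF _ x0] in auto)
      then show ?thesis by (simp add: mult.commute)
    qed
  qed
  have "((\<lambda>y. (1 / norm (y - x0)) *\<^sub>R
      ((\<integral>p. h y p \<partial>\<mu>) - ((\<integral>p. h x0 p \<partial>\<mu>) + (\<integral>p. h' x0 p (y - x0) \<partial>\<mu>)))) \<longlongrightarrow> 0) (at x0)"
    unfolding tendsto_at_iff_sequentially
  proof safe
    fix X assume X: "\<forall>i. X i \<in> UNIV - {x0}" and lim: "X \<longlonglongrightarrow> x0"
    obtain N where N: "\<And>i. i \<ge> N \<Longrightarrow> X i \<in> ball x0 r"
      using lim r by (auto simp: lim_sequentially dist_commute)
    define Q where "Q i p = (1 / norm (X (i + N) - x0)) *\<^sub>R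
       (h (X (i + N)) p - (h x0 p + h' x0 p (X (i + N) - x0)))" for i p
    have Xn: "X (i + N) \<in> ball x0 r" "norm (X (i + N) - x0) > 0" for i
      using N[of "i + N"] X by auto
    have lim': "(\<lambda>i. X (i + N)) \<longlonglongrightarrow> x0"
      using lim by (rule LIMSEQ_ignore_initial_segment)
    have "(\<lambda>i. \<integral>p. Q i p \<partial>\<mu>) \<longlonglongrightarrow> (\<integral>p. 0 \<partial>\<mu>)"
    proof (rule integral_dominated_convergence[where w = "\<lambda>p. 2 * D p"])
      show "Q i \<in> borel_measurable \<mu>" for i
        unfolding Q_def using int[OF Xn(1)] int[OF x0] meas by measurable
      show "AE p in \<mu>. (\<lambda>i. Q i p) \<longlonglongrightarrow> 0"
      proof (rule AE_I2)
        fix p assume "p \<in> space \<mu>"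
        from der[OF this x0]
        have "((\<lambda>y. (1 / norm (y - x0)) *\<^sub>R (h y p - (h x0 p + h' x0 p (y - x0)))) \<longlongrightarrow> 0) (at x0)"
          by (simp add: has_derivative_at2)
        with X lim' show "(\<lambda>i. Q i p) \<longlonglongrightarrow> 0"
          unfolding tendsto_at_iff_sequentially Q_def by (auto simp: comp_def)
      qed
      show "AE p in \<mu>. norm (Q i p) \<le> 2 * D p" for i
      proof (rule AE_I2)
        fix p assume p: "p \<in> space \<mu>"
        have "norm (h (X (i + N)) p - h x0 p) \<le> D p * norm (X (i + N) - x0)"
        proof (rule differentiable_bound[of "ball x0 r"])
          show "((\<lambda>x. h x p) has_derivative h' x p) (at x within ball x0 r)" if "x \<in> ball x0 r" for x
            using der[OF p that] by (rule has_derivative_at_withinI)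
          show "onorm (h' x p) \<le> D p" if "x \<in> ball x0 r" for x
          proof (rule onorm_le)
            show "norm (h' x p k) \<le> D p * norm k" for k by (rule dom[OF p that])
          qed
        qed (use Xn x0 in auto)
        moreover have "norm (h' x0 p (X (i + N) - x0)) \<le> D p * norm (X (i + N) - x0)"
          by (rule dom[OF p x0])
        ultimately have "norm (h (X (i + N)) p - (h x0 p + h' x0 p (X (i + N) - x0)))
            \<le> 2 * D p * norm (X (i + N) - x0)"
          using norm_triangle_ineq4[of "h (X (i + N)) p - h x0 p" "h' x0 p (X (i + N) - x0)"]
          by (simp add: algebra_simps)
        then show "norm (Q i p) \<le> 2 * D p"
          unfolding Q_def using Xn(2)[of i] by (simp add: pos_divide_le_eq)
      qed
    qed (use D in auto)
    moreover have "(\<integral>p. Q i p \<partial>\<mu>) = (1 / norm (X (i + N) - x0)) *\<^sub>R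
      ((\<integral>p. h (X (i + N)) p \<partial>\<mu>) - ((\<integral>p. h x0 p \<partial>\<mu>) + (\<integral>p. h' x0 p (X (i + N) - x0) \<partial>\<mu>)))" for i
      unfolding Q_def using int[OF Xn(1)] int[OF x0] int' by simp
    ultimately have "(\<lambda>i. (1 / norm (X (i + N) - x0)) *\<^sub>R
      ((\<integral>p. h (X (i + N)) p \<partial>\<mu>) - ((\<integral>p. h x0 p \<partial>\<mu>) + (\<integral>p. h' x0 p (X (i + N) - x0) \<partial>\<mu>)))) \<longlonglongrightarrow> 0"
      by simp
    then show "((\<lambda>y. (1 / norm (y - x0)) *\<^sub>R
      ((\<integral>p. h y p \<partial>\<mu>) - ((\<integral>p. h x0 p \<partial>\<mu>) + (\<integral>p. h' x0 p (y - x0) \<partial>\<mu>)))) \<circ> X) \<longlonglongrightarrow> 0"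
      unfolding comp_def by (rule LIMSEQ_offset)
  qed
  with bl show ?thesis unfolding has_derivative_at2 by simp
qed

section \<open>Gaussian vectors independent of a sigma-algebra\<close>

text \<open>\<open>D\<close> is centred Gaussian with covariance \<open>v Id\<close>, \<open>v > 0\<close>, and independent of the
  sigma-algebra \<open>G\<close>.\<close>

definition gauss_indep :: "'w measure \<Rightarrow> 'w measure \<Rightarrow> ('w \<Rightarrow> real ^ 'n) \<Rightarrow> real \<Rightarrow> bool" where
  "gauss_indep M G D v \<longleftrightarrow> D \<in> borel_measurable M \<and> 0 < v \<and>
     (\<forall>A\<in>sets G. \<forall>S\<in>sets borel. emeasure M (A \<inter> (D -` S \<inter> space M)) =
        emeasure M A * emeasure (density lborel (\<lambda>z. ennreal (gdens v z))) S)"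

lemma measurable_subalgebra_ident: "subalgebra M G \<Longrightarrow> (\<lambda>\<omega>. \<omega>) \<in> measurable M G"
  by (rule measurableI) (auto simp: subalgebra_def Int_absorb2 dest: sets.sets_into_space)

lemma gauss_indep_distr:
  assumes gi: "gauss_indep M G D v" and sub: "subalgebra M G" and "prob_space M"
  shows "distr M (borel \<Otimes>\<^sub>M G) (\<lambda>\<omega>. (D \<omega>, \<omega>))
    = density lborel (\<lambda>z. ennreal (gdens v z)) \<Otimes>\<^sub>M restr_to_subalg M G"
proof -
  interpret M: prob_space M by fact
  have v: "v > 0" and [measurable]: "D \<in> borel_measurable M" using gi by (auto simp: gauss_indep_def)
  interpret N: prob_space "density lborel (\<lambda>z. ennreal (gdens v z)) :: (real^'b) measure"
    using v by (rule prob_space_gdens)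
  interpret R: prob_space "restr_to_subalg M G"
    using sub assms(3) by (rule prob_space_restr_to_subalg)
  have sG: "space G = space M" "sets G \<subseteq> sets M" using sub by (auto simp: subalgebra_def)
  have [measurable]: "(\<lambda>\<omega>. \<omega>) \<in> measurable M G" by (rule measurable_subalgebra_ident[OF sub])
  show ?thesis
  proof (rule pair_measure_eqI[symmetric])
    show "sets (density lborel (\<lambda>z. ennreal (gdens v z)) \<Otimes>\<^sub>M restr_to_subalg M G)
       = sets (distr M (borel \<Otimes>\<^sub>M G) (\<lambda>\<omega>. (D \<omega>, \<omega>)))"
      by (simp add: sets_restr_to_subalg[OF sub] cong: sets_pair_measure_cong)
    fix S :: "(real^'b) set" and A assume "S \<in> sets (density lborel (\<lambda>z. ennreal (gdens v z)))" and A: "A \<in> sets (restr_to_subalg M G)"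
    then have S: "S \<in> sets borel" and A': "A \<in> sets G" by (auto simp: sets_restr_to_subalg[OF sub])
    have "emeasure (distr M (borel \<Otimes>\<^sub>M G) (\<lambda>\<omega>. (D \<omega>, \<omega>))) (S \<times> A)
      = emeasure M ((\<lambda>\<omega>. (D \<omega>, \<omega>)) -` (S \<times> A) \<inter> space M)"
      using S A' by (subst emeasure_distr) auto
    also have "(\<lambda>\<omega>. (D \<omega>, \<omega>)) -` (S \<times> A) \<inter> space M = A \<inter> (D -` S \<inter> space M)"
      by auto
    finally show "emeasure (density lborel (\<lambda>z. ennreal (gdens v z))) S * emeasure (restr_to_subalg M G) A
       = emeasure (distr M (borel \<Otimes>\<^sub>M G) (\<lambda>\<omega>. (D \<omega>, \<omega>))) (S \<times> A)"
      using gi S A' by (simp add: gauss_indep_def emeasure_restr_to_subalg[OF sub A'] mult.commute)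
  qed unfold_locales
qed

text \<open>The freezing lemma: an independent argument is integrated out separately.\<close>

lemma nn_integral_gauss_indep:
  fixes D :: "'w \<Rightarrow> real ^ 'n"
  assumes gi: "gauss_indep M G D v" and sub: "subalgebra M G" and "prob_space M"
    and [measurable]: "\<psi> \<in> borel_measurable (borel \<Otimes>\<^sub>M G)"
  shows "(\<integral>\<^sup>+\<omega>. \<psi> (D \<omega>, \<omega>) \<partial>M) = (\<integral>\<^sup>+y. (\<integral>\<^sup>+\<omega>. \<psi> (y, \<omega>) \<partial>M) * gdens v y \<partial>lborel)"
proof -
  interpret M: prob_space M by fact
  have v: "v > 0" and [measurable]: "D \<in> borel_measurable M" using gi by (auto simp: gauss_indep_def)
  interpret R: prob_space "restr_to_subalg M G"
    using sub assms(3) by (rule prob_space_restr_to_subalg)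
  have sG: "space G = space M" "sets G \<subseteq> sets M" using sub by (auto simp: subalgebra_def)
  have [measurable]: "(\<lambda>\<omega>. \<omega>) \<in> measurable M G" by (rule measurable_subalgebra_ident[OF sub])
  have [measurable_cong]: "sets (restr_to_subalg M G) = sets G" by (rule sets_restr_to_subalg[OF sub])
  have "(\<integral>\<^sup>+\<omega>. \<psi> (D \<omega>, \<omega>) \<partial>M) = (\<integral>\<^sup>+p. \<psi> p \<partial>distr M (borel \<Otimes>\<^sub>M G) (\<lambda>\<omega>. (D \<omega>, \<omega>)))"
    by (subst nn_integral_distr) auto
  also have "\<dots> = (\<integral>\<^sup>+y. \<integral>\<^sup>+\<omega>. \<psi> (y, \<omega>) \<partial>restr_to_subalg M G \<partial>density lborel (\<lambda>z. ennreal (gdens v z)))"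
    unfolding gauss_indep_distr[OF assms(1-3)]
    by (subst R.nn_integral_fst[symmetric]) auto
  also have "\<dots> = (\<integral>\<^sup>+y. gdens v y * (\<integral>\<^sup>+\<omega>. \<psi> (y, \<omega>) \<partial>restr_to_subalg M G) \<partial>lborel)"
    by (subst nn_integral_density) auto
  also have "\<dots> = (\<integral>\<^sup>+y. gdens v y * (\<integral>\<^sup>+\<omega>. \<psi> (y, \<omega>) \<partial>M) \<partial>lborel)"
    by (intro nn_integral_cong arg_cong2[where f = "(*)"] refl nn_integral_subalgebra2 sub) measurable
  finally show ?thesis by (simp add: mult.commute)
qed

lemma gauss_indep_law:
  assumes gi: "gauss_indep M G D v" and sub: "subalgebra M G" and "prob_space M"
    and [measurable]: "g \<in> borel_measurable borel"
  shows "(\<integral>\<^sup>+\<omega>. g (D \<omega>) \<partial>M) = (\<integral>\<^sup>+y. g y * gdens v y \<partial>lborel)"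
proof -
  interpret M: prob_space M by fact
  show ?thesis
    using nn_integral_gauss_indep[OF gi sub assms(3), of "\<lambda>p. g (fst p)"] by (simp add: M.emeasure_space_1)
qed

lemma gauss_indepI:
  fixes D :: "'w \<Rightarrow> real ^ 'n"
  assumes [measurable]: "D \<in> borel_measurable M" and "0 < v" and sub: "subalgebra M G"
    and eq: "\<And>A S. A \<in> sets G \<Longrightarrow> S \<in> sets borel \<Longrightarrow>
      (\<integral>\<^sup>+\<omega>. indicator A \<omega> * indicator S (D \<omega>) \<partial>M) = (\<integral>\<^sup>+y. emeasure M A * indicator S y * gdens v y \<partial>lborel)"
  shows "gauss_indep M G D v"
  unfolding gauss_indep_def
proof (intro conjI ballI)
  fix A and S :: "(real^'n) set" assume A: "A \<in> sets G" and S[measurable]: "S \<in> sets borel"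
  have [measurable]: "A \<in> sets M" using A sub by (auto simp: subalgebra_def)
  have "emeasure M (A \<inter> (D -` S \<inter> space M)) = (\<integral>\<^sup>+\<omega>. indicator (A \<inter> (D -` S \<inter> space M)) \<omega> \<partial>M)"
    by (subst nn_integral_indicator) auto
  also have "\<dots> = (\<integral>\<^sup>+\<omega>. indicator A \<omega> * indicator S (D \<omega>) \<partial>M)"
    by (intro nn_integral_cong) (auto simp: indicator_def)
  also have "\<dots> = (\<integral>\<^sup>+y. emeasure M A * (ennreal (gdens v y) * indicator S y) \<partial>lborel)"
    unfolding eq[OF A S] by (intro nn_integral_cong) (simp add: indicator_def)
  also have "\<dots> = emeasure M A * (\<integral>\<^sup>+y. ennreal (gdens v y) * indicator S y \<partial>lborel)"
    by (rule nn_integral_cmult) measurable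
  also have "(\<integral>\<^sup>+y. ennreal (gdens v y) * indicator S y \<partial>lborel) = emeasure (density lborel (\<lambda>z. ennreal (gdens v z))) S"
    by (rule emeasure_density[symmetric]) (use S in auto)
  finally show "emeasure M (A \<inter> (D -` S \<inter> space M))
      = emeasure M A * emeasure (density lborel (\<lambda>z. ennreal (gdens v z))) S" .
qed (use assms in auto)

lemma gauss_indep_cong_AE:
  fixes D :: "'w \<Rightarrow> real ^ 'n"
  assumes gi: "gauss_indep M G D v" and sub: "subalgebra M G"
    and [measurable]: "E \<in> borel_measurable M" and eq: "AE \<omega> in M. D \<omega> = E \<omega>"
  shows "gauss_indep M G E v"
  unfolding gauss_indep_def
proof (intro conjI ballI)
  have [measurable]: "D \<in> borel_measurable M" using gi by (simp add: gauss_indep_def)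
  fix A and S :: "(real^'n) set" assume A: "A \<in> sets G" and S[measurable]: "S \<in> sets borel"
  have [measurable]: "A \<in> sets M" using A sub by (auto simp: subalgebra_def)
  have "emeasure M (A \<inter> (E -` S \<inter> space M)) = emeasure M (A \<inter> (D -` S \<inter> space M))"
    by (rule emeasure_eq_AE) (use eq in auto)
  then show "emeasure M (A \<inter> (E -` S \<inter> space M))
      = emeasure M A * emeasure (density lborel (\<lambda>z. ennreal (gdens v z))) S"
    using gi A S by (simp add: gauss_indep_def)
qed (use gi in \<open>auto simp: gauss_indep_def\<close>)

lemma gauss_indep_sum:
  fixes D E :: "'w \<Rightarrow> real ^ 'n"
  assumes D: "gauss_indep M G D p" and E: "gauss_indep M H E q"
    and G: "subalgebra M G" and H: "subalgebra M H" and GH: "subalgebra H G"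
    and [measurable]: "D \<in> borel_measurable H" and M: "prob_space M"
  shows "gauss_indep M G (\<lambda>\<omega>. e *\<^sub>R D \<omega> + E \<omega>) (e\<^sup>2 * p + q)"
proof -
  interpret M: prob_space M by fact
  have p: "p > 0" and q: "q > 0" and [measurable]: "D \<in> borel_measurable M" "E \<in> borel_measurable M"
    using D E by (auto simp: gauss_indep_def)
  have T: "e\<^sup>2 * p + q > 0" using p q by (simp add: add_nonneg_pos)
  show ?thesis
  proof (rule gauss_indepI)
    fix A and S :: "(real^'n) set" assume A: "A \<in> sets G" and S[measurable]: "S \<in> sets borel"
    have [measurable]: "A \<in> sets M" "A \<in> sets H" using A G GH by (auto simp: subalgebra_def)
    have "(\<integral>\<^sup>+\<omega>. indicator A \<omega> * indicator S (e *\<^sub>R D \<omega> + E \<omega>) \<partial>M)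
        = (\<integral>\<^sup>+r. (\<integral>\<^sup>+\<omega>. indicator A \<omega> * indicator S (e *\<^sub>R D \<omega> + r) \<partial>M) * gdens q r \<partial>lborel)"
      using nn_integral_gauss_indep[OF E H M, of "\<lambda>(r, \<omega>). indicator A \<omega> * indicator S (e *\<^sub>R D \<omega> + r)"]
      by simp
    also have "\<dots> = (\<integral>\<^sup>+r. (\<integral>\<^sup>+y. (\<integral>\<^sup>+\<omega>. indicator A \<omega> * indicator S (e *\<^sub>R y + r) \<partial>M) * gdens p y \<partial>lborel) * gdens q r \<partial>lborel)"
    proof (intro nn_integral_cong arg_cong2[where f = "(*)"] refl)
      fix r
      have "A \<in> sets G" by fact
      then show "(\<integral>\<^sup>+\<omega>. indicator A \<omega> * indicator S (e *\<^sub>R D \<omega> + r) \<partial>M)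
         = (\<integral>\<^sup>+y. (\<integral>\<^sup>+\<omega>. indicator A \<omega> * indicator S (e *\<^sub>R y + r) \<partial>M) * gdens p y \<partial>lborel)"
        using nn_integral_gauss_indep[OF D G M, of "\<lambda>(y, \<omega>). indicator A \<omega> * indicator S (e *\<^sub>R y + r)"]
        by simp
    qed
    also have "\<dots> = (\<integral>\<^sup>+r. \<integral>\<^sup>+y. emeasure M A * indicator S (e *\<^sub>R y + r) * gdens q r * gdens p y \<partial>lborel \<partial>lborel)"
      by (intro nn_integral_cong, subst nn_integral_multc[symmetric]) (auto simp: nn_integral_multc ac_simps)
    also have "\<dots> = (\<integral>\<^sup>+y. \<integral>\<^sup>+r. emeasure M A * indicator S (e *\<^sub>R y + r) * gdens q r * gdens p y \<partial>lborel \<partial>lborel)"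
      by (intro lborel_pair.Fubini') measurable
    also have "\<dots> = (\<integral>\<^sup>+u. \<integral>\<^sup>+(w :: real ^ 'n). emeasure M A * indicator S u
        * gdens (p * q / (e\<^sup>2 * p + q)) w * gdens (e\<^sup>2 * p + q) u \<partial>lborel \<partial>lborel)"
      using nn_integral_gdens_split[OF p q refl, where \<phi> = "\<lambda>u w. emeasure M A * indicator S u" and e = e] by simp
    also have "\<dots> = (\<integral>\<^sup>+u. emeasure M A * indicator S u * gdens (e\<^sup>2 * p + q) u \<partial>lborel)"
      using p q T by (intro nn_integral_cong) (simp add: nn_integral_multc nn_integral_cmult nn_integral_gdens)
    finally show "(\<integral>\<^sup>+\<omega>. indicator A \<omega> * indicator S (e *\<^sub>R D \<omega> + E \<omega>) \<partial>M)
       = (\<integral>\<^sup>+u. emeasure M A * indicator S u * gdens (e\<^sup>2 * p + q) u \<partial>lborel)" .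
  qed (use T G in auto)
qed

lemma gauss_indep_scale:
  fixes D :: "'w \<Rightarrow> real ^ 'n"
  assumes D: "gauss_indep M G D v" and sub: "subalgebra M G" and M: "prob_space M" and c: "c > 0"
  shows "gauss_indep M G (\<lambda>\<omega>. c *\<^sub>R D \<omega>) (c\<^sup>2 * v)"
proof (rule gauss_indepI)
  have v: "v > 0" and [measurable]: "D \<in> borel_measurable M" using D by (auto simp: gauss_indep_def)
  show "0 < c\<^sup>2 * v" using v c by simp
  show "(\<lambda>\<omega>. c *\<^sub>R D \<omega>) \<in> borel_measurable M" by measurable
  fix A and S :: "(real^'n) set" assume A: "A \<in> sets G" and S[measurable]: "S \<in> sets borel"
  have AM: "A \<in> sets M" using A sub by (auto simp: subalgebra_def)
  have [measurable]: "A \<in> sets G" by (rule A)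
  have "(\<integral>\<^sup>+\<omega>. indicator A \<omega> * indicator S (c *\<^sub>R D \<omega>) \<partial>M)
     = (\<integral>\<^sup>+y. (\<integral>\<^sup>+\<omega>. indicator A \<omega> * indicator S (c *\<^sub>R y) \<partial>M) * gdens v y \<partial>lborel)"
    using nn_integral_gauss_indep[OF D sub M, of "\<lambda>(y, \<omega>). indicator A \<omega> * indicator S (c *\<^sub>R y)"] by simp
  also have "\<dots> = (\<integral>\<^sup>+y. emeasure M A * indicator S (c *\<^sub>R y) * gdens v y \<partial>lborel)"
    using AM by (simp add: nn_integral_multc)
  also have "\<dots> = (\<integral>\<^sup>+y. emeasure M A * indicator S y * gdens (c\<^sup>2 * v) y \<partial>lborel)"
    by (rule nn_integral_gdens_scale[OF c v, symmetric]) measurable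
  finally show "(\<integral>\<^sup>+\<omega>. indicator A \<omega> * indicator S (c *\<^sub>R D \<omega>) \<partial>M)
     = (\<integral>\<^sup>+y. emeasure M A * indicator S y * gdens (c\<^sup>2 * v) y \<partial>lborel)" .
qed (rule sub)

text \<open>Since the variance \<open>v\<close> is the same for all \<open>n\<close>, no convergence of densities is involved.\<close>

lemma gauss_indep_lim:
  fixes D :: "'w \<Rightarrow> real ^ 'n"
  assumes gi: "\<And>n. gauss_indep M G (Dn n) v" and sub: "subalgebra M G" and M: "prob_space M"
    and [measurable]: "D \<in> borel_measurable M"
    and lim: "AE \<omega> in M. (\<lambda>n. Dn n \<omega>) \<longlonglongrightarrow> D \<omega>"
  shows "gauss_indep M G D v"
  unfolding gauss_indep_def
proof (intro conjI ballI)
  interpret M: prob_space M by fact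
  show v: "v > 0" using gi[of 0] by (simp add: gauss_indep_def)
  have [measurable]: "Dn n \<in> borel_measurable M" for n using gi by (simp add: gauss_indep_def)
  define N :: "(real^'n) measure" where "N = density lborel (\<lambda>z. ennreal (gdens v z))"
  interpret N: prob_space N unfolding N_def by (rule prob_space_gdens[OF v])
  fix A and S :: "(real^'n) set" assume A: "A \<in> sets G" and S: "S \<in> sets borel"
  have AM[measurable]: "A \<in> sets M" using A sub by (auto simp: subalgebra_def)
  define \<mu>1 where "\<mu>1 = distr (restrict_space M A) borel D"
  define \<mu>2 where "\<mu>2 = scale_measure (emeasure M A) N"
  have AE: "A \<inter> space M = A" using sets.sets_into_space[OF AM] by auto
  have [simp]: "sets \<mu>1 = sets borel" "sets \<mu>2 = sets borel" by (auto simp: \<mu>1_def \<mu>2_def N_def)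
  have [measurable]: "D \<in> borel_measurable (restrict_space M A)" by (rule measurable_restrict_space1) simp
  have e1: "emeasure \<mu>1 U = emeasure M (A \<inter> (D -` U \<inter> space M))" if "U \<in> sets borel" for U
  proof -
    have "emeasure \<mu>1 U = emeasure (restrict_space M A) (D -` U \<inter> A)"
      unfolding \<mu>1_def using that by (subst emeasure_distr) (auto simp: space_restrict_space AE)
    also have "\<dots> = emeasure M (D -` U \<inter> A)"
      by (rule emeasure_restrict_space) (auto simp: AE)
    also have "D -` U \<inter> A = A \<inter> (D -` U \<inter> space M)" using sets.sets_into_space[OF AM] by auto
    finally show ?thesis .
  qed
  have e2: "emeasure \<mu>2 U = emeasure M A * emeasure N U" for U
    unfolding \<mu>2_def by simp
  have fin1: "emeasure \<mu>1 U \<noteq> \<infinity>" if "U \<in> sets borel" for U using that by (simp add: e1 M.emeasure_eq_measure)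
  have fin2: "emeasure \<mu>2 U \<noteq> \<infinity>" for U by (simp add: e2 M.emeasure_eq_measure N.emeasure_eq_measure ennreal_mult[symmetric])
  have tot: "emeasure \<mu>1 UNIV = emeasure \<mu>2 UNIV"
  proof -
    have "emeasure N UNIV = 1" using N.emeasure_space_1 by (simp add: N_def)
    moreover have "emeasure \<mu>1 UNIV = emeasure M A"
      using e1[of UNIV] AE by simp
    ultimately show ?thesis by (simp add: e2)
  qed
  \<comment> \<open>Fatou's lemma bounds the limit law on open sets; outer regularity extends this to Borel sets.\<close>
  have op: "emeasure \<mu>1 U \<le> emeasure \<mu>2 U" if U: "open U" for U
  proof -
    have [measurable]: "U \<in> sets borel" using U by simp
    have [measurable]: "D -` U \<inter> space M \<in> sets M" by measurable
    have "A \<inter> (D -` U \<inter> space M) \<in> sets M" by measurable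
    then have "emeasure M (A \<inter> (D -` U \<inter> space M)) = (\<integral>\<^sup>+\<omega>. indicator (A \<inter> (D -` U \<inter> space M)) \<omega> \<partial>M)"
      by (rule nn_integral_indicator[symmetric])
    then have "emeasure \<mu>1 U = (\<integral>\<^sup>+\<omega>. indicator (A \<inter> (D -` U \<inter> space M)) \<omega> \<partial>M)"
      by (subst e1) simp_all
    also have "\<dots> \<le> (\<integral>\<^sup>+\<omega>. liminf (\<lambda>n. indicator (A \<inter> (Dn n -` U \<inter> space M)) \<omega>) \<partial>M)"
    proof (rule nn_integral_mono_AE, use lim in eventually_elim)
      fix \<omega> assume l: "(\<lambda>n. Dn n \<omega>) \<longlonglongrightarrow> D \<omega>"
      show "indicator (A \<inter> (D -` U \<inter> space M)) \<omega> \<le> liminf (\<lambda>n. indicator (A \<inter> (Dn n -` U \<inter> space M)) \<omega> :: ennreal)"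
      proof (cases "\<omega> \<in> A \<inter> (D -` U \<inter> space M)")
        case True
        then have "\<forall>\<^sub>F n in sequentially. Dn n \<omega> \<in> U"
          using topological_tendstoD[OF l U] by simp
        then have "\<forall>\<^sub>F n in sequentially. (1::ennreal) \<le> indicator (A \<inter> (Dn n -` U \<inter> space M)) \<omega>"
          by (rule eventually_mono) (use True in auto)
        then show ?thesis using True by (simp add: Liminf_bounded)
      qed simp
    qed
    also have "\<dots> \<le> liminf (\<lambda>n. \<integral>\<^sup>+\<omega>. indicator (A \<inter> (Dn n -` U \<inter> space M)) \<omega> \<partial>M)"
      by (rule nn_integral_liminf) measurable
    also have "(\<lambda>n. \<integral>\<^sup>+\<omega>. indicator (A \<inter> (Dn n -` U \<inter> space M)) \<omega> \<partial>M) = (\<lambda>n. emeasure \<mu>2 U)"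
      using gi A by (simp add: gauss_indep_def e2 N_def)
    finally show ?thesis by (simp add: Liminf_const)
  qed
  have le: "emeasure \<mu>1 B \<le> emeasure \<mu>2 B" if B: "B \<in> sets borel" for B
  proof -
    have "emeasure \<mu>1 B = (INF U \<in> {U. B \<subseteq> U \<and> open U}. emeasure \<mu>1 U)"
      using B fin1 by (intro outer_regular) (auto simp: \<mu>1_def)
    also have "\<dots> \<le> (INF U \<in> {U. B \<subseteq> U \<and> open U}. emeasure \<mu>2 U)"
      by (intro INF_mono) (use op in auto)
    also have "\<dots> = emeasure \<mu>2 B"
      using B fin2 by (intro outer_regular[symmetric]) (auto simp: \<mu>2_def N_def)
    finally show ?thesis .
  qed
  have "emeasure \<mu>1 S = emeasure \<mu>2 S"
  proof (rule antisym[OF le[OF S]])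
    have "emeasure \<mu>1 S + emeasure \<mu>1 (- S) = emeasure \<mu>1 UNIV"
      using S by (subst plus_emeasure) auto
    moreover have "emeasure \<mu>2 S + emeasure \<mu>2 (- S) = emeasure \<mu>2 UNIV"
      using S by (subst plus_emeasure) auto
    ultimately have "emeasure \<mu>2 S + emeasure \<mu>2 (- S) \<le> emeasure \<mu>1 S + emeasure \<mu>2 (- S)"
    proof -
      have "- S \<in> sets borel" using S by simp
      from add_left_mono[OF le[OF this], of "emeasure \<mu>1 S"] show ?thesis
        using \<open>emeasure \<mu>1 S + emeasure \<mu>1 (- S) = emeasure \<mu>1 UNIV\<close>
          \<open>emeasure \<mu>2 S + emeasure \<mu>2 (- S) = emeasure \<mu>2 UNIV\<close> tot by simp
    qed
    then show "emeasure \<mu>2 S \<le> emeasure \<mu>1 S"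
      using fin2[of "- S"] by (simp add: add.commute)
  qed
  then show "emeasure M (A \<inter> (D -` S \<inter> space M)) = emeasure M A * emeasure (density lborel (\<lambda>z. ennreal (gdens v z))) S"
    using e1[OF S] e2 by (simp add: N_def)
qed simp

section \<open>The Ornstein-Uhlenbeck process\<close>

lemma set_integral_eq_integral_Icc:
  fixes y :: "real \<Rightarrow> 'b::euclidean_space"
  assumes "continuous_on {s..t} y"
  shows "(LBINT r:{s..t}. y r) = integral {s..t} y"
  by (rule set_borel_integral_eq_integral(2)[OF borel_integrable_atLeastAtMost'[OF assms]])

text \<open>Applied to the difference of two solutions driven by the same noise, this shows how the
  process depends on its starting point.\<close>

lemma linear_integral_equation_unique:
  fixes d :: "real \<Rightarrow> 'b::euclidean_space"
  assumes cont: "continuous_on {0..} d"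
    and eq: "\<And>t. t \<ge> 0 \<Longrightarrow> d t = x - a *\<^sub>R (LBINT s:{0..t}. d s)" and T: "T \<ge> 0"
  shows "d T = exp (- a * T) *\<^sub>R x"
proof -
  have cT: "continuous_on {0..t} d" for t by (rule continuous_on_subset[OF cont]) auto
  have eq': "d t = x - a *\<^sub>R integral {0..t} d" if "t \<ge> 0" for t
    using eq[OF that] set_integral_eq_integral_Icc[OF cT] by simp
  have "((\<lambda>t. x - a *\<^sub>R integral {0..t} d) has_vector_derivative (- a *\<^sub>R d t)) (at t within {0..T})"
    if "t \<in> {0..T}" for t
    by (rule derivative_eq_intros integral_has_vector_derivative cT that refl)+ simp
  then have d': "(d has_vector_derivative (- a *\<^sub>R d t)) (at t within {0..T})" if "t \<in> {0..T}" for t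
    by (rule has_vector_derivative_transform[OF that, rotated]) (use that eq' in auto)
  have "((\<lambda>t. exp (a * t) *\<^sub>R d t) has_vector_derivative 0) (at t within {0..T})" if "t \<in> {0..T}" for t
  proof -
    have "((\<lambda>t. exp (a * t)) has_real_derivative a * exp (a * t)) (at t within {0..T})"
      by (auto intro!: derivative_eq_intros)
    from has_vector_derivative_scaleR[OF this d'[OF that]] show ?thesis by (simp add: mult.commute)
  qed
  then have "\<exists>c. \<forall>t\<in>{0..T}. exp (a * t) *\<^sub>R d t = c"
    unfolding has_vector_derivative_def by (intro has_derivative_zero_constant) auto
  then obtain c where "\<forall>t\<in>{0..T}. exp (a * t) *\<^sub>R d t = c" ..
  with T have "exp (a * T) *\<^sub>R d T = c" "exp (a * 0) *\<^sub>R d 0 = c" by (blast intro: atLeastAtMost_iff[THEN iffD2])+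
  then have "exp (a * T) *\<^sub>R d T = exp (a * 0) *\<^sub>R d 0" by (rule trans[OF _ sym])
  moreover have "d 0 = x" using eq'[of 0] by simp
  ultimately have "exp (- a * T) *\<^sub>R (exp (a * T) *\<^sub>R d T) = exp (- a * T) *\<^sub>R x" by simp
  then show ?thesis by (simp add: mult_exp_exp)
qed

text \<open>The weight of the Brownian increment over \<open>[r, r + h]\<close> in a Riemann-Stieltjes sum for
  the integral of \<open>exp (- a (s - u))\<close> with respect to \<open>B\<^sub>u\<close>. It is the quadratic mean of the
  integrand over the interval, so that the sums have exactly the variance of their limit.\<close>

definition ou_weight :: "real \<Rightarrow> real \<Rightarrow> real \<Rightarrow> real \<Rightarrow> real" where
  "ou_weight a s r h = sqrt ((exp (- 2 * a * (s - (r + h))) - exp (- 2 * a * (s - r))) / (2 * a * h))"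

lemma exp_increment_bounds:
  fixes a :: real
  shows "a * h * exp (- a * (s - r)) \<le> exp (- a * (s - (r + h))) - exp (- a * (s - r))"
    and "exp (- a * (s - (r + h))) - exp (- a * (s - r)) \<le> a * h * exp (- a * (s - (r + h)))"
proof -
  define E where "E r = exp (- a * (s - r))" for r
  have 1: "E (r + h) = E r * exp (a * h)" and 2: "E r = E (r + h) * exp (- (a * h))"
    unfolding E_def by (simp_all add: mult_exp_exp algebra_simps)
  have "E r * (1 + a * h) \<le> E (r + h)"
    by (subst 1) (intro mult_left_mono exp_ge_add_one_self, simp add: E_def)
  moreover have "E (r + h) * (1 + - (a * h)) \<le> E r"
    by (subst 2) (intro mult_left_mono exp_ge_add_one_self, simp add: E_def)
  ultimately show "a * h * exp (- a * (s - r)) \<le> exp (- a * (s - (r + h))) - exp (- a * (s - r))"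
    and "exp (- a * (s - (r + h))) - exp (- a * (s - r)) \<le> a * h * exp (- a * (s - (r + h)))"
    unfolding E_def[symmetric] by (simp_all add: algebra_simps)
qed

lemma ou_weight_bounds:
  assumes "a > 0" "h > 0"
  shows "exp (- a * (s - r)) \<le> ou_weight a s r h" "ou_weight a s r h \<le> exp (- a * (s - (r + h)))"
proof -
  have sq: "exp (- (2 * a * u)) = (exp (- (a * u)))\<^sup>2" for u
    by (simp add: exp_double[symmetric] algebra_simps)
  have "exp (- 2 * a * (s - r)) \<le> (exp (- 2 * a * (s - (r + h))) - exp (- 2 * a * (s - r))) / (2 * a * h)"
    using exp_increment_bounds(1)[of "2 * a" h s r] assms by (simp add: pos_le_divide_eq mult.commute)
  then show "exp (- a * (s - r)) \<le> ou_weight a s r h"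
    unfolding ou_weight_def by (intro real_le_rsqrt) (simp add: sq)
  have "(exp (- 2 * a * (s - (r + h))) - exp (- 2 * a * (s - r))) / (2 * a * h) \<le> exp (- 2 * a * (s - (r + h)))"
    using exp_increment_bounds(2)[of "2 * a" s r h] assms by (simp add: pos_divide_le_eq mult.commute)
  then show "ou_weight a s r h \<le> exp (- a * (s - (r + h)))"
    unfolding ou_weight_def by (intro real_le_lsqrt) (simp_all add: sq)
qed

text \<open>The error of one summand, where \<open>\<eta>\<close> bounds the oscillation of the solution on the interval.
  The integral equation expresses the noise by the solution, so this is a pathwise estimate.\<close>

lemma ou_step_bound:
  fixes y b :: "real \<Rightarrow> 'b::euclidean_space"
  assumes a: "a > 0" and h: "h > 0" and r: "0 \<le> r" "r + h \<le> s" and cont: "continuous_on {0..} y"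
    and eq: "\<And>t. t \<ge> 0 \<Longrightarrow> y t = x + \<sigma> *\<^sub>R b t - a *\<^sub>R (LBINT s:{0..t}. y s)"
    and K: "norm (y r) \<le> K" and \<eta>: "\<And>u. u \<in> {r..r + h} \<Longrightarrow> norm (y u - y r) \<le> \<eta>"
  shows "norm (exp (- a * (s - (r + h))) *\<^sub>R y (r + h) - exp (- a * (s - r)) *\<^sub>R y r
      - (\<sigma> * ou_weight a s r h) *\<^sub>R (b (r + h) - b r))
    \<le> (exp (- a * (s - (r + h))) - exp (- a * (s - r))) * (a * h * K + \<eta>) + a * h * \<eta>"
proof -
  define E0 E1 c where "E0 = exp (- a * (s - r))" and "E1 = exp (- a * (s - (r + h)))" and "c = ou_weight a s r h"
  have E: "a * h * E0 \<le> E1 - E0" "E1 - E0 \<le> a * h * E1" "E0 \<le> c" "c \<le> E1" "E1 \<le> 1" "0 < E0"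
    using exp_increment_bounds[of a h s r] exp_increment_bounds[of a s r h] ou_weight_bounds[OF a h, of s r] a r
    unfolding E0_def E1_def c_def by auto
  have cI: "continuous_on {u..v} y" if "0 \<le> u" for u v by (rule continuous_on_subset[OF cont]) (use that in auto)
  have i: "y integrable_on {u..v}" if "0 \<le> u" for u v using cI[OF that] by (rule integrable_continuous_real)
  define I where "I = integral {r..r + h} y"
  have J: "integral {0..r + h} y = integral {0..r} y + I"
    unfolding I_def using r h by (intro Henstock_Kurzweil_Integration.integral_combine[symmetric] i) auto
  have y1: "y (r + h) = x + \<sigma> *\<^sub>R b (r + h) - a *\<^sub>R (integral {0..r} y + I)"
    using r h eq[of "r + h"] set_integral_eq_integral_Icc[OF cI[of 0 "r + h"]] by (simp flip: J)
  have y0: "y r = x + \<sigma> *\<^sub>R b r - a *\<^sub>R integral {0..r} y"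
    using r eq[of r] set_integral_eq_integral_Icc[OF cI[of 0 r]] by simp
  have "y (r + h) - y r = \<sigma> *\<^sub>R (b (r + h) - b r) - a *\<^sub>R I"
    unfolding y1 y0 by (simp add: algebra_simps)
  then have \<sigma>b: "\<sigma> *\<^sub>R (b (r + h) - b r) = y (r + h) - y r + a *\<^sub>R I" by (simp add: algebra_simps)
  have \<eta>0: "0 \<le> \<eta>" using \<eta>[of r] h by simp
  have "norm (integral {r..r + h} (\<lambda>u. y u - y r)) \<le> \<eta> * (r + h - r)"
    using h r \<eta> by (intro integral_bound continuous_intros cI) auto
  moreover have "integral {r..r + h} (\<lambda>u. y u - y r) = I - h *\<^sub>R y r"
    unfolding I_def using h r by (subst Henstock_Kurzweil_Integration.integral_diff) (auto intro: i)
  ultimately have I: "norm (I - h *\<^sub>R y r) \<le> h * \<eta>" by (simp add: mult.commute)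
  have "E1 *\<^sub>R y (r + h) - E0 *\<^sub>R y r - (\<sigma> * c) *\<^sub>R (b (r + h) - b r)
    = E1 *\<^sub>R y (r + h) - E0 *\<^sub>R y r - c *\<^sub>R (y (r + h) - y r + a *\<^sub>R I)"
    unfolding \<sigma>b[symmetric] by (simp add: mult.commute)
  also have "\<dots> = (E1 - c) *\<^sub>R (y (r + h) - y r) + (E1 - E0 - c * a * h) *\<^sub>R y r - (c * a) *\<^sub>R (I - h *\<^sub>R y r)"
    by (simp add: algebra_simps)
  finally have "norm (E1 *\<^sub>R y (r + h) - E0 *\<^sub>R y r - (\<sigma> * c) *\<^sub>R (b (r + h) - b r))
    = norm ((E1 - c) *\<^sub>R (y (r + h) - y r) + (E1 - E0 - c * a * h) *\<^sub>R y r - (c * a) *\<^sub>R (I - h *\<^sub>R y r))"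
    by (rule arg_cong)
  also have "\<dots> \<le> norm ((E1 - c) *\<^sub>R (y (r + h) - y r)) + norm ((E1 - E0 - c * a * h) *\<^sub>R y r) + norm ((c * a) *\<^sub>R (I - h *\<^sub>R y r))"
    by (rule order_trans[OF norm_triangle_ineq4 add_right_mono[OF norm_triangle_ineq]])
  also have "\<dots> \<le> (E1 - E0) * \<eta> + (a * h * (E1 - E0)) * K + a * (h * \<eta>)"
  proof (intro add_mono)
    show "norm ((E1 - c) *\<^sub>R (y (r + h) - y r)) \<le> (E1 - E0) * \<eta>"
      using E \<eta>[of "r + h"] h by (auto intro!: mult_mono)
    have "\<bar>E1 - E0 - c * a * h\<bar> \<le> a * h * (E1 - E0)"
    proof -
      have "E0 * (a * h) \<le> c * (a * h)" "c * (a * h) \<le> E1 * (a * h)"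
        using E a h by (auto intro!: mult_right_mono)
      then show ?thesis using E by (simp add: abs_le_iff algebra_simps)
    qed
    then show "norm ((E1 - E0 - c * a * h) *\<^sub>R y r) \<le> (a * h * (E1 - E0)) * K"
      using K E a h by (auto intro!: mult_mono)
    have "c * a \<le> 1 * a" using E a by (intro mult_right_mono) auto
    then show "norm ((c * a) *\<^sub>R (I - h *\<^sub>R y r)) \<le> a * (h * \<eta>)"
      using mult_mono[OF _ I, of "c * a" a] E a by simp
  qed
  also have "\<dots> = (E1 - E0) * (a * h * K + \<eta>) + a * h * \<eta>" by (simp add: algebra_simps)
  finally show ?thesis unfolding E0_def E1_def c_def .
qed

lemma ou_riemann_sum_tendsto:
  fixes y b :: "real \<Rightarrow> 'b::euclidean_space"
  assumes a: "a > 0" and s: "0 \<le> s0" "s0 < s" and cont: "continuous_on {0..} y"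
    and eq: "\<And>t. t \<ge> 0 \<Longrightarrow> y t = x + \<sigma> *\<^sub>R b t - a *\<^sub>R (LBINT s:{0..t}. y s)"
  shows "(\<lambda>n. let h = (s - s0) / real (Suc n) in
      \<Sum>i<Suc n. (\<sigma> * ou_weight a s (s0 + real i * h) h) *\<^sub>R (b (s0 + real (Suc i) * h) - b (s0 + real i * h)))
    \<longlonglongrightarrow> y s - exp (- a * (s - s0)) *\<^sub>R y s0"
    (is "?S \<longlonglongrightarrow> ?L")
proof (rule metric_LIMSEQ_I)
  fix \<epsilon> :: real assume \<epsilon>: "\<epsilon> > 0"
  have cI: "continuous_on {s0..s} y" by (rule continuous_on_subset[OF cont]) (use s in auto)
  obtain K where K: "K > 0" "\<And>r. r \<in> {s0..s} \<Longrightarrow> norm (y r) \<le> K"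
    using compact_imp_bounded[OF compact_continuous_image[OF cI compact_Icc]]
    unfolding bounded_pos by auto
  define \<eta> where "\<eta> = \<epsilon> / (2 * (1 + a * (s - s0)))"
  have pos: "1 + a * (s - s0) > 0" using a s by (simp add: add_pos_nonneg)
  have \<eta>: "\<eta> > 0" unfolding \<eta>_def using \<epsilon> pos by simp
  obtain \<delta> where \<delta>: "\<delta> > 0" "\<And>r u. r \<in> {s0..s} \<Longrightarrow> u \<in> {s0..s} \<Longrightarrow> dist u r < \<delta> \<Longrightarrow> dist (y u) (y r) < \<eta>"
    using compact_uniformly_continuous[OF cI compact_Icc] \<eta> unfolding uniformly_continuous_on_def by metis
  define \<delta>' where "\<delta>' = min \<delta> (\<epsilon> / (2 * a * K))"
  have \<delta>': "\<delta>' > 0" unfolding \<delta>'_def using \<delta> \<epsilon> a K by simp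
  obtain N where N: "\<And>n. n \<ge> N \<Longrightarrow> (s - s0) / real (Suc n) < \<delta>'"
  proof -
    have "(\<lambda>n. (s - s0) * (1 / real (Suc n))) \<longlonglongrightarrow> (s - s0) * 0"
      by (intro tendsto_mult tendsto_const LIMSEQ_Suc[OF lim_1_over_n])
    then have "\<forall>\<^sub>F n in sequentially. (s - s0) / real (Suc n) < \<delta>'"
      using \<delta>' by (auto dest!: order_tendstoD(2))
    then show thesis using that by (auto simp: eventually_sequentially)
  qed
  show "\<exists>N. \<forall>n\<ge>N. dist (?S n) ?L < \<epsilon>"
  proof (intro exI[of _ N] allI impI)
    fix n assume n: "n \<ge> N"
    define h where "h = (s - s0) / real (Suc n)"
    define r where "r i = s0 + real i * h" for i
    define E where "E i = exp (- a * (s - r i))" for i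
    have h: "h > 0" "h < \<delta>" "a * h * K < \<epsilon> / 2"
    proof -
      show "h > 0" unfolding h_def using s by simp
      have "h < \<delta>'" unfolding h_def by (rule N[OF n])
      then show "h < \<delta>" and "a * h * K < \<epsilon> / 2"
        unfolding \<delta>'_def using a K by (auto simp: field_simps)
    qed
    have rS: "r (Suc i) = r i + h" for i unfolding r_def by (simp add: algebra_simps)
    have r0: "r 0 = s0" and rN: "r (Suc n) = s" unfolding r_def h_def by simp_all
    have rle: "s0 \<le> r i" for i unfolding r_def using h by simp
    have rles: "r i \<le> s" if "i \<le> Suc n" for i
    proof -
      have "real i * h \<le> real (Suc n) * h" using that h by (intro mult_right_mono) auto
      then show ?thesis using rN unfolding r_def by simp
    qed
    \<comment> \<open>Write the limit as a telescoping sum and compare it with the Riemann-Stieltjes sum term by term.\<close>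
    have "norm (\<Sum>i<Suc n. E (Suc i) *\<^sub>R y (r (Suc i)) - E i *\<^sub>R y (r i) - (\<sigma> * ou_weight a s (r i) h) *\<^sub>R (b (r (Suc i)) - b (r i)))
      \<le> (\<Sum>i<Suc n. (E (Suc i) - E i) * (a * h * K + \<eta>) + a * h * \<eta>)"
    proof (rule sum_norm_le)
      fix i assume "i \<in> {..<Suc n}"
      then have i: "i \<le> Suc n" "Suc i \<le> Suc n" by auto
      have ri: "r i \<in> {s0..s}" "r i + h \<le> s" using rle[of i] rles[OF i(1)] rles[OF i(2)] by (auto simp: rS)
      show "norm (E (Suc i) *\<^sub>R y (r (Suc i)) - E i *\<^sub>R y (r i) - (\<sigma> * ou_weight a s (r i) h) *\<^sub>R (b (r (Suc i)) - b (r i)))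
        \<le> (E (Suc i) - E i) * (a * h * K + \<eta>) + a * h * \<eta>"
        unfolding E_def rS
      proof (rule ou_step_bound[OF a h(1) _ ri(2) cont eq])
        show "norm (y (r i)) \<le> K" using K ri by auto
        show "norm (y u - y (r i)) \<le> \<eta>" if "u \<in> {r i..r i + h}" for u
          using \<delta>(2)[OF ri(1), of u] that ri h by (auto simp: dist_norm)
      qed (use ri s in auto)
    qed
    also have "\<dots> = (E (Suc n) - E 0) * (a * h * K + \<eta>) + real (Suc n) * (a * h * \<eta>)"
      unfolding sum.distrib sum_distrib_right[symmetric] sum_lessThan_telescope by simp
    also have "\<dots> \<le> 1 * (a * h * K + \<eta>) + a * (s - s0) * \<eta>"
    proof (rule add_mono)
      have "E (Suc n) - E 0 \<le> 1" unfolding E_def rN by simp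
      then show "(E (Suc n) - E 0) * (a * h * K + \<eta>) \<le> 1 * (a * h * K + \<eta>)"
        using a h K \<eta> by (intro mult_right_mono) auto
      have "real (Suc n) * (a * h * \<eta>) = a * (real (Suc n) * h) * \<eta>" by (simp only: ac_simps)
      also have "real (Suc n) * h = s - s0" unfolding h_def by simp
      finally show "real (Suc n) * (a * h * \<eta>) \<le> a * (s - s0) * \<eta>" by (rule eq_refl)
    qed
    also have "\<dots> = a * h * K + (1 + a * (s - s0)) * \<eta>" by (simp add: algebra_simps)
    also have "(1 + a * (s - s0)) * \<eta> = \<epsilon> / 2" unfolding \<eta>_def using pos by (simp add: field_simps)
    also have "a * h * K + \<epsilon> / 2 < \<epsilon>" using h(3) by simp
    also have "(\<Sum>i<Suc n. E (Suc i) *\<^sub>R y (r (Suc i)) - E i *\<^sub>R y (r i) - (\<sigma> * ou_weight a s (r i) h) *\<^sub>R (b (r (Suc i)) - b (r i)))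
      = (E (Suc n) *\<^sub>R y (r (Suc n)) - E 0 *\<^sub>R y (r 0)) - ?S n"
      unfolding sum_subtractf[of "\<lambda>i. E (Suc i) *\<^sub>R y (r (Suc i)) - E i *\<^sub>R y (r i)"]
        sum_lessThan_telescope[of "\<lambda>i. E i *\<^sub>R y (r i)"]
      by (simp only: Let_def h_def[symmetric] r_def[symmetric])
    also have "E (Suc n) *\<^sub>R y (r (Suc n)) - E 0 *\<^sub>R y (r 0) = ?L"
      unfolding rN r0 E_def by simp
    finally show "dist (?S n) ?L < \<epsilon>" by (simp add: dist_norm norm_minus_commute)
  qed
qed

text \<open>The Ornstein-Uhlenbeck processes from all starting points, driven by one Brownian motion.\<close>

locale ou_process =
  fixes M :: "'w measure" and F :: "real \<Rightarrow> 'w measure"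
    and B :: "real \<Rightarrow> 'w \<Rightarrow> real ^ 'n"
    and X :: "real ^ 'n \<Rightarrow> real \<Rightarrow> 'w \<Rightarrow> real ^ 'n"
    and a \<sigma> :: real
  assumes a: "a > 0" and \<sigma>: "\<sigma> > 0"
    and bm: "brownian_motion M F B"
    and ou: "\<And>y. OU_solution M F B a \<sigma> y (X y)"
begin

lemma prob_M: "prob_space M"
  using bm by (simp add: brownian_motion_def filtered_prob_space_def)

sublocale M: prob_space M by (rule prob_M)

lemma subalgebra_F: "subalgebra M (F s)"
  using bm by (simp add: brownian_motion_def filtered_prob_space_def)

lemma subalgebra_F_mono: "s \<le> t \<Longrightarrow> subalgebra (F t) (F s)"
  using bm unfolding brownian_motion_def filtered_prob_space_def subalgebra_def filtration_def by auto

lemma X_measurable_F: "0 \<le> s \<Longrightarrow> s \<le> t \<Longrightarrow> X x s \<in> borel_measurable (F t)"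
  using ou[of x] measurable_from_subalg[OF subalgebra_F_mono] unfolding OU_solution_def by blast

lemma B_measurable_F: "0 \<le> s \<Longrightarrow> s \<le> t \<Longrightarrow> B s \<in> borel_measurable (F t)"
  using bm measurable_from_subalg[OF subalgebra_F_mono] unfolding brownian_motion_def by blast

lemma X_measurable: "0 \<le> s \<Longrightarrow> X x s \<in> borel_measurable M"
  using measurable_from_subalg[OF subalgebra_F X_measurable_F[OF _ order_refl]] .

lemma X_continuous: "\<omega> \<in> space M \<Longrightarrow> continuous_on {0..} (\<lambda>s. X x s \<omega>)"
  using ou[of x] by (simp add: OU_solution_def)

text \<open>The process started at \<open>0\<close>.\<close>

definition Y :: "real \<Rightarrow> 'w \<Rightarrow> real ^ 'n" where "Y = X 0"

lemma X_eq_Y: "AE \<omega> in M. \<forall>t\<ge>0. X x t \<omega> = exp (- a * t) *\<^sub>R x + Y t \<omega>"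
proof -
  have "AE \<omega> in M. \<forall>t\<ge>0. X x t \<omega> = x + \<sigma> *\<^sub>R B t \<omega> - a *\<^sub>R (LBINT s:{0..t}. X x s \<omega>)"
    "AE \<omega> in M. \<forall>t\<ge>0. Y t \<omega> = 0 + \<sigma> *\<^sub>R B t \<omega> - a *\<^sub>R (LBINT s:{0..t}. Y s \<omega>)"
    using ou[of x] ou[of 0] by (simp_all add: OU_solution_def Y_def)
  moreover have "AE \<omega> in M. \<omega> \<in> space M" by simp
  ultimately show ?thesis
  proof eventually_elim
    fix \<omega> assume Xe: "\<forall>t\<ge>0. X x t \<omega> = x + \<sigma> *\<^sub>R B t \<omega> - a *\<^sub>R (LBINT s:{0..t}. X x s \<omega>)"
      and Ye: "\<forall>t\<ge>0. Y t \<omega> = 0 + \<sigma> *\<^sub>R B t \<omega> - a *\<^sub>R (LBINT s:{0..t}. Y s \<omega>)" and \<omega>: "\<omega> \<in> space M"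
    have c: "continuous_on {0..} (\<lambda>s. X x s \<omega>)" "continuous_on {0..} (\<lambda>s. Y s \<omega>)"
      using X_continuous[OF \<omega>] by (auto simp: Y_def)
    have i: "set_integrable lborel {0..t} (\<lambda>s. X x s \<omega>)" "set_integrable lborel {0..t} (\<lambda>s. Y s \<omega>)" for t
      by (intro borel_integrable_atLeastAtMost' continuous_on_subset[OF c(1)] continuous_on_subset[OF c(2)]; auto)+
    have "X x t \<omega> - Y t \<omega> = exp (- a * t) *\<^sub>R x" if "t \<ge> 0" for t
    proof (rule linear_integral_equation_unique[OF _ _ that])
      show "continuous_on {0..} (\<lambda>s. X x s \<omega> - Y s \<omega>)" by (intro continuous_intros c)
      show "X x t \<omega> - Y t \<omega> = x - a *\<^sub>R (LBINT s:{0..t}. X x s \<omega> - Y s \<omega>)" if "t \<ge> 0" for t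
      proof -
        have "X x t \<omega> - Y t \<omega> = (x + \<sigma> *\<^sub>R B t \<omega> - a *\<^sub>R (LBINT s:{0..t}. X x s \<omega>))
           - (0 + \<sigma> *\<^sub>R B t \<omega> - a *\<^sub>R (LBINT s:{0..t}. Y s \<omega>))"
          by (rule arg_cong2[where f = "(-)", OF Xe[rule_format, OF that] Ye[rule_format, OF that]])
        also have "\<dots> = x - a *\<^sub>R (LBINT s:{0..t}. X x s \<omega> - Y s \<omega>)"
          unfolding set_integral_diff(2)[OF i] by (simp add: algebra_simps)
        finally show ?thesis .
      qed
    qed
    then show "\<forall>t\<ge>0. X x t \<omega> = exp (- a * t) *\<^sub>R x + Y t \<omega>" by (auto simp: algebra_simps)
  qed
qed

lemma Y_0: "AE \<omega> in M. Y 0 \<omega> = 0"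
proof -
  have "AE \<omega> in M. B 0 \<omega> = 0" using bm by (simp add: brownian_motion_def)
  moreover have "AE \<omega> in M. \<forall>t\<ge>0. Y t \<omega> = 0 + \<sigma> *\<^sub>R B t \<omega> - a *\<^sub>R (LBINT s:{0..t}. Y s \<omega>)"
    using ou[of 0] by (simp add: OU_solution_def Y_def)
  ultimately show ?thesis
  proof eventually_elim
    fix \<omega> assume "B 0 \<omega> = 0" "\<forall>t\<ge>0. Y t \<omega> = 0 + \<sigma> *\<^sub>R B t \<omega> - a *\<^sub>R (LBINT s:{0..t}. Y s \<omega>)"
    then have "Y 0 \<omega> = - (a *\<^sub>R (LBINT s:{0..0}. Y s \<omega>))" by simp
    then show "Y 0 \<omega> = 0" by (subst (asm) set_integral_eq_integral_Icc) auto
  qed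
qed

lemma gauss_indep_brownian:
  assumes "0 \<le> s" "s < t"
  shows "gauss_indep M (F s) (\<lambda>\<omega>. B t \<omega> - B s \<omega>) (t - s)"
  unfolding gauss_indep_def
proof (intro conjI ballI)
  have [measurable]: "B s \<in> borel_measurable M" "B t \<in> borel_measurable M"
    using assms by (auto intro: measurable_from_subalg[OF subalgebra_F B_measurable_F[OF _ order_refl]])
  show "(\<lambda>\<omega>. B t \<omega> - B s \<omega>) \<in> borel_measurable M" by measurable
  show "0 < t - s" using assms by simp
  have ind: "M.indep_set (sets (F s)) (sets (vimage_algebra (space M) (\<lambda>\<omega>. B t \<omega> - B s \<omega>) borel))"
    and d: "distributed M lborel (\<lambda>\<omega>. B t \<omega> - B s \<omega>) (\<lambda>z. ennreal (gdens (t - s) z))"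
    using bm assms unfolding brownian_motion_def gdens_def by blast+
  fix A and S :: "(real^'n) set" assume A: "A \<in> sets (F s)" and S: "S \<in> sets borel"
  let ?D = "(\<lambda>\<omega>. B t \<omega> - B s \<omega>) -` S \<inter> space M"
  have "?D \<in> sets (vimage_algebra (space M) (\<lambda>\<omega>. B t \<omega> - B s \<omega>) borel)"
    using S by (rule in_vimage_algebra)
  then have "M.prob (A \<inter> ?D) = M.prob A * M.prob ?D"
    using ind A unfolding M.indep_sets2_eq by blast
  then have "emeasure M (A \<inter> ?D) = emeasure M A * emeasure M ?D"
    by (simp add: M.emeasure_eq_measure ennreal_mult)
  also have "emeasure M ?D = emeasure (distr M lborel (\<lambda>\<omega>. B t \<omega> - B s \<omega>)) S"
    using S by (subst emeasure_distr) auto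
  also have "\<dots> = emeasure (density lborel (\<lambda>z. ennreal (gdens (t - s) z))) S"
    using distributed_distr_eq_density[OF d] by simp
  finally show "emeasure M (A \<inter> ?D) = emeasure M A * emeasure (density lborel (\<lambda>z. ennreal (gdens (t - s) z))) S" .
qed

text \<open>The variance of each coordinate of \<open>Y\<^sub>t\<close>.\<close>

definition var :: "real \<Rightarrow> real" where
  "var t = \<sigma>\<^sup>2 * (1 - exp (- 2 * a * t)) / (2 * a)"

lemma var_pos: "t > 0 \<Longrightarrow> var t > 0"
  using a \<sigma> by (simp add: var_def)

lemma var_mono: "s \<le> t \<Longrightarrow> var s \<le> var t"
  unfolding var_def using a \<sigma> by (intro divide_right_mono mult_left_mono) auto

lemma var_add: "var t = (exp (- a * (t - s)))\<^sup>2 * var s + var (t - s)"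
  using a unfolding var_def by (simp add: field_simps exp_double[symmetric] mult_exp_exp)

lemma gauss_indep_riemann_sum:
  assumes s: "0 \<le> s0" and h: "h > 0"
  shows "gauss_indep M (F s0)
    (\<lambda>\<omega>. \<Sum>i<Suc k. (\<sigma> * ou_weight a s (s0 + real i * h) h) *\<^sub>R (B (s0 + real (Suc i) * h) \<omega> - B (s0 + real i * h) \<omega>))
    (\<sigma>\<^sup>2 * (exp (- 2 * a * (s - (s0 + real (Suc k) * h))) - exp (- 2 * a * (s - s0))) / (2 * a))"
proof -
  define r where "r i = s0 + real i * h" for i
  have r0: "r 0 = s0" by (simp add: r_def)
  have rS: "r (Suc i) = r i + h" for i by (simp add: r_def algebra_simps)
  have rle: "s0 \<le> r i" for i using h by (simp add: r_def)
  define E where "E i = exp (- 2 * a * (s - r i))" for i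
  define T where "T i \<omega> = (\<sigma> * ou_weight a s (r i) h) *\<^sub>R (B (r (Suc i)) \<omega> - B (r i) \<omega>)" for i \<omega>
  have T: "gauss_indep M (F (r i)) (T i) (\<sigma>\<^sup>2 * (E (Suc i) - E i) / (2 * a))" for i
  proof -
    have w: "ou_weight a s (r i) h > 0"
      by (rule less_le_trans[OF _ ou_weight_bounds(1)[OF a h]]) simp
    have "0 \<le> E (Suc i) - E i" unfolding E_def rS using a h by simp
    then have w2: "(ou_weight a s (r i) h)\<^sup>2 = (E (Suc i) - E i) / (2 * a * h)"
      unfolding ou_weight_def E_def rS using a h by (subst real_sqrt_pow2) auto
    have "gauss_indep M (F (r i)) (T i) ((\<sigma> * ou_weight a s (r i) h)\<^sup>2 * (r (Suc i) - r i))"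
      unfolding T_def using s h w \<sigma> rle[of i]
      by (intro gauss_indep_scale gauss_indep_brownian subalgebra_F prob_M) (auto simp: rS)
    also have "(\<sigma> * ou_weight a s (r i) h)\<^sup>2 * (r (Suc i) - r i) = \<sigma>\<^sup>2 * (E (Suc i) - E i) / (2 * a)"
      unfolding power_mult_distrib w2 rS using h a by simp
    finally show ?thesis .
  qed
  have "gauss_indep M (F (r 0)) (\<lambda>\<omega>. \<Sum>i<Suc k. T i \<omega>) (\<sigma>\<^sup>2 * (E (Suc k) - E 0) / (2 * a))"
  proof (induction k)
    case 0
    then show ?case using T[of 0] by simp
  next
    case (Suc k)
    have "(\<lambda>\<omega>. \<Sum>i<Suc k. T i \<omega>) \<in> borel_measurable (F (r (Suc k)))"
    proof (rule borel_measurable_sum)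
      fix i assume "i \<in> {..<Suc k}"
      then have "real i * h \<le> real (Suc k) * h" "real (Suc i) * h \<le> real (Suc k) * h" using h by (intro mult_right_mono; simp)+
      then have "0 \<le> r i" "r i \<le> r (Suc k)" "0 \<le> r (Suc i)" "r (Suc i) \<le> r (Suc k)"
        using s h unfolding r_def by (auto intro!: add_nonneg_nonneg)
      then show "T i \<in> borel_measurable (F (r (Suc k)))"
        unfolding T_def using B_measurable_F by measurable
    qed
    from gauss_indep_sum[OF Suc T[of "Suc k"] subalgebra_F subalgebra_F _ this prob_M, of 1]
    have "gauss_indep M (F (r 0)) (\<lambda>\<omega>. (\<Sum>i<Suc k. T i \<omega>) + T (Suc k) \<omega>)
       (\<sigma>\<^sup>2 * (E (Suc k) - E 0) / (2 * a) + \<sigma>\<^sup>2 * (E (Suc (Suc k)) - E (Suc k)) / (2 * a))"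
      using rle[of "Suc k"] by (simp add: subalgebra_F_mono r0)
    also have "\<sigma>\<^sup>2 * (E (Suc k) - E 0) / (2 * a) + \<sigma>\<^sup>2 * (E (Suc (Suc k)) - E (Suc k)) / (2 * a)
       = \<sigma>\<^sup>2 * (E (Suc (Suc k)) - E 0) / (2 * a)"
      by (simp add: field_simps flip: add_divide_distrib)
    finally show ?case by simp
  qed
  then show ?thesis unfolding T_def E_def r0 unfolding r_def .
qed

text \<open>The Markov property with its Gaussian kernel.\<close>

lemma gauss_indep_ou_increment:
  assumes s: "0 \<le> s0" "s0 < s"
  shows "gauss_indep M (F s0) (\<lambda>\<omega>. Y s \<omega> - exp (- a * (s - s0)) *\<^sub>R Y s0 \<omega>) (var (s - s0))"
proof (rule gauss_indep_lim[OF _ subalgebra_F prob_M])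
  let ?h = "\<lambda>n. (s - s0) / real (Suc n)"
  let ?D = "\<lambda>n \<omega>. let h = (s - s0) / real (Suc n) in
      \<Sum>i<Suc n. (\<sigma> * ou_weight a s (s0 + real i * h) h) *\<^sub>R (B (s0 + real (Suc i) * h) \<omega> - B (s0 + real i * h) \<omega>)"
  show "gauss_indep M (F s0) (?D n) (var (s - s0))" for n
  proof -
    have "?h n > 0" using s by simp
    from gauss_indep_riemann_sum[OF s(1) this, where k = n and s = s] show ?thesis
      by (simp add: var_def Let_def del: sum.lessThan_Suc of_nat_Suc)
  qed
  have [measurable]: "X 0 s \<in> borel_measurable M" "X 0 s0 \<in> borel_measurable M"
    using X_measurable s by auto
  show "(\<lambda>\<omega>. Y s \<omega> - exp (- a * (s - s0)) *\<^sub>R Y s0 \<omega>) \<in> borel_measurable M"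
    unfolding Y_def by measurable
  have "AE \<omega> in M. \<forall>t\<ge>0. Y t \<omega> = 0 + \<sigma> *\<^sub>R B t \<omega> - a *\<^sub>R (LBINT s:{0..t}. Y s \<omega>)"
    using ou[of 0] by (simp add: OU_solution_def Y_def)
  moreover have "AE \<omega> in M. \<omega> \<in> space M" by simp
  ultimately show "AE \<omega> in M. (\<lambda>n. ?D n \<omega>) \<longlonglongrightarrow> Y s \<omega> - exp (- a * (s - s0)) *\<^sub>R Y s0 \<omega>"
  proof eventually_elim
    fix \<omega> assume eq: "\<forall>t\<ge>0. Y t \<omega> = 0 + \<sigma> *\<^sub>R B t \<omega> - a *\<^sub>R (LBINT s:{0..t}. Y s \<omega>)" and \<omega>: "\<omega> \<in> space M"
    have "continuous_on {0..} (\<lambda>s. Y s \<omega>)" unfolding Y_def by (rule X_continuous[OF \<omega>])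
    from ou_riemann_sum_tendsto[OF a s this, of 0 \<sigma> "\<lambda>s. B s \<omega>"] eq
    show "(\<lambda>n. ?D n \<omega>) \<longlonglongrightarrow> Y s \<omega> - exp (- a * (s - s0)) *\<^sub>R Y s0 \<omega>" by blast
  qed
qed

lemma Y_measurable_F: "0 \<le> s \<Longrightarrow> s \<le> t \<Longrightarrow> Y s \<in> borel_measurable (F t)"
  unfolding Y_def by (rule X_measurable_F)

lemma Y_measurable: "0 \<le> s \<Longrightarrow> Y s \<in> borel_measurable M"
  unfolding Y_def by (rule X_measurable)

lemma gauss_indep_Y: "t > 0 \<Longrightarrow> gauss_indep M (F 0) (Y t) (var t)"
  by (rule gauss_indep_cong_AE[OF gauss_indep_ou_increment[of 0 t, simplified] subalgebra_F Y_measurable])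
    (use Y_0 in auto)

lemma Y_law:
  assumes "t > 0" "g \<in> borel_measurable borel"
  shows "(\<integral>\<^sup>+\<omega>. g (Y t \<omega>) \<partial>M) = (\<integral>\<^sup>+y. g y * gdens (var t) y \<partial>lborel)"
  by (rule gauss_indep_law[OF gauss_indep_Y subalgebra_F prob_M]) (use assms in auto)

text \<open>\<open>Y\<^sub>s\<close> has the law of \<open>Y\<^sub>t\<close>, scaled down.\<close>

lemma Y_moment_mono:
  assumes "0 \<le> s" "s \<le> t" "0 < t"
  shows "(\<integral>\<^sup>+\<omega>. ennreal ((1 + norm (Y s \<omega>)) ^ m) \<partial>M) \<le> (\<integral>\<^sup>+\<omega>. ennreal ((1 + norm (Y t \<omega>)) ^ m) \<partial>M)"
proof (cases "s = 0")
  case True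
  have "(\<integral>\<^sup>+\<omega>. ennreal ((1 + norm (Y s \<omega>)) ^ m) \<partial>M) = (\<integral>\<^sup>+\<omega>. 1 \<partial>M)"
    by (rule nn_integral_cong_AE) (use Y_0 True in auto)
  also have "\<dots> \<le> (\<integral>\<^sup>+\<omega>. ennreal ((1 + norm (Y t \<omega>)) ^ m) \<partial>M)"
    by (intro nn_integral_mono) (simp add: one_le_power flip: ennreal_1)
  finally show ?thesis .
next
  case False
  have std: "(\<integral>\<^sup>+\<omega>. ennreal ((1 + norm (Y r \<omega>)) ^ m) \<partial>M)
     = (\<integral>\<^sup>+y. ennreal ((1 + sqrt (var r) * norm (y :: real^'n)) ^ m) * gdens 1 y \<partial>lborel)" if "r > 0" for r
  proof -
    have v: "var r > 0" using that by (rule var_pos)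
    have "(\<integral>\<^sup>+\<omega>. ennreal ((1 + norm (Y r \<omega>)) ^ m) \<partial>M)
      = (\<integral>\<^sup>+y. ennreal ((1 + norm (y :: real^'n)) ^ m) * gdens (var r) y \<partial>lborel)"
      by (rule Y_law[OF that]) measurable
    also have "\<dots> = (\<integral>\<^sup>+y. ennreal ((1 + norm (y :: real^'n)) ^ m) * gdens ((sqrt (var r))\<^sup>2 * 1) y \<partial>lborel)"
      using v by simp
    also have "\<dots> = (\<integral>\<^sup>+y. ennreal ((1 + norm (sqrt (var r) *\<^sub>R (y :: real^'n))) ^ m) * gdens 1 y \<partial>lborel)"
      using v by (intro nn_integral_gdens_scale) auto
    finally show ?thesis using v by simp
  qed
  have "s > 0" using False assms by simp
  then have "0 < sqrt (var s)" "sqrt (var s) \<le> sqrt (var t)" using var_pos var_mono assms by auto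
  then show ?thesis
    unfolding std[OF \<open>s > 0\<close>] std[OF \<open>t > 0\<close>]
    by (intro nn_integral_mono mult_right_mono ennreal_leI power_mono add_left_mono) auto
qed

lemma Y_moment_finite:
  assumes "t > 0"
  shows "(\<integral>\<^sup>+\<omega>. ennreal ((1 + norm (Y t \<omega>)) ^ m) \<partial>M) < \<infinity>"
proof -
  define v where "v = var t"
  have v: "v > 0" unfolding v_def using assms by (rule var_pos)
  have "(\<integral>\<^sup>+\<omega>. ennreal ((1 + norm (Y t \<omega>)) ^ m) \<partial>M)
    = (\<integral>\<^sup>+y. ennreal ((1 + norm (y :: real^'n)) ^ m) * gdens v y \<partial>lborel)"
    unfolding v_def by (rule Y_law[OF assms]) measurable
  also have "\<dots> = (\<integral>\<^sup>+y. ennreal ((1 / sqrt (2 * pi * v)) ^ CARD('n) * ((1 + norm (y :: real^'n)) ^ m * exp (- (1 / (2 * v)) * (norm y)\<^sup>2))) \<partial>lborel)"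
    using v by (intro nn_integral_cong) (simp add: gdens_eq ac_simps flip: ennreal_mult)
  also have "\<dots> < \<infinity>"
  proof -
    have "integrable lborel (\<lambda>y. (1 / sqrt (2 * pi * v)) ^ CARD('n) * ((1 + norm (y :: real^'n)) ^ m * exp (- (1 / (2 * v)) * (norm y)\<^sup>2)))"
      using v by (intro integrable_mult_right integrable_power_mult_gauss) simp
    then show ?thesis using v by (subst (asm) integrable_iff_bounded) (simp add: abs_mult)
  qed
  finally show ?thesis .
qed

section \<open>Independence of the bridge and the endpoint\<close>

text \<open>For \<open>0 \<le> s \<le> t\<close>, \<open>\<beta> s t *\<^sub>R Y t\<close> is the conditional expectation of \<open>Y s\<close> given \<open>Y t\<close>, and
  \<open>Z t s\<close> is the bridge from \<open>0\<close> at time \<open>0\<close> to \<open>0\<close> at time \<open>t\<close>, evaluated at time \<open>s\<close>.\<close>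

definition \<beta> :: "real \<Rightarrow> real \<Rightarrow> real" where "\<beta> s t = sinh (a * s) / sinh (a * t)"

definition Z :: "real \<Rightarrow> real \<Rightarrow> 'w \<Rightarrow> real ^ 'n" where "Z t s \<omega> = Y s \<omega> - \<beta> s t *\<^sub>R Y t \<omega>"

lemma sinh_pos: "t > 0 \<Longrightarrow> sinh (a * t) > 0"
  using a by simp

lemma \<beta>_mult: "0 < s \<Longrightarrow> \<beta> r s * \<beta> s t = \<beta> r t"
  using sinh_pos[of s] by (simp add: \<beta>_def)

lemma \<beta>_self: "0 < s \<Longrightarrow> \<beta> s s = 1"
  using sinh_pos[of s] a by (simp add: \<beta>_def)

lemma var_sinh: "var t = \<sigma>\<^sup>2 * exp (- a * t) * sinh (a * t) / a"
  by (simp add: var_def sinh_def field_simps mult_exp_exp)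

lemma \<beta>_eq: "0 < s \<Longrightarrow> s < t \<Longrightarrow> exp (- a * (t - s)) * var s / var t = \<beta> s t"
proof -
  assume "0 < s" "s < t"
  then have "sinh (a * t) > 0" using sinh_pos by auto
  have "exp (- a * (t - s)) * var s = \<sigma>\<^sup>2 * (exp (- a * (t - s)) * exp (- a * s)) * sinh (a * s) / a"
    unfolding var_sinh by (simp only: ac_simps times_divide_eq_right)
  also have "exp (- a * (t - s)) * exp (- a * s) = exp (- a * t)" by (simp add: mult_exp_exp algebra_simps)
  finally have eq: "exp (- a * (t - s)) * var s = \<sigma>\<^sup>2 * exp (- a * t) * sinh (a * s) / a" .
  show ?thesis unfolding \<beta>_def eq unfolding var_sinh using a \<sigma> \<open>sinh (a * t) > 0\<close> by simp
qed

lemma Z_measurable_F: "0 \<le> s \<Longrightarrow> s \<le> t \<Longrightarrow> Z t s \<in> borel_measurable (F t)"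
  unfolding Z_def[abs_def] using Y_measurable_F[of s t] Y_measurable_F[of t t] by measurable

lemma Z_measurable: "0 \<le> s \<Longrightarrow> s \<le> t \<Longrightarrow> Z t s \<in> borel_measurable M"
  using measurable_from_subalg[OF subalgebra_F Z_measurable_F] .

text \<open>A finite-dimensional form of the independence of \<open>Y\<^sub>t\<close> and the bridge. The induction adds a
  largest time \<open>b < t\<close>: the bridge to \<open>t\<close> at the old times is the bridge to \<open>b\<close> plus a multiple of
  \<open>Z t b\<close>, and \<open>Y\<^sub>t\<close>, \<open>Z t b\<close> are independent combinations of \<open>Y\<^sub>b\<close> and of the
  increment after \<open>b\<close>.\<close>

lemma bridge_fdd:
  assumes "finite J" "t > 0" "J \<subseteq> {0..t}"
    and "\<phi> \<in> borel_measurable (borel \<Otimes>\<^sub>M PiM J (\<lambda>_. borel))"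
  shows "(\<integral>\<^sup>+\<omega>. \<phi> (Y t \<omega>, \<lambda>r\<in>J. Z t r \<omega>) \<partial>M)
    = (\<integral>\<^sup>+y. (\<integral>\<^sup>+\<omega>. \<phi> (y, \<lambda>r\<in>J. Z t r \<omega>) \<partial>M) * gdens (var t) y \<partial>lborel)"
  using assms
proof (induction J arbitrary: t \<phi> rule: finite_linorder_max_induct)
  case empty
  have [measurable]: "\<phi> \<in> borel_measurable (borel \<Otimes>\<^sub>M PiM {} (\<lambda>_. borel))" by fact
  have "(\<lambda>y. \<phi> (y, \<lambda>r\<in>{}. 0)) \<in> borel_measurable borel"
    by measurable (auto simp: space_PiM)
  from Y_law[OF empty(1) this] show ?case
    by (simp add: restrict_def M.emeasure_space_1)
next
  case (insert b J)
  note lt = insert.hyps(2) and IH = insert.IH and t = insert.prems(1)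
  have Jt: "J \<subseteq> {0..t}" and bt: "0 \<le> b" "b \<le> t" using insert.prems(2) by auto
  have [measurable]: "\<phi> \<in> borel_measurable (borel \<Otimes>\<^sub>M PiM (insert b J) (\<lambda>_. borel))" by fact
  have YM[measurable]: "Y t \<in> borel_measurable M" using Y_measurable t by auto
  define \<zeta> where "\<zeta> u \<omega> = (\<lambda>r\<in>J. Z u r \<omega>)" for u \<omega>
  show ?case
  proof (cases "b = 0 \<or> b = t")
    case True
    \<comment> \<open>Here \<open>Z t b\<close> vanishes almost surely.\<close>
    define ext :: "(real \<Rightarrow> real^'n) \<Rightarrow> real \<Rightarrow> real^'n" where "ext z = (\<lambda>r\<in>insert b J. if r = b then 0 else z r)" for z
    have [measurable]: "ext \<in> measurable (PiM J (\<lambda>_. borel)) (PiM (insert b J) (\<lambda>_. borel))"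
      unfolding ext_def
    proof (rule measurable_restrict)
      fix r assume "r \<in> insert b J"
      then show "(\<lambda>z. if r = b then 0 else z r) \<in> borel_measurable (PiM J (\<lambda>_. borel :: (real^'n) measure))"
        by (cases "r = b") auto
    qed
    have "AE \<omega> in M. Z t b \<omega> = 0"
      using Y_0 by eventually_elim (use True t \<beta>_self[OF t] in \<open>auto simp: Z_def \<beta>_def\<close>)
    then have ae: "AE \<omega> in M. (\<lambda>r\<in>insert b J. Z t r \<omega>) = ext (\<zeta> t \<omega>)"
      by eventually_elim (auto simp: ext_def \<zeta>_def restrict_def)
    have "(\<integral>\<^sup>+\<omega>. \<phi> (Y t \<omega>, \<lambda>r\<in>insert b J. Z t r \<omega>) \<partial>M) = (\<integral>\<^sup>+\<omega>. \<phi> (Y t \<omega>, ext (\<zeta> t \<omega>)) \<partial>M)"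
      by (rule nn_integral_cong_AE) (use ae in \<open>eventually_elim, simp\<close>)
    also have "\<dots> = (\<integral>\<^sup>+y. (\<integral>\<^sup>+\<omega>. \<phi> (y, ext (\<zeta> t \<omega>)) \<partial>M) * gdens (var t) y \<partial>lborel)"
      using IH[OF t Jt, of "\<lambda>(y, z). \<phi> (y, ext z)"] by (simp add: \<zeta>_def restrict_def)
    also have "(\<lambda>y. \<integral>\<^sup>+\<omega>. \<phi> (y, ext (\<zeta> t \<omega>)) \<partial>M) = (\<lambda>y. \<integral>\<^sup>+\<omega>. \<phi> (y, \<lambda>r\<in>insert b J. Z t r \<omega>) \<partial>M)"
      by (intro HOL.ext nn_integral_cong_AE) (use ae in \<open>eventually_elim, simp\<close>)
    finally show ?thesis .
  next
    case False
    then have b: "0 < b" "b < t" using bt by auto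
    define e where "e = exp (- a * (t - b))"
    define p q where "p = var b" and "q = var (t - b)"
    have pq: "p > 0" "q > 0" unfolding p_def q_def using b by (auto intro: var_pos)
    have T: "var t = e\<^sup>2 * p + q" unfolding e_def p_def q_def by (rule var_add)
    have \<beta>: "e * p / var t = \<beta> b t" unfolding e_def p_def using \<beta>_eq b by simp
    define R where "R \<omega> = Y t \<omega> - e *\<^sub>R Y b \<omega>" for \<omega>
    have R: "gauss_indep M (F b) R q"
      unfolding R_def e_def q_def using gauss_indep_ou_increment b by auto
    define shift :: "(real \<Rightarrow> real^'n) \<Rightarrow> real^'n \<Rightarrow> real \<Rightarrow> real^'n"
      where "shift z w = (\<lambda>r\<in>insert b J. (if r = b then 0 else z r) + \<beta> r b *\<^sub>R w)" for z w
    have sh: "(\<lambda>x. shift (f x) (g x)) \<in> measurable K (PiM (insert b J) (\<lambda>_. borel))"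
      if [measurable]: "f \<in> measurable K (PiM J (\<lambda>_. borel))" "g \<in> borel_measurable K" for f g and K :: "'k measure"
      unfolding shift_def
    proof (rule measurable_restrict)
      fix r assume r: "r \<in> insert b J"
      show "(\<lambda>x. (if r = b then 0 else f x r) + \<beta> r b *\<^sub>R g x) \<in> borel_measurable K"
      proof (cases "r = b")
        case False
        with r have [measurable]: "(\<lambda>z. z r) \<in> borel_measurable (PiM J (\<lambda>_. borel :: (real^'n) measure))" by auto
        from False show ?thesis by simp
      qed simp
    qed
    have \<zeta>F[measurable]: "\<zeta> b \<in> measurable (F b) (PiM J (\<lambda>_. borel))"
      unfolding \<zeta>_def[abs_def] using lt Jt by (intro measurable_restrict Z_measurable_F) auto
    have \<zeta>M[measurable]: "\<zeta> b \<in> measurable M (PiM J (\<lambda>_. borel))"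
      using measurable_from_subalg[OF subalgebra_F \<zeta>F] .
    have YF[measurable]: "Y b \<in> borel_measurable (F b)" using Y_measurable_F b by auto
    have Z_shift: "(\<lambda>r\<in>insert b J. Z t r \<omega>) = shift (\<zeta> b \<omega>) (Y b \<omega> - \<beta> b t *\<^sub>R Y t \<omega>)" for \<omega>
    proof (rule HOL.ext)
      fix r
      show "(\<lambda>r\<in>insert b J. Z t r \<omega>) r = shift (\<zeta> b \<omega>) (Y b \<omega> - \<beta> b t *\<^sub>R Y t \<omega>) r"
        using lt \<beta>_mult[OF b(1), of r t] \<beta>_self[OF b(1)]
        by (auto simp: shift_def \<zeta>_def Z_def scaleR_diff_right)
    qed
    \<comment> \<open>The triple of \<open>Y t\<close>, \<open>Z t b\<close> and the bridge to \<open>b\<close> is independent.\<close>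
    have key: "(\<integral>\<^sup>+\<omega>. \<phi> (Y t \<omega>, \<lambda>r\<in>insert b J. Z t r \<omega>) \<partial>M)
        = (\<integral>\<^sup>+u. (\<integral>\<^sup>+w. (\<integral>\<^sup>+\<omega>. \<phi> (u, shift (\<zeta> b \<omega>) w) \<partial>M) * gdens (p * q / var t) w \<partial>lborel) * gdens (var t) u \<partial>lborel)"
      if \<phi>[measurable]: "\<phi> \<in> borel_measurable (borel \<Otimes>\<^sub>M PiM (insert b J) (\<lambda>_. borel))" for \<phi>
    proof -
      define \<psi> where "\<psi> y r z = \<phi> (e *\<^sub>R y + r, shift z (y - \<beta> b t *\<^sub>R (e *\<^sub>R y + r)))" for y r z
      have \<psi>1: "(\<lambda>(r, \<omega>). \<psi> (Y b \<omega>) r (\<zeta> b \<omega>)) \<in> borel_measurable (borel \<Otimes>\<^sub>M F b)"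
        unfolding \<psi>_def case_prod_unfold by (intro measurable_compose[OF _ \<phi>] measurable_Pair sh; measurable)
      have \<psi>2: "(\<lambda>(y, z). \<psi> y r z) \<in> borel_measurable (borel \<Otimes>\<^sub>M PiM J (\<lambda>_. borel))" for r
        unfolding \<psi>_def case_prod_unfold by (intro measurable_compose[OF _ \<phi>] measurable_Pair sh; measurable)
      define \<Phi> where "\<Phi> u w = (\<integral>\<^sup>+\<omega>. \<phi> (u, shift (\<zeta> b \<omega>) w) \<partial>M)" for u w
      have \<Phi>[measurable]: "(\<lambda>(u, w). \<Phi> u w) \<in> borel_measurable (borel \<Otimes>\<^sub>M borel)"
      proof -
        have "(\<lambda>((u, w), \<omega>). \<phi> (u, shift (\<zeta> b \<omega>) w)) \<in> borel_measurable ((borel \<Otimes>\<^sub>M borel) \<Otimes>\<^sub>M M)"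
          unfolding case_prod_unfold by (intro measurable_compose[OF _ \<phi>] measurable_Pair sh; measurable)
        then show ?thesis unfolding \<Phi>_def case_prod_unfold by (intro M.borel_measurable_nn_integral) (simp add: case_prod_unfold)
      qed
      have "(\<integral>\<^sup>+\<omega>. \<phi> (Y t \<omega>, \<lambda>r\<in>insert b J. Z t r \<omega>) \<partial>M) = (\<integral>\<^sup>+\<omega>. \<psi> (Y b \<omega>) (R \<omega>) (\<zeta> b \<omega>) \<partial>M)"
        unfolding Z_shift \<psi>_def R_def by simp
      also have "\<dots> = (\<integral>\<^sup>+r. (\<integral>\<^sup>+\<omega>. \<psi> (Y b \<omega>) r (\<zeta> b \<omega>) \<partial>M) * gdens q r \<partial>lborel)"
        using nn_integral_gauss_indep[OF R subalgebra_F prob_M \<psi>1] by simp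
      also have "\<dots> = (\<integral>\<^sup>+r. (\<integral>\<^sup>+y. \<Phi> (e *\<^sub>R y + r) (y - \<beta> b t *\<^sub>R (e *\<^sub>R y + r)) * gdens p y \<partial>lborel) * gdens q r \<partial>lborel)"
      proof (intro nn_integral_cong arg_cong2[where f = "(*)"] refl)
        fix r
        have "J \<subseteq> {0..b}" using lt Jt by (auto simp: less_imp_le)
        from IH[OF b(1) this \<psi>2[of r]]
        show "(\<integral>\<^sup>+\<omega>. \<psi> (Y b \<omega>) r (\<zeta> b \<omega>) \<partial>M) = (\<integral>\<^sup>+y. \<Phi> (e *\<^sub>R y + r) (y - \<beta> b t *\<^sub>R (e *\<^sub>R y + r)) * gdens p y \<partial>lborel)"
          unfolding \<Phi>_def p_def \<psi>_def \<zeta>_def by (simp add: restrict_def)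
      qed
      also have "\<dots> = (\<integral>\<^sup>+r. \<integral>\<^sup>+y. \<Phi> (e *\<^sub>R y + r) (y - \<beta> b t *\<^sub>R (e *\<^sub>R y + r)) * gdens q r * gdens p y \<partial>lborel \<partial>lborel)"
        by (subst nn_integral_multc[symmetric]) (auto simp: ac_simps)
      also have "\<dots> = (\<integral>\<^sup>+y. \<integral>\<^sup>+r. \<Phi> (e *\<^sub>R y + r) (y - \<beta> b t *\<^sub>R (e *\<^sub>R y + r)) * gdens q r * gdens p y \<partial>lborel \<partial>lborel)"
        by (intro lborel_pair.Fubini') measurable
      also have "\<dots> = (\<integral>\<^sup>+u. \<integral>\<^sup>+w. \<Phi> u w * gdens (p * q / var t) w * gdens (var t) u \<partial>lborel \<partial>lborel)"
        using nn_integral_gdens_split[OF pq T \<Phi>] unfolding \<beta> .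
      also have "\<dots> = (\<integral>\<^sup>+u. (\<integral>\<^sup>+w. \<Phi> u w * gdens (p * q / var t) w \<partial>lborel) * gdens (var t) u \<partial>lborel)"
        by (intro nn_integral_cong nn_integral_multc) measurable
      finally show ?thesis unfolding \<Phi>_def .
    qed
    have "(\<integral>\<^sup>+\<omega>. \<phi> (u, \<lambda>r\<in>insert b J. Z t r \<omega>) \<partial>M)
       = (\<integral>\<^sup>+w. (\<integral>\<^sup>+\<omega>. \<phi> (u, shift (\<zeta> b \<omega>) w) \<partial>M) * gdens (p * q / var t) w \<partial>lborel)" for u
      using key[of "\<lambda>x. \<phi> (u, snd x)"] nn_integral_gdens[OF var_pos[OF t], where 'n = 'n]
      by (simp add: nn_integral_cmult)
    then show ?thesis using key[OF insert.prems(3)] by (simp add: restrict_def)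
  qed
qed

text \<open>The sigma-algebra generated by the whole bridge.\<close>

definition bridge_algebra :: "real \<Rightarrow> 'w measure" where
  "bridge_algebra t = vimage_algebra (space M) (\<lambda>\<omega>. \<lambda>r\<in>{0..t}. Z t r \<omega>) (PiM {0..t} (\<lambda>_. borel))"

lemma space_bridge_algebra [simp]: "space (bridge_algebra t) = space M"
  by (simp add: bridge_algebra_def)

lemma bridge_measurable: "(\<lambda>\<omega>. \<lambda>r\<in>{0..t}. Z t r \<omega>) \<in> measurable M (PiM {0..t} (\<lambda>_. borel))"
  by (intro measurable_restrict Z_measurable) auto

lemma subalgebra_bridge: "subalgebra M (bridge_algebra t)"
  unfolding subalgebra_def
proof (intro conjI)
  show "sets (bridge_algebra t) \<subseteq> sets M"
    unfolding bridge_algebra_def using bridge_measurable[of t]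
    by (intro sets_image_in_sets) auto
qed simp

lemma Z_measurable_bridge:
  assumes "s \<in> {0..t}"
  shows "Z t s \<in> borel_measurable (bridge_algebra t)"
proof -
  have "(\<lambda>\<omega>. \<lambda>r\<in>{0..t}. Z t r \<omega>) \<in> measurable (bridge_algebra t) (PiM {0..t} (\<lambda>_. borel))"
    unfolding bridge_algebra_def by (rule measurable_vimage_algebra1) (auto simp: space_PiM)
  from measurable_compose[OF this measurable_component_singleton[OF assms]] show ?thesis
    using assms by simp
qed

text \<open>For a fixed Borel set \<open>S\<close>, two measures on the space of functions on \<open>{0..t}\<close> agree on cylinder
  sets by the finite-dimensional statement, hence everywhere.\<close>

lemma gauss_indep_bridge:
  assumes t: "t > 0"
  shows "gauss_indep M (bridge_algebra t) (Y t) (var t)"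
  unfolding gauss_indep_def
proof (intro conjI ballI)
  show YM[measurable]: "Y t \<in> borel_measurable M" using Y_measurable t by auto
  show v: "0 < var t" using t by (rule var_pos)
  let ?P = "PiM {0..t} (\<lambda>_. borel :: (real^'n) measure)"
  let ?z = "\<lambda>\<omega>. \<lambda>r\<in>{0..t}. Z t r \<omega>"
  define N :: "(real^'n) measure" where "N = density lborel (\<lambda>z. ennreal (gdens (var t) z))"
  note bridge_measurable[of t, measurable]
  fix A and S :: "(real^'n) set" assume A: "A \<in> sets (bridge_algebra t)" and S[measurable]: "S \<in> sets borel"
  have zs: "?z \<in> space M \<rightarrow> space ?P" by (auto simp: space_PiM)
  obtain C where C[measurable]: "C \<in> sets ?P" and AC: "A = ?z -` C \<inter> space M"
    using A unfolding bridge_algebra_def sets_vimage_algebra2[OF zs] by auto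
  define P where "P = distr (density M (\<lambda>\<omega>. indicator S (Y t \<omega>))) ?P ?z"
  define Q where "Q = scale_measure (emeasure N S) (distr M ?P ?z)"
  have Pe: "emeasure P C = (\<integral>\<^sup>+\<omega>. indicator S (Y t \<omega>) * indicator C (?z \<omega>) \<partial>M)" if [measurable]: "C \<in> sets ?P" for C
  proof -
    have "emeasure P C = (\<integral>\<^sup>+\<omega>. indicator S (Y t \<omega>) * indicator (?z -` C \<inter> space M) \<omega> \<partial>M)"
      unfolding P_def by (subst emeasure_distr, measurable, simp, subst emeasure_density) auto
    also have "\<dots> = (\<integral>\<^sup>+\<omega>. indicator S (Y t \<omega>) * indicator C (?z \<omega>) \<partial>M)"
      by (intro nn_integral_cong) (auto simp: indicator_def)
    finally show ?thesis .
  qed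
  have Qe: "emeasure Q C = emeasure N S * (\<integral>\<^sup>+\<omega>. indicator C (?z \<omega>) \<partial>M)" if [measurable]: "C \<in> sets ?P" for C
  proof -
    have "emeasure M (?z -` C \<inter> space M) = (\<integral>\<^sup>+\<omega>. indicator (?z -` C \<inter> space M) \<omega> \<partial>M)"
      by (rule nn_integral_indicator[symmetric]) measurable
    also have "\<dots> = (\<integral>\<^sup>+\<omega>. indicator C (?z \<omega>) \<partial>M)"
      by (intro nn_integral_cong) (auto simp: indicator_def)
    finally show ?thesis unfolding Q_def by (simp add: emeasure_distr)
  qed
  have "P = Q"
  proof (rule measure_eqI_PiM_infinite)
    show "sets P = sets ?P" "sets Q = sets ?P" by (simp_all add: P_def Q_def)
    fix D and J :: "real set" assume J: "finite J" "J \<subseteq> {0..t}" and D: "\<And>i. i \<in> J \<Longrightarrow> D i \<in> sets (borel :: (real^'n) measure)"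
    let ?E = "prod_emb {0..t} (\<lambda>_. borel) J (Pi\<^sub>E J D)"
    have E: "?E \<in> sets ?P" using J D by (intro sets_PiM_I) auto
    have D'[measurable]: "Pi\<^sub>E J D \<in> sets (PiM J (\<lambda>_. borel :: (real^'n) measure))"
      using J D by (intro sets_PiM_I_finite) auto
    have ind: "indicator ?E (?z \<omega>) = (indicator (Pi\<^sub>E J D) (\<lambda>r\<in>J. Z t r \<omega>) :: ennreal)" for \<omega>
    proof -
      have "restrict (?z \<omega>) J = (\<lambda>r\<in>J. Z t r \<omega>)" using J(2) by (auto simp: restrict_def fun_eq_iff)
      then show ?thesis by (auto simp: indicator_def prod_emb_def)
    qed
    have zJ[measurable]: "(\<lambda>\<omega>. \<lambda>r\<in>J. Z t r \<omega>) \<in> measurable M (PiM J (\<lambda>_. borel))"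
      using J by (intro measurable_restrict Z_measurable) auto
    have "emeasure P ?E = (\<integral>\<^sup>+\<omega>. indicator S (Y t \<omega>) * indicator (Pi\<^sub>E J D) (\<lambda>r\<in>J. Z t r \<omega>) \<partial>M)"
      unfolding Pe[OF E] ind ..
    also have "\<dots> = (\<integral>\<^sup>+y. (\<integral>\<^sup>+\<omega>. indicator S y * indicator (Pi\<^sub>E J D) (\<lambda>r\<in>J. Z t r \<omega>) \<partial>M) * gdens (var t) y \<partial>lborel)"
      using bridge_fdd[OF J(1) t J(2), of "\<lambda>(y, z). indicator S y * indicator (Pi\<^sub>E J D) z"] by simp
    also have "\<dots> = (\<integral>\<^sup>+y. (gdens (var t) y * indicator S y) * (\<integral>\<^sup>+\<omega>. indicator (Pi\<^sub>E J D) (\<lambda>r\<in>J. Z t r \<omega>) \<partial>M) \<partial>lborel)"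
      by (intro nn_integral_cong) (auto simp: nn_integral_cmult indicator_def mult.commute)
    also have "\<dots> = (\<integral>\<^sup>+y. ennreal (gdens (var t) y) * indicator S y \<partial>lborel) * (\<integral>\<^sup>+\<omega>. indicator (Pi\<^sub>E J D) (\<lambda>r\<in>J. Z t r \<omega>) \<partial>M)"
      by (subst nn_integral_multc[symmetric]) (auto intro!: nn_integral_cong simp: indicator_def)
    also have "\<dots> = emeasure Q ?E"
      unfolding Qe[OF E] ind N_def using S by (subst emeasure_density) auto
    finally show "emeasure P ?E = emeasure Q ?E" .
  next
    show "finite_measure P"
    proof (rule finite_measureI)
      have "space ?P \<in> sets ?P" by simp
      from Pe[OF this] have "emeasure P (space ?P) \<le> (\<integral>\<^sup>+\<omega>. 1 \<partial>M)"
        by (simp only:) (intro nn_integral_mono, simp add: indicator_def)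
      then show "emeasure P (space P) \<noteq> \<infinity>"
        by (auto simp: P_def M.emeasure_space_1 top_unique)
    qed
  qed
  have "A \<inter> (Y t -` S \<inter> space M) \<in> sets M" unfolding AC by measurable
  then have "emeasure M (A \<inter> (Y t -` S \<inter> space M)) = (\<integral>\<^sup>+\<omega>. indicator (A \<inter> (Y t -` S \<inter> space M)) \<omega> \<partial>M)"
    by (rule nn_integral_indicator[symmetric])
  also have "\<dots> = emeasure P C"
    unfolding Pe[OF C] AC by (intro nn_integral_cong) (auto simp: indicator_def)
  also have "\<dots> = emeasure N S * (\<integral>\<^sup>+\<omega>. indicator C (?z \<omega>) \<partial>M)"
    unfolding \<open>P = Q\<close> by (rule Qe[OF C])
  also have "(\<integral>\<^sup>+\<omega>. indicator C (?z \<omega>) \<partial>M) = (\<integral>\<^sup>+\<omega>. indicator A \<omega> \<partial>M)"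
    unfolding AC by (intro nn_integral_cong) (auto simp: indicator_def)
  also have "\<dots> = emeasure M A"
    by (rule nn_integral_indicator) (use A subalgebra_bridge in \<open>auto simp: subalgebra_def\<close>)
  finally show "emeasure M (A \<inter> (Y t -` S \<inter> space M))
      = emeasure M A * emeasure (density lborel (\<lambda>z. ennreal (gdens (var t) z))) S"
    unfolding N_def by (simp only: mult.commute)
qed

end

section \<open>Regular functions of polynomial growth\<close>

text \<open>Polynomial growth with a positive constant and with all sufficiently large exponents, so that
  finitely many bounds can be combined.\<close>

lemma poly_growth_pos:
  assumes "poly_growth g"
  obtains C m where "C > 0" "\<And>x m'. m \<le> m' \<Longrightarrow> \<bar>g x\<bar> \<le> C * (1 + norm x) ^ m'"
proof -
  from assms obtain C m where C: "\<And>x. \<bar>g x\<bar> \<le> C * (1 + norm x) ^ m" unfolding poly_growth_def by auto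
  have "\<bar>g x\<bar> \<le> (\<bar>C\<bar> + 1) * (1 + norm x) ^ m'" if "m \<le> m'" for x m'
  proof -
    have "C * (1 + norm x) ^ m \<le> (\<bar>C\<bar> + 1) * (1 + norm x) ^ m'"
      using that by (intro mult_mono power_increasing) auto
    then show ?thesis using C[of x] by linarith
  qed
  moreover have "\<bar>C\<bar> + 1 > 0" by simp
  ultimately show thesis using that by blast
qed

lemma poly_growth_vec:
  fixes g :: "real ^ 'n \<Rightarrow> 'b::real_normed_vector ^ 'm"
  assumes "\<And>i. \<exists>C m. C > 0 \<and> (\<forall>x m'. m \<le> m' \<longrightarrow> norm (g x $ i) \<le> C * (1 + norm x) ^ m')"
  shows "\<exists>C m. C > 0 \<and> (\<forall>x m'. m \<le> m' \<longrightarrow> norm (g x) \<le> C * (1 + norm x) ^ m')"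
proof -
  from assms obtain C m where C: "\<And>i. C i > 0" "\<And>i x m'. m i \<le> m' \<Longrightarrow> norm (g x $ i) \<le> C i * (1 + norm x) ^ m'"
    by metis
  have "norm (g x) \<le> (\<Sum>i\<in>UNIV. C i) * (1 + norm x) ^ m'" if "(\<Sum>i\<in>UNIV. m i) \<le> m'" for x m'
  proof -
    have "norm (g x) \<le> (\<Sum>i\<in>UNIV. norm (g x $ i))"
      unfolding norm_vec_def by (rule L2_set_le_sum) simp
    also have "\<dots> \<le> (\<Sum>i\<in>UNIV. C i * (1 + norm x) ^ m')"
    proof (rule sum_mono)
      fix i
      have "m i \<le> (\<Sum>i\<in>UNIV. m i)" by (rule member_le_sum) auto
      then show "norm (g x $ i) \<le> C i * (1 + norm x) ^ m'" using that by (intro C) simp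
    qed
    finally show ?thesis by (simp add: sum_distrib_right)
  qed
  moreover have "(\<Sum>i\<in>UNIV. C i) > 0" using C(1) by (intro sum_pos) auto
  ultimately show ?thesis by blast
qed

lemma grad_eq:
  assumes "(g has_derivative (\<lambda>k. w \<bullet> k)) (at x)"
  shows "grad g x = w"
  unfolding grad_def frechet_derivative_at[OF assms, symmetric]
  by (simp add: inner_axis vec_eq_iff)

lemma has_derivative_grad:
  assumes "g differentiable at x"
  shows "(g has_derivative (\<lambda>k. grad g x \<bullet> k)) (at x)"
proof -
  have d: "(g has_derivative frechet_derivative g (at x)) (at x)"
    using assms by (simp add: frechet_derivative_works)
  then interpret bounded_linear "frechet_derivative g (at x)" by (rule has_derivative_bounded_linear)
  have "frechet_derivative g (at x) = (\<lambda>k. grad g x \<bullet> k)"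
  proof
    fix k
    have "frechet_derivative g (at x) k = frechet_derivative g (at x) (\<Sum>i\<in>UNIV. (k $ i) *\<^sub>R axis i 1)"
      by (simp add: basis_expansion flip: scalar_mult_eq_scaleR)
    also have "\<dots> = (\<Sum>i\<in>UNIV. k $ i * frechet_derivative g (at x) (axis i 1))"
      by (simp add: sum scaleR)
    finally show "frechet_derivative g (at x) k = grad g x \<bullet> k" by (simp add: grad_def inner_vec_def mult.commute)
  qed
  with d show ?thesis by simp
qed

lemma Hess_eq:
  assumes "(grad g has_derivative (\<lambda>k. H *v k)) (at x)"
  shows "Hess g x = H"
  unfolding Hess_def jacobian_def frechet_derivative_at[OF assms, symmetric]
  by (rule matrix_of_matrix_vector_mul)

lemma D_class_2:
  fixes V :: "real ^ 'n \<Rightarrow> real"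
  assumes "D_class 2 V"
  shows "(V has_derivative (\<lambda>k. grad V x \<bullet> k)) (at x)"
    and "(grad V has_derivative (\<lambda>k. Hess V x *v k)) (at x)"
    and "continuous_on UNIV (Hess V)"
    and "\<exists>C m. C > 0 \<and> (\<forall>x. norm (grad V x) \<le> C * (1 + norm x) ^ m \<and> norm (Hess V x) \<le> C * (1 + norm x) ^ m)"
proof -
  have V: "\<And>x. V differentiable at x" "\<And>i x. (\<lambda>x. grad V x $ i) differentiable at x"
    and pg: "\<And>i. poly_growth (\<lambda>x. grad V x $ i)"
    and c: "\<And>i j. continuous_on UNIV (\<lambda>x. grad (\<lambda>x. grad V x $ i) x $ j)"
    and ph: "\<And>i j. poly_growth (\<lambda>x. grad (\<lambda>x. grad V x $ i) x $ j)"
    using assms by (auto simp: numeral_2_eq_2)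
  show "(V has_derivative (\<lambda>k. grad V x \<bullet> k)) (at x)"
    by (rule has_derivative_grad[OF V(1)])
  have dg: "(grad V has_derivative (\<lambda>k. (\<chi> i. grad (\<lambda>x. grad V x $ i) x) *v k)) (at x)" for x
  proof -
    have "((\<lambda>x. \<chi> i. grad V x $ i) has_derivative (\<lambda>k. \<chi> i. grad (\<lambda>x. grad V x $ i) x \<bullet> k)) (at x)"
    proof (subst has_derivative_componentwise_within, rule ballI)
      fix b :: "real ^ 'n" assume "b \<in> Basis"
      then obtain i where b: "b = axis i 1" unfolding Basis_vec_real by blast
      show "((\<lambda>x. (\<chi> i. grad V x $ i) \<bullet> b) has_derivative (\<lambda>k. (\<chi> i. grad (\<lambda>x. grad V x $ i) x \<bullet> k) \<bullet> b)) (at x)"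
        using has_derivative_grad[OF V(2)[of i x]] unfolding b inner_axis by simp
    qed
    then show ?thesis by (simp add: matrix_vector_mult_def inner_vec_def)
  qed
  have H: "Hess V x = (\<chi> i. grad (\<lambda>x. grad V x $ i) x)" for x
    by (rule Hess_eq[OF dg])
  show "(grad V has_derivative (\<lambda>k. Hess V x *v k)) (at x)"
    using dg unfolding H .
  show "continuous_on UNIV (Hess V)"
  proof -
    have "Hess V = (\<lambda>x. \<chi> i j. grad (\<lambda>x. grad V x $ i) x $ j)" by (simp add: H fun_eq_iff vec_eq_iff)
    moreover have "continuous_on UNIV (\<lambda>x. \<chi> i j. grad (\<lambda>x. grad V x $ i) x $ j)"
      by (intro continuous_on_vec_lambda c)
    ultimately show ?thesis by simp
  qed
  have "\<exists>C m. C > 0 \<and> (\<forall>x m'. m \<le> m' \<longrightarrow> norm (grad V x) \<le> C * (1 + norm x) ^ m')"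
    using poly_growth_pos[OF pg] by (intro poly_growth_vec) (metis real_norm_def)
  moreover have "\<exists>C m. C > 0 \<and> (\<forall>x m'. m \<le> m' \<longrightarrow> norm (Hess V x) \<le> C * (1 + norm x) ^ m')"
    using poly_growth_pos[OF ph] by (intro poly_growth_vec) (simp add: H, metis)
  ultimately obtain C1 m1 C2 m2 where C: "C1 > 0" "C2 > 0"
    "\<And>x m'. m1 \<le> m' \<Longrightarrow> norm (grad V x) \<le> C1 * (1 + norm x) ^ m'"
    "\<And>x m'. m2 \<le> m' \<Longrightarrow> norm (Hess V x) \<le> C2 * (1 + norm x) ^ m'" by auto
  show "\<exists>C m. C > 0 \<and> (\<forall>x. norm (grad V x) \<le> C * (1 + norm x) ^ m \<and> norm (Hess V x) \<le> C * (1 + norm x) ^ m)"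
  proof (intro exI[of _ "C1 + C2"] exI[of _ "m1 + m2"] conjI allI)
    fix x :: "real ^ 'n"
    have "C1 * (1 + norm x) ^ (m1 + m2) \<le> (C1 + C2) * (1 + norm x) ^ (m1 + m2)"
      "C2 * (1 + norm x) ^ (m1 + m2) \<le> (C1 + C2) * (1 + norm x) ^ (m1 + m2)"
      using C(1,2) by (intro mult_right_mono; simp)+
    then show "norm (grad V x) \<le> (C1 + C2) * (1 + norm x) ^ (m1 + m2)"
      "norm (Hess V x) \<le> (C1 + C2) * (1 + norm x) ^ (m1 + m2)"
      using C(3)[of "m1 + m2" x] C(4)[of "m1 + m2" x] by auto
  qed (use C in auto)
qed

lemma norm_matrix_vector_mult_le:
  fixes A :: "real ^ 'n ^ 'm"
  shows "norm (A *v k) \<le> norm A * norm k"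
proof -
  have "norm (A *v k) = L2_set (\<lambda>i. \<bar>A $ i \<bullet> k\<bar>) UNIV"
    by (simp add: norm_vec_def matrix_vector_mult_def inner_vec_def)
  also have "\<dots> \<le> L2_set (\<lambda>i. norm (A $ i) * norm k) UNIV"
    by (intro L2_set_mono) (auto simp: Cauchy_Schwarz_ineq2)
  also have "\<dots> = norm A * norm k"
    by (simp add: norm_vec_def[of A] L2_set_left_distrib)
  finally show ?thesis .
qed

lemma bounded_linear_matrix_vector_mult_left: "bounded_linear (\<lambda>A :: real ^ 'n ^ 'm. A *v k)"
  by (rule bounded_linear_intro[where K = "norm k"])
    (auto simp: matrix_vector_mult_add_rdistrib scaleR_matrix_vector_assoc norm_matrix_vector_mult_le)

lemma norm_outer: "norm (u \<otimes>\<^sub>v w) = norm u * norm w" for u w :: "real ^ 'n"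
proof -
  have "u \<otimes>\<^sub>v w = (\<chi> i. (u $ i) *\<^sub>R w)" by (simp add: outer_def vec_eq_iff)
  then show ?thesis by (simp add: norm_vec_def[of "\<chi> i. (u $ i) *\<^sub>R w"] norm_vec_def[of u] L2_set_left_distrib)
qed

lemma outer_mult_vec: "(u \<otimes>\<^sub>v w) *v k = (w \<bullet> k) *\<^sub>R u" for u w k :: "real ^ 'n"
  by (simp add: outer_def matrix_vector_mult_def inner_vec_def vec_eq_iff sum_distrib_left mult.commute mult.left_commute)

lemma outer_measurable:
  fixes g :: "'q \<Rightarrow> real ^ 'n"
  assumes [measurable]: "g \<in> borel_measurable N"
  shows "(\<lambda>q. g q \<otimes>\<^sub>v g q) \<in> borel_measurable N"
proof -
  have "continuous_on UNIV (\<lambda>u :: real ^ 'n. u \<otimes>\<^sub>v u)"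
    unfolding outer_def by (intro continuous_on_vec_lambda continuous_intros)
  from borel_measurable_continuous_on[OF this assms] show ?thesis .
qed

section \<open>Integrals along paths\<close>

lemma has_derivative_path_integral:
  fixes \<phi> :: "'a::euclidean_space \<Rightarrow> 'b::euclidean_space" and w \<alpha> :: "real \<Rightarrow> real"
  assumes w: "continuous_on {0..t} w" and \<alpha>: "continuous_on {0..t} \<alpha>" and c: "continuous_on {0..t} c"
    and der: "\<And>y. (\<phi> has_derivative \<phi>' y) (at y)"
    and cont: "\<And>k. continuous_on UNIV (\<lambda>y. \<phi>' y k)"
    and bnd: "\<And>y k. norm (\<phi>' y k) \<le> b y * norm k" and b: "continuous_on UNIV b"
  shows "((\<lambda>x. LBINT s:{0..t}. w s *\<^sub>R \<phi> (\<alpha> s *\<^sub>R x + c s)) has_derivative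
    (\<lambda>k. LBINT s:{0..t}. (w s * \<alpha> s) *\<^sub>R \<phi>' (\<alpha> s *\<^sub>R x0 + c s) k)) (at x0)"
proof -
  have \<phi>c: "continuous_on UNIV \<phi>"
    using der by (intro continuous_at_imp_continuous_on) (auto dest: has_derivative_continuous)
  have cs: "continuous_on {0..t} (\<lambda>s. \<alpha> s *\<^sub>R x + c s)" for x by (intro continuous_intros \<alpha> c)
  have comp: "continuous_on {0..t} (\<lambda>s. g (\<alpha> s *\<^sub>R x + c s))" if "continuous_on UNIV g" for g :: "'a \<Rightarrow> 'c::topological_space" and x
    using continuous_on_compose2[OF that cs] by simp
  have "compact ((\<lambda>(x, s). w s * \<alpha> s * b (\<alpha> s *\<^sub>R x + c s)) ` (cball x0 1 \<times> {0..t}))"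
  proof (rule compact_continuous_image)
    have s: "continuous_on (cball x0 1 \<times> {0..t}) (\<lambda>p. g (snd p))" if "continuous_on {0..t} g" for g :: "real \<Rightarrow> 'd::topological_space"
      by (rule continuous_on_compose2[OF that continuous_on_snd[OF continuous_on_id]]) auto
    have "continuous_on (cball x0 1 \<times> {0..t}) (\<lambda>p. b (\<alpha> (snd p) *\<^sub>R fst p + c (snd p)))"
      by (rule continuous_on_compose2[OF b]) (auto intro!: continuous_intros s \<alpha> c)
    then show "continuous_on (cball x0 1 \<times> {0..t}) (\<lambda>(x, s). w s * \<alpha> s * b (\<alpha> s *\<^sub>R x + c s))"
      unfolding case_prod_beta by (intro continuous_intros s w \<alpha>)
  qed (intro compact_Times compact_cball compact_Icc)
  then obtain K where K: "K > 0" "\<And>x s. x \<in> cball x0 1 \<Longrightarrow> s \<in> {0..t} \<Longrightarrow> \<bar>w s * \<alpha> s * b (\<alpha> s *\<^sub>R x + c s)\<bar> \<le> K"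
    by (auto dest!: compact_imp_bounded simp: bounded_pos)
  have lin: "linear (\<phi>' y)" for y using der has_derivative_linear by blast
  have "((\<lambda>x. \<integral>s. indicator {0..t} s *\<^sub>R (w s *\<^sub>R \<phi> (\<alpha> s *\<^sub>R x + c s)) \<partial>lborel) has_derivative
    (\<lambda>k. \<integral>s. indicator {0..t} s *\<^sub>R ((w s * \<alpha> s) *\<^sub>R \<phi>' (\<alpha> s *\<^sub>R x0 + c s) k) \<partial>lborel)) (at x0)"
  proof (rule has_derivative_integral_dominated[where r = 1 and D = "\<lambda>s. indicator {0..t} s *\<^sub>R K"
      and h' = "\<lambda>x s k. indicator {0..t} s *\<^sub>R ((w s * \<alpha> s) *\<^sub>R \<phi>' (\<alpha> s *\<^sub>R x + c s) k)"])
    show "integrable lborel (\<lambda>s. indicator {0..t} s *\<^sub>R (w s *\<^sub>R \<phi> (\<alpha> s *\<^sub>R x + c s)))" for x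
      by (rule borel_integrable_atLeastAtMost'[unfolded set_integrable_def])
        (intro continuous_intros w comp \<phi>c)
    show "((\<lambda>x. indicator {0..t} s *\<^sub>R (w s *\<^sub>R \<phi> (\<alpha> s *\<^sub>R x + c s))) has_derivative
        (\<lambda>k. indicator {0..t} s *\<^sub>R ((w s * \<alpha> s) *\<^sub>R \<phi>' (\<alpha> s *\<^sub>R x + c s) k))) (at x)" for s x
    proof -
      have "((\<lambda>x. \<phi> (\<alpha> s *\<^sub>R x + c s)) has_derivative (\<lambda>k. \<phi>' (\<alpha> s *\<^sub>R x + c s) (\<alpha> s *\<^sub>R k))) (at x)"
        by (rule has_derivative_compose[OF _ der]) (auto intro!: derivative_eq_intros)
      then have "((\<lambda>x. indicator {0..t} s *\<^sub>R (w s *\<^sub>R \<phi> (\<alpha> s *\<^sub>R x + c s))) has_derivative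
         (\<lambda>k. indicator {0..t} s *\<^sub>R (w s *\<^sub>R \<phi>' (\<alpha> s *\<^sub>R x + c s) (\<alpha> s *\<^sub>R k)))) (at x)"
        by (intro has_derivative_scaleR_right)
      then show ?thesis by (simp add: linear_scale[OF lin])
    qed
    have "integrable lborel (\<lambda>s. indicator {0..t} s *\<^sub>R ((w s * \<alpha> s) *\<^sub>R \<phi>' (\<alpha> s *\<^sub>R x0 + c s) k))" for k
      by (rule borel_integrable_atLeastAtMost'[unfolded set_integrable_def])
        (intro continuous_intros w \<alpha> comp cont)
    then show "(\<lambda>s. indicator {0..t} s *\<^sub>R ((w s * \<alpha> s) *\<^sub>R \<phi>' (\<alpha> s *\<^sub>R x0 + c s) k)) \<in> borel_measurable lborel" for k
      by auto
    show "norm (indicator {0..t} s *\<^sub>R ((w s * \<alpha> s) *\<^sub>R \<phi>' (\<alpha> s *\<^sub>R x + c s) k)) \<le> (indicator {0..t} s *\<^sub>R K) * norm k"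
      if "x \<in> ball x0 1" for x s k
    proof (cases "s \<in> {0..t}")
      case True
      have "norm ((w s * \<alpha> s) *\<^sub>R \<phi>' (\<alpha> s *\<^sub>R x + c s) k) \<le> \<bar>w s * \<alpha> s\<bar> * (b (\<alpha> s *\<^sub>R x + c s) * norm k)"
        unfolding norm_scaleR by (intro mult_left_mono bnd) simp
      also have "\<dots> \<le> \<bar>w s * \<alpha> s * b (\<alpha> s *\<^sub>R x + c s)\<bar> * norm k"
        unfolding mult.assoc[symmetric] by (intro mult_right_mono) (auto simp: abs_mult intro!: mult_left_mono)
      also have "\<dots> \<le> K * norm k"
        using K(2)[of x s] True that by (intro mult_right_mono) auto
      finally show ?thesis using True by simp
    qed simp
    show "integrable lborel (\<lambda>s. indicator {0..t} s *\<^sub>R K)"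
      by (rule borel_integrable_atLeastAtMost'[unfolded set_integrable_def]) simp
  qed simp
  then show ?thesis unfolding set_lebesgue_integral_def .
qed

lemma (in pair_sigma_finite) integrable_mult_prod:
  fixes f g :: "_ \<Rightarrow> real"
  assumes f: "integrable M1 f" and g: "integrable M2 g"
  shows "integrable (M1 \<Otimes>\<^sub>M M2) (\<lambda>p. f (fst p) * g (snd p))"
proof (rule Fubini_integrable)
  have [measurable]: "f \<in> borel_measurable M1" "g \<in> borel_measurable M2" using f g by auto
  show "(\<lambda>p. f (fst p) * g (snd p)) \<in> borel_measurable (M1 \<Otimes>\<^sub>M M2)" by measurable
qed (use f g in \<open>auto simp: abs_mult\<close>)

lemma measurable_set_integral_Icc:
  fixes g :: "'p \<Rightarrow> real \<Rightarrow> 'b::{banach, second_countable_topology}"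
  assumes [measurable]: "(\<lambda>q. g (fst q) (snd q)) \<in> borel_measurable (N \<Otimes>\<^sub>M borel)"
  shows "(\<lambda>p. LBINT s:{a..b}. g p s) \<in> borel_measurable N"
  unfolding set_lebesgue_integral_def
proof (rule lborel.borel_measurable_lebesgue_integral)
  have "(\<lambda>q. indicator {a..b} (snd q) *\<^sub>R g (fst q) (snd q)) \<in> borel_measurable (N \<Otimes>\<^sub>M borel)" by measurable
  then show "(\<lambda>(p, s). indicator {a..b} s *\<^sub>R g p s) \<in> borel_measurable (N \<Otimes>\<^sub>M lborel)"
    by (simp add: case_prod_unfold cong: measurable_cong_sets)
qed

lemma norm_set_integral_le:
  fixes g :: "real \<Rightarrow> 'b::{banach, second_countable_topology}"
  assumes g: "continuous_on {a..b} g" and u: "continuous_on {a..b} u"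
    and le: "\<And>s. s \<in> {a..b} \<Longrightarrow> norm (g s) \<le> u s"
  shows "norm (LBINT s:{a..b}. g s) \<le> (LBINT s:{a..b}. u s)"
proof -
  have "norm (LBINT s:{a..b}. g s) \<le> (\<integral>s. norm (indicator {a..b} s *\<^sub>R g s) \<partial>lborel)"
    unfolding set_lebesgue_integral_def by (rule integral_norm_bound)
  also have "\<dots> = (LBINT s:{a..b}. norm (g s))"
    unfolding set_lebesgue_integral_def by simp
  also have "\<dots> \<le> (LBINT s:{a..b}. u s)"
    by (intro set_integral_mono borel_integrable_atLeastAtMost' continuous_intros g u le)
  finally show ?thesis .
qed

lemma set_integral_square_le:
  fixes g :: "real \<Rightarrow> real"
  assumes g: "continuous_on {0..t} g" and t: "t > 0"
  shows "(LBINT s:{0..t}. g s)\<^sup>2 \<le> t * (LBINT s:{0..t}. (g s)\<^sup>2)"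
proof -
  define c where "c = (LBINT s:{0..t}. g s) / t"
  have i: "set_integrable lborel {0..t} (\<lambda>s. (g s)\<^sup>2)" "set_integrable lborel {0..t} (\<lambda>s. 2 * c * g s)"
    "set_integrable lborel {0..t} (\<lambda>s. c\<^sup>2)"
    by (intro borel_integrable_atLeastAtMost' continuous_intros g)+
  have "0 \<le> (LBINT s:{0..t}. (g s - c)\<^sup>2)"
    unfolding set_lebesgue_integral_def by (rule integral_nonneg_AE) simp
  also have "\<dots> = (LBINT s:{0..t}. ((g s)\<^sup>2 - 2 * c * g s) + c\<^sup>2)"
    by (simp add: power2_eq_square algebra_simps)
  also have "\<dots> = (LBINT s:{0..t}. (g s)\<^sup>2) - 2 * c * (LBINT s:{0..t}. g s) + t * c\<^sup>2"
    using t by (subst set_integral_add(2), intro set_integral_diff i, intro i)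
      (subst set_integral_diff(2)[OF i(1,2)], simp add: set_integral_const)
  also have "\<dots> = (LBINT s:{0..t}. (g s)\<^sup>2) - (LBINT s:{0..t}. g s)\<^sup>2 / t"
    using t by (simp add: c_def power2_eq_square)
  finally show ?thesis using t by (simp add: pos_divide_le_eq mult.commute)
qed

lemma mult_le_sum_squares: "x * y \<le> x\<^sup>2 + y\<^sup>2" for x y :: real
proof -
  have "0 \<le> (x - y)\<^sup>2 + x\<^sup>2 + y\<^sup>2" by simp
  then show ?thesis by (simp add: power2_diff)
qed

lemma integrable_scaleR_iff:
  fixes h :: "'q \<Rightarrow> 'b::{banach, second_countable_topology}"
  assumes "c \<noteq> 0"
  shows "integrable N (\<lambda>q. c *\<^sub>R h q) \<longleftrightarrow> integrable N h"
  using integrable_scaleR_right[of "inverse c" N "\<lambda>q. c *\<^sub>R h q"] assms by auto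

section \<open>The Feynman-Kac kernel over the bridge\<close>

text \<open>Differentiability does not depend on the sign of \<open>f\<close>; non-negativity is assumed in a later locale.\<close>

locale feynman_kac = ou_process M F B X a \<sigma>
  for M :: "'w measure" and F :: "real \<Rightarrow> 'w measure"
    and B :: "real \<Rightarrow> 'w \<Rightarrow> real ^ 'n"
    and X :: "real ^ 'n \<Rightarrow> real \<Rightarrow> 'w \<Rightarrow> real ^ 'n" and a \<sigma> :: real +
  fixes V f :: "real ^ 'n \<Rightarrow> real" and t :: real
  assumes t: "t > 0" and V_bdd: "bdd_below (range V)" and V_D: "D_class 2 V"
    and f_L2: "f \<in> L2_space (equilibrium a \<sigma>)"
begin

text \<open>The coefficient of the starting point in the process pinned at time \<open>t\<close>.\<close>

definition \<alpha> :: "real \<Rightarrow> real" where "\<alpha> s = sinh (a * (t - s)) / sinh (a * t)"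

definition clamp_time :: "real \<Rightarrow> real" where "clamp_time s = max 0 (min t s)"

text \<open>The bridge to time \<open>t\<close>, extended to all real times as a constant before \<open>0\<close> and after \<open>t\<close>.\<close>

definition bridge :: "real \<Rightarrow> 'w \<Rightarrow> real ^ 'n" where "bridge s \<omega> = Z t (clamp_time s) \<omega>"

text \<open>The trajectory from \<open>x\<close> to \<open>z\<close>, where \<open>p = (z, \<omega>)\<close> consists of the endpoint at time \<open>t\<close>
  and of the scenario that determines the bridge.\<close>

definition bridged_path :: "real ^ 'n \<Rightarrow> (real ^ 'n) \<times> 'w \<Rightarrow> real \<Rightarrow> real ^ 'n" where
  "bridged_path x p s = \<alpha> s *\<^sub>R x + (\<beta> s t *\<^sub>R fst p + bridge s (snd p))"

abbreviation e :: real where "e \<equiv> exp (- a * t)"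

abbreviation v :: real where "v \<equiv> var t"

text \<open>The exponent in the Feynman-Kac weight along this trajectory, and its gradient and Hessian
  in \<open>x\<close>.\<close>

definition potential :: "real ^ 'n \<Rightarrow> (real ^ 'n) \<times> 'w \<Rightarrow> real" where
  "potential x p = (LBINT s:{0..t}. V (bridged_path x p s))"

definition grad_potential :: "real ^ 'n \<Rightarrow> (real ^ 'n) \<times> 'w \<Rightarrow> real ^ 'n" where
  "grad_potential x p = (LBINT s:{0..t}. \<alpha> s *\<^sub>R grad V (bridged_path x p s))"

definition Hess_potential :: "real ^ 'n \<Rightarrow> (real ^ 'n) \<times> 'w \<Rightarrow> real ^ 'n ^ 'n" where
  "Hess_potential x p = (LBINT s:{0..t}. (\<alpha> s)\<^sup>2 *\<^sub>R Hess V (bridged_path x p s))"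

text \<open>The Feynman-Kac weight as a function of endpoint and scenario.\<close>

definition weight :: "real ^ 'n \<Rightarrow> (real ^ 'n) \<times> 'w \<Rightarrow> real" where
  "weight x p = f (fst p) * exp (- potential x p)"

text \<open>The integrand of the representation of \<open>P\<^sub>t\<^sup>V f(x)\<close> as an integral over endpoints and
  scenarios; the Gaussian factor is the density of \<open>X\<^sub>t\<^sup>x\<close>.\<close>

definition dens :: "real ^ 'n \<Rightarrow> (real ^ 'n) \<times> 'w \<Rightarrow> real" where
  "dens x p = gdens v (fst p - e *\<^sub>R x) * weight x p"

text \<open>The logarithmic gradient of \<open>dens\<close> in \<open>x\<close>. At the endpoint \<open>z = X\<^sub>t\<^sup>x\<close> it is \<open>A\<^sub>t\<^sup>x\<close>.\<close>

definition score :: "real ^ 'n \<Rightarrow> (real ^ 'n) \<times> 'w \<Rightarrow> real ^ 'n" where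
  "score x p = - grad_potential x p + (e / v) *\<^sub>R (fst p - e *\<^sub>R x)"

text \<open>The quantities to be dominated, together with \<open>dens\<close>.\<close>

abbreviation Hess_norm :: "real ^ 'n \<Rightarrow> (real ^ 'n) \<times> 'w \<Rightarrow> real" where
  "Hess_norm x p \<equiv> LBINT s:{0..t}. norm ((\<alpha> s)\<^sup>2 *\<^sub>R Hess V (bridged_path x p s))"

abbreviation growth :: "real ^ 'n \<Rightarrow> (real ^ 'n) \<times> 'w \<Rightarrow> real" where
  "growth x p \<equiv> 1 + norm (score x p) + (norm (score x p))\<^sup>2 + Hess_norm x p + e\<^sup>2 / v"

abbreviation \<G> :: "((real ^ 'n) \<times> 'w) measure" where "\<G> \<equiv> borel \<Otimes>\<^sub>M bridge_algebra t"

text \<open>The reference measure: Lebesgue measure for the endpoint, and the probability measure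
  restricted to the events that depend on the bridge only.\<close>

definition MG :: "'w measure" where "MG = restr_to_subalg M (bridge_algebra t)"

definition \<mu> :: "((real ^ 'n) \<times> 'w) measure" where "\<mu> = lborel \<Otimes>\<^sub>M MG"

lemma v: "v > 0" using t by (rule var_pos)

sublocale MG: prob_space MG
  unfolding MG_def by (rule prob_space_restr_to_subalg[OF subalgebra_bridge prob_M])

sublocale \<mu>: pair_sigma_finite lborel MG ..

lemma sets_MG [measurable_cong]: "sets MG = sets (bridge_algebra t)"
  unfolding MG_def by (rule sets_restr_to_subalg[OF subalgebra_bridge])

lemma space_MG: "space MG = space M"
  unfolding MG_def by (rule space_restr_to_subalg)

lemma sets_\<mu> [measurable_cong]: "sets \<mu> = sets \<G>"
  unfolding \<mu>_def by (rule sets_pair_measure_cong) (simp_all add: sets_MG)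

lemma space_\<mu>: "space \<mu> = UNIV \<times> space M"
  unfolding \<mu>_def by (simp add: space_pair_measure space_MG)

lemma \<alpha>_bounds:
  assumes "s \<in> {0..t}"
  shows "0 \<le> \<alpha> s" "\<alpha> s \<le> 1"
  using assms a sinh_pos[OF t] by (auto simp: \<alpha>_def divide_le_eq_1)

lemma \<beta>_bounds:
  assumes "s \<in> {0..t}"
  shows "0 \<le> \<beta> s t" "\<beta> s t \<le> 1"
  using assms a sinh_pos[OF t] by (auto simp: \<beta>_def divide_le_eq_1)

lemma \<alpha>_continuous [continuous_intros]: "continuous_on S \<alpha>"
  unfolding \<alpha>_def[abs_def] using sinh_pos[OF t] by (intro continuous_intros) auto

lemma \<beta>_continuous [continuous_intros]: "continuous_on S (\<lambda>s. \<beta> s t)"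
  unfolding \<beta>_def[abs_def] using sinh_pos[OF t] by (intro continuous_intros) auto

lemma \<alpha>_\<beta>: "\<alpha> s + \<beta> s t * e = exp (- a * s)"
proof -
  have "sinh (a * (t - s)) + sinh (a * s) * e = exp (- a * s) * sinh (a * t)"
    by (simp add: sinh_def algebra_simps mult_exp_exp)
  moreover have "\<alpha> s + \<beta> s t * e = (sinh (a * (t - s)) + sinh (a * s) * e) / sinh (a * t)"
    by (simp add: \<alpha>_def \<beta>_def add_divide_distrib)
  ultimately show ?thesis using sinh_pos[OF t] a t by simp
qed

lemma clamp_time [simp]: "s \<in> {0..t} \<Longrightarrow> clamp_time s = s"
  by (simp add: clamp_time_def)

lemma clamp_time_Icc: "clamp_time s \<in> {0..t}"
  using t by (auto simp: clamp_time_def)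

lemma bridge_continuous: "\<omega> \<in> space M \<Longrightarrow> continuous_on S (\<lambda>s. bridge s \<omega>)"
proof -
  assume \<omega>: "\<omega> \<in> space M"
  have c: "continuous_on S clamp_time" unfolding clamp_time_def[abs_def] by (intro continuous_intros)
  have "continuous_on S (\<lambda>s. Y (clamp_time s) \<omega>)"
    unfolding Y_def using clamp_time_Icc by (intro continuous_on_compose2[OF X_continuous[OF \<omega>] c]) auto
  moreover have "continuous_on S (\<lambda>s. \<beta> (clamp_time s) t)"
    by (rule continuous_on_compose2[OF \<beta>_continuous c]) auto
  ultimately show ?thesis unfolding bridge_def Z_def by (intro continuous_intros)
qed

lemma bridge_measurable_single: "bridge s \<in> borel_measurable (bridge_algebra t)"
  unfolding bridge_def[abs_def] using Z_measurable_bridge[OF clamp_time_Icc] .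

lemma bridge_joint [measurable]: "(\<lambda>q. bridge (fst q) (snd q)) \<in> borel_measurable (borel \<Otimes>\<^sub>M bridge_algebra t)"
  by (rule measurable_continuous_process[OF bridge_measurable_single]) (simp add: bridge_continuous)

lemma path_continuous: "p \<in> space \<mu> \<Longrightarrow> continuous_on S (bridged_path x p)"
  unfolding bridged_path_def[abs_def] by (intro continuous_intros bridge_continuous) (auto simp: space_\<mu>)

lemma path_joint [measurable]: "(\<lambda>q. bridged_path x (fst q) (snd q)) \<in> borel_measurable (\<G> \<Otimes>\<^sub>M borel)"
proof -
  have [measurable]: "\<alpha> \<in> borel_measurable borel" "(\<lambda>s. \<beta> s t) \<in> borel_measurable borel"
    by (intro borel_measurable_continuous_onI continuous_intros)+
  have [measurable]: "(\<lambda>q. bridge (snd q) (snd (fst q))) \<in> borel_measurable (\<G> \<Otimes>\<^sub>M borel)"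
  proof -
    have "(\<lambda>q. (snd q, snd (fst q))) \<in> measurable ((borel \<Otimes>\<^sub>M bridge_algebra t) \<Otimes>\<^sub>M borel) (borel \<Otimes>\<^sub>M bridge_algebra t)"
      by measurable
    from measurable_compose[OF this bridge_joint] show ?thesis by simp
  qed
  show ?thesis unfolding bridged_path_def by measurable
qed

lemma \<alpha>_measurable [measurable]: "\<alpha> \<in> borel_measurable borel"
  by (intro borel_measurable_continuous_onI continuous_intros)

lemma V_continuous: "continuous_on UNIV V"
  using D_class_2(1)[OF V_D] by (intro continuous_at_imp_continuous_on) (auto dest: has_derivative_continuous)

lemma grad_V_continuous: "continuous_on UNIV (grad V)"
  using D_class_2(2)[OF V_D] by (intro continuous_at_imp_continuous_on) (auto dest: has_derivative_continuous)

lemma Hess_V_continuous: "continuous_on UNIV (Hess V)"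
  by (rule D_class_2(3)[OF V_D])

lemma V_measurable [measurable]: "V \<in> borel_measurable borel"
  and grad_V_measurable [measurable]: "grad V \<in> borel_measurable borel"
  and Hess_V_measurable [measurable]: "Hess V \<in> borel_measurable borel"
  by (intro borel_measurable_continuous_onI V_continuous grad_V_continuous Hess_V_continuous)+

lemma f_measurable [measurable]: "f \<in> borel_measurable borel"
  using f_L2 by (simp add: L2_space_def equilibrium_def)

lemma potential_measurable [measurable]: "potential x \<in> borel_measurable \<G>"
  unfolding potential_def[abs_def] by (rule measurable_set_integral_Icc) measurable

lemma grad_potential_measurable [measurable]: "grad_potential x \<in> borel_measurable \<G>"
  unfolding grad_potential_def[abs_def] by (rule measurable_set_integral_Icc) measurable

lemma Hess_potential_measurable [measurable]: "Hess_potential x \<in> borel_measurable \<G>"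
  unfolding Hess_potential_def[abs_def] by (rule measurable_set_integral_Icc) measurable

lemma weight_measurable [measurable]: "weight x \<in> borel_measurable \<G>"
  unfolding weight_def[abs_def] by measurable

lemma dens_measurable [measurable]: "dens x \<in> borel_measurable \<G>"
  unfolding dens_def[abs_def] by measurable

lemma score_measurable [measurable]: "score x \<in> borel_measurable \<G>"
  unfolding score_def[abs_def] by measurable

section \<open>Derivatives in the starting point\<close>

lemma path_integrable:
  fixes \<phi> :: "real ^ 'n \<Rightarrow> 'b::euclidean_space"
  assumes "continuous_on UNIV \<phi>" "continuous_on {0..t} w" "p \<in> space \<mu>"
  shows "continuous_on {0..t} (\<lambda>s. w s *\<^sub>R \<phi> (bridged_path x p s))"
    and "set_integrable lborel {0..t} (\<lambda>s. w s *\<^sub>R \<phi> (bridged_path x p s))"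
proof -
  show "continuous_on {0..t} (\<lambda>s. w s *\<^sub>R \<phi> (bridged_path x p s))"
    by (intro continuous_intros assms continuous_on_compose2[OF assms(1) path_continuous]) auto
  then show "set_integrable lborel {0..t} (\<lambda>s. w s *\<^sub>R \<phi> (bridged_path x p s))"
    by (rule borel_integrable_atLeastAtMost')
qed

lemma potential_derivative:
  assumes p: "p \<in> space \<mu>"
  shows "((\<lambda>x. potential x p) has_derivative (\<lambda>k. grad_potential x p \<bullet> k)) (at x)"
proof -
  have "((\<lambda>x. LBINT s:{0..t}. 1 *\<^sub>R V (\<alpha> s *\<^sub>R x + (\<beta> s t *\<^sub>R fst p + bridge s (snd p)))) has_derivative
    (\<lambda>k. LBINT s:{0..t}. (1 * \<alpha> s) *\<^sub>R (grad V (\<alpha> s *\<^sub>R x + (\<beta> s t *\<^sub>R fst p + bridge s (snd p))) \<bullet> k))) (at x)"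
  proof (rule has_derivative_path_integral[where b = "\<lambda>y. norm (grad V y)"])
    show "norm (grad V y \<bullet> k) \<le> norm (grad V y) * norm k" for y k
      unfolding real_norm_def by (rule Cauchy_Schwarz_ineq2)
  qed (use p in \<open>auto simp: space_\<mu> intro!: continuous_intros bridge_continuous grad_V_continuous D_class_2(1)[OF V_D]\<close>)
  moreover have "(LBINT s:{0..t}. (1 * \<alpha> s) *\<^sub>R (grad V (bridged_path x p s) \<bullet> k)) = grad_potential x p \<bullet> k" for k
    using path_integrable(2)[OF grad_V_continuous \<alpha>_continuous p, of x]
    unfolding grad_potential_def set_lebesgue_integral_def set_integrable_def
    by (subst integral_inner_left[symmetric]) (auto simp: mult.assoc)
  ultimately show ?thesis unfolding potential_def bridged_path_def by simp
qed

lemma grad_potential_derivative: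
  assumes p: "p \<in> space \<mu>"
  shows "((\<lambda>x. grad_potential x p) has_derivative (\<lambda>k. Hess_potential x p *v k)) (at x)"
proof -
  have "((\<lambda>x. LBINT s:{0..t}. \<alpha> s *\<^sub>R grad V (\<alpha> s *\<^sub>R x + (\<beta> s t *\<^sub>R fst p + bridge s (snd p)))) has_derivative
    (\<lambda>k. LBINT s:{0..t}. (\<alpha> s * \<alpha> s) *\<^sub>R (Hess V (\<alpha> s *\<^sub>R x + (\<beta> s t *\<^sub>R fst p + bridge s (snd p))) *v k))) (at x)"
  proof (rule has_derivative_path_integral[where b = "\<lambda>y. norm (Hess V y)"])
    show "norm (Hess V y *v k) \<le> norm (Hess V y) * norm k" for y k by (rule norm_matrix_vector_mult_le)
    show "continuous_on UNIV (\<lambda>y. Hess V y *v k)" for k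
      by (rule bounded_linear.continuous_on[OF bounded_linear_matrix_vector_mult_left Hess_V_continuous])
  qed (use p in \<open>auto simp: space_\<mu> intro!: continuous_intros bridge_continuous Hess_V_continuous D_class_2(2)[OF V_D]\<close>)
  moreover have "(LBINT s:{0..t}. (\<alpha> s * \<alpha> s) *\<^sub>R (Hess V (bridged_path x p s) *v k)) = Hess_potential x p *v k" for k
  proof -
    have "set_integrable lborel {0..t} (\<lambda>s. (\<alpha> s)\<^sup>2 *\<^sub>R Hess V (bridged_path x p s))"
      by (intro path_integrable(2)[OF Hess_V_continuous _ p] continuous_intros)
    from integral_bounded_linear[OF bounded_linear_matrix_vector_mult_left this[unfolded set_integrable_def], of k]
    show ?thesis
      unfolding Hess_potential_def set_lebesgue_integral_def
      by (simp add: scaleR_matrix_vector_assoc[symmetric] power2_eq_square)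
  qed
  ultimately show ?thesis unfolding grad_potential_def bridged_path_def by simp
qed

lemma gdens_derivative:
  "((\<lambda>x. gdens v (z - e *\<^sub>R x)) has_derivative (\<lambda>k. gdens v (z - e *\<^sub>R x) * (((e / v) *\<^sub>R (z - e *\<^sub>R x)) \<bullet> k))) (at x)"
  unfolding gdens_eq[OF v] power2_norm_eq_inner
  by (rule derivative_eq_intros refl)+
    (use v in \<open>auto simp: inner_diff_left inner_diff_right inner_commute field_simps intro!: ext\<close>)

lemma dens_derivative:
  assumes p: "p \<in> space \<mu>"
  shows "((\<lambda>x. dens x p) has_derivative (\<lambda>k. dens x p * (score x p \<bullet> k))) (at x)"
proof -
  have "((\<lambda>x. exp (- potential x p)) has_derivative (\<lambda>k. exp (- potential x p) * (- (grad_potential x p \<bullet> k)))) (at x)"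
    by (auto intro!: derivative_eq_intros potential_derivative[OF p])
  then have "((\<lambda>x. gdens v (fst p - e *\<^sub>R x) * (f (fst p) * exp (- potential x p))) has_derivative
    (\<lambda>k. gdens v (fst p - e *\<^sub>R x) * (f (fst p) * (exp (- potential x p) * (- (grad_potential x p \<bullet> k))))
      + gdens v (fst p - e *\<^sub>R x) * (((e / v) *\<^sub>R (fst p - e *\<^sub>R x)) \<bullet> k) * (f (fst p) * exp (- potential x p)))) (at x)"
    by (intro has_derivative_mult gdens_derivative has_derivative_mult_right)
  then show ?thesis
    unfolding dens_def weight_def score_def by (simp add: inner_diff_left inner_add_left algebra_simps)
qed

lemma score_derivative:
  assumes p: "p \<in> space \<mu>"
  shows "((\<lambda>x. score x p) has_derivative (\<lambda>k. - (Hess_potential x p *v k) - (e\<^sup>2 / v) *\<^sub>R k)) (at x)"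
  unfolding score_def
  by (rule derivative_eq_intros grad_potential_derivative[OF p] refl)+ (auto simp: power2_eq_square)

lemma dens_score_derivative:
  assumes p: "p \<in> space \<mu>"
  shows "((\<lambda>x. dens x p *\<^sub>R score x p) has_derivative
    (\<lambda>k. dens x p *\<^sub>R ((score x p \<bullet> k) *\<^sub>R score x p - Hess_potential x p *v k - (e\<^sup>2 / v) *\<^sub>R k))) (at x)"
  using has_derivative_scaleR[OF dens_derivative[OF p] score_derivative[OF p]]
  by (simp add: algebra_simps)

section \<open>Domination\<close>

lemma nn_integral_MG: "g \<in> borel_measurable (bridge_algebra t) \<Longrightarrow> (\<integral>\<^sup>+\<omega>. g \<omega> \<partial>MG) = (\<integral>\<^sup>+\<omega>. g \<omega> \<partial>M)"
  unfolding MG_def by (rule nn_integral_subalgebra2[OF subalgebra_bridge])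

text \<open>The moments of the bridge are bounded uniformly in time.\<close>

lemma bridge_moment:
  obtains K :: real where "K \<ge> 0" "\<And>s. (\<integral>\<^sup>+\<omega>. ennreal ((1 + norm (bridge s \<omega>)) ^ k) \<partial>MG) \<le> ennreal K"
proof -
  define I where "I = (\<integral>\<^sup>+\<omega>. ennreal ((1 + norm (Y t \<omega>)) ^ (2 * k)) \<partial>M)"
  have I: "I < \<infinity>" unfolding I_def by (rule Y_moment_finite[OF t])
  have "(\<integral>\<^sup>+\<omega>. ennreal ((1 + norm (bridge s \<omega>)) ^ k) \<partial>MG) \<le> I + I" for s
  proof -
    define r where "r = clamp_time s"
    have r: "r \<in> {0..t}" unfolding r_def by (rule clamp_time_Icc)
    have [measurable]: "bridge s \<in> borel_measurable (bridge_algebra t)" by (rule bridge_measurable_single)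
    have [measurable]: "Y r \<in> borel_measurable M" "Y t \<in> borel_measurable M" using r t by (auto intro: Y_measurable)
    have "(\<integral>\<^sup>+\<omega>. ennreal ((1 + norm (bridge s \<omega>)) ^ k) \<partial>MG) = (\<integral>\<^sup>+\<omega>. ennreal ((1 + norm (bridge s \<omega>)) ^ k) \<partial>M)"
      by (rule nn_integral_MG) measurable
    also have "\<dots> \<le> (\<integral>\<^sup>+\<omega>. ennreal ((1 + norm (Y r \<omega>)) ^ (2 * k)) + ennreal ((1 + norm (Y t \<omega>)) ^ (2 * k)) \<partial>M)"
    proof (rule nn_integral_mono)
      fix \<omega>
      have "norm (bridge s \<omega>) \<le> norm (Y r \<omega>) + norm (\<beta> r t *\<^sub>R Y t \<omega>)"
        unfolding bridge_def Z_def r_def by (rule norm_triangle_ineq4)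
      also have "norm (\<beta> r t *\<^sub>R Y t \<omega>) \<le> 1 * norm (Y t \<omega>)"
        unfolding norm_scaleR using \<beta>_bounds[OF r] by (intro mult_right_mono) auto
      finally have "norm (bridge s \<omega>) \<le> norm (Y r \<omega>) + 1 * norm (Y t \<omega>)" by simp
      moreover have "(1 + norm (Y r \<omega>)) * (1 + norm (Y t \<omega>)) = 1 + (norm (Y r \<omega>) + 1 * norm (Y t \<omega>)) + norm (Y r \<omega>) * norm (Y t \<omega>)"
        by (simp add: algebra_simps)
      moreover have "0 \<le> norm (Y r \<omega>) * norm (Y t \<omega>)" by simp
      ultimately have "1 + norm (bridge s \<omega>) \<le> (1 + norm (Y r \<omega>)) * (1 + norm (Y t \<omega>))" by linarith
      then have "(1 + norm (bridge s \<omega>)) ^ k \<le> (1 + norm (Y r \<omega>)) ^ k * (1 + norm (Y t \<omega>)) ^ k"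
        unfolding power_mult_distrib[symmetric] by (intro power_mono) auto
      also have "\<dots> \<le> (1 + norm (Y r \<omega>)) ^ (2 * k) + (1 + norm (Y t \<omega>)) ^ (2 * k)"
        using mult_le_sum_squares[of "(1 + norm (Y r \<omega>)) ^ k" "(1 + norm (Y t \<omega>)) ^ k"]
        by (simp add: power_mult[symmetric] mult.commute)
      finally show "ennreal ((1 + norm (bridge s \<omega>)) ^ k) \<le> ennreal ((1 + norm (Y r \<omega>)) ^ (2 * k)) + ennreal ((1 + norm (Y t \<omega>)) ^ (2 * k))"
        by (simp add: ennreal_leI flip: ennreal_plus)
    qed
    also have "\<dots> = (\<integral>\<^sup>+\<omega>. ennreal ((1 + norm (Y r \<omega>)) ^ (2 * k)) \<partial>M) + I"
      unfolding I_def by (rule nn_integral_add) measurable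
    also have "\<dots> \<le> I + I"
      unfolding I_def using r t by (intro add_right_mono Y_moment_mono) auto
    finally show ?thesis .
  qed
  moreover have "I + I = ennreal (enn2real (I + I))" using I by (simp add: less_top)
  ultimately show thesis using that[of "enn2real (I + I)"] by (metis enn2real_nonneg)
qed

lemma bridge_moment_integrable: "integrable MG (\<lambda>\<omega>. (1 + norm (bridge s \<omega>)) ^ k)"
proof -
  obtain K where K: "\<And>s. (\<integral>\<^sup>+\<omega>. ennreal ((1 + norm (bridge s \<omega>)) ^ k) \<partial>MG) \<le> ennreal K"
    using bridge_moment[of k] by blast
  have [measurable]: "bridge s \<in> borel_measurable (bridge_algebra t)" by (rule bridge_measurable_single)
  show ?thesis
    by (rule integrableI_nonneg) (use K[of s] in \<open>auto intro: le_less_trans\<close>)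
qed

text \<open>The random factor in the bounds on the potential and its derivatives.\<close>

definition bridge_integral :: "nat \<Rightarrow> 'w \<Rightarrow> real" where
  "bridge_integral k \<omega> = (LBINT s:{0..t}. (1 + norm (bridge s \<omega>)) ^ k)"

lemma bridge_integral_measurable [measurable]: "bridge_integral k \<in> borel_measurable (bridge_algebra t)"
  unfolding bridge_integral_def[abs_def]
proof (rule measurable_set_integral_Icc)
  have "(\<lambda>q. (snd q, fst q)) \<in> measurable (bridge_algebra t \<Otimes>\<^sub>M borel) (borel \<Otimes>\<^sub>M bridge_algebra t)" by measurable
  from measurable_compose[OF this bridge_joint]
  have [measurable]: "(\<lambda>q. bridge (snd q) (fst q)) \<in> borel_measurable (bridge_algebra t \<Otimes>\<^sub>M borel)" by simp
  show "(\<lambda>q. (1 + norm (bridge (snd q) (fst q))) ^ k) \<in> borel_measurable (bridge_algebra t \<Otimes>\<^sub>M borel)" by measurable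
qed

lemma bridge_power_continuous: "\<omega> \<in> space M \<Longrightarrow> continuous_on S (\<lambda>s. (1 + norm (bridge s \<omega>)) ^ k)"
  by (intro continuous_intros bridge_continuous)

lemma bridge_integral_nonneg: "0 \<le> bridge_integral k \<omega>"
  unfolding bridge_integral_def set_lebesgue_integral_def by (rule integral_nonneg_AE) simp

lemma bridge_integral_integrable: "integrable MG (bridge_integral k)"
proof (rule integrableI_nonneg)
  obtain K where K: "K \<ge> 0" "\<And>s. (\<integral>\<^sup>+\<omega>. ennreal ((1 + norm (bridge s \<omega>)) ^ k) \<partial>MG) \<le> ennreal K"
    using bridge_moment[of k] by blast
  have [measurable]: "(\<lambda>q. bridge (fst q) (snd q)) \<in> borel_measurable (lborel \<Otimes>\<^sub>M MG)"
    using bridge_joint by simp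
  have "(\<integral>\<^sup>+\<omega>. ennreal (bridge_integral k \<omega>) \<partial>MG) = (\<integral>\<^sup>+\<omega>. \<integral>\<^sup>+s. ennreal (indicator {0..t} s *\<^sub>R (1 + norm (bridge s \<omega>)) ^ k) \<partial>lborel \<partial>MG)"
  proof (rule nn_integral_cong)
    fix \<omega> assume "\<omega> \<in> space MG"
    then have "integrable lborel (\<lambda>s. indicator {0..t} s *\<^sub>R (1 + norm (bridge s \<omega>)) ^ k)"
      using borel_integrable_atLeastAtMost'[OF bridge_power_continuous] by (simp add: space_MG set_integrable_def)
    from nn_integral_eq_integral[OF this]
    show "ennreal (bridge_integral k \<omega>) = (\<integral>\<^sup>+s. ennreal (indicator {0..t} s *\<^sub>R (1 + norm (bridge s \<omega>)) ^ k) \<partial>lborel)"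
      unfolding bridge_integral_def set_lebesgue_integral_def by simp
  qed
  also have "\<dots> = (\<integral>\<^sup>+s. \<integral>\<^sup>+\<omega>. ennreal (indicator {0..t} s *\<^sub>R (1 + norm (bridge s \<omega>)) ^ k) \<partial>MG \<partial>lborel)"
    by (rule \<mu>.Fubini'[of "\<lambda>s \<omega>. ennreal (indicator {0..t} s *\<^sub>R (1 + norm (bridge s \<omega>)) ^ k)"])
      (simp add: case_prod_unfold)
  also have "\<dots> \<le> (\<integral>\<^sup>+s. ennreal K * indicator {0..t} s \<partial>lborel)"
    by (intro nn_integral_mono) (use K(2) in \<open>auto simp: indicator_def\<close>)
  also have "\<dots> < \<infinity>"
    using t by (simp add: nn_integral_cmult ennreal_mult_less_top)
  finally show "(\<integral>\<^sup>+\<omega>. ennreal (bridge_integral k \<omega>) \<partial>MG) < \<infinity>" .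
qed (use bridge_integral_nonneg in auto)

lemma bridge_integral_square_integrable: "integrable MG (\<lambda>\<omega>. (1 + bridge_integral k \<omega>)\<^sup>2)"
proof (rule Bochner_Integration.integrable_bound)
  show "integrable MG (\<lambda>\<omega>. 2 + 2 * (t * bridge_integral (2 * k) \<omega>))"
    using bridge_integral_integrable by simp
  show "AE \<omega> in MG. norm ((1 + bridge_integral k \<omega>)\<^sup>2) \<le> norm (2 + 2 * (t * bridge_integral (2 * k) \<omega>))"
  proof (rule AE_I2)
    fix \<omega> assume "\<omega> \<in> space MG"
    then have "(bridge_integral k \<omega>)\<^sup>2 \<le> t * bridge_integral (2 * k) \<omega>"
      using set_integral_square_le[OF bridge_power_continuous t, of \<omega> k]
      by (simp add: bridge_integral_def space_MG power_mult[symmetric] mult.commute)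
    moreover have "0 \<le> (1 - bridge_integral k \<omega>)\<^sup>2" by simp
    ultimately have "(1 + bridge_integral k \<omega>)\<^sup>2 \<le> 2 + 2 * (t * bridge_integral (2 * k) \<omega>)"
      by (simp add: power2_eq_square algebra_simps)
    then show "norm ((1 + bridge_integral k \<omega>)\<^sup>2) \<le> norm (2 + 2 * (t * bridge_integral (2 * k) \<omega>))"
      by simp
  qed
qed measurable

text \<open>The bound for \<open>dens\<close> as a function of the endpoint. The density of \<open>X\<^sub>t\<^sup>x\<close> decays at least like
  \<open>exp (- (a / \<sigma>\<^sup>2) |z - e x|\<^sup>2)\<close>, while square integrability of \<open>f\<close> controls \<open>f\<close> times
  \<open>exp (- (a / (2 \<sigma>\<^sup>2)) |z|\<^sup>2)\<close>. The factor \<open>3/4\<close> in between leaves room for the shift by \<open>e x\<close> and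
  for a polynomial in \<open>z\<close>.\<close>

definition envelope :: "real ^ 'n \<Rightarrow> real" where
  "envelope z = \<bar>f z\<bar> * exp (- (3 / 4 * (a / \<sigma>\<^sup>2)) * (norm z)\<^sup>2)"

lemma envelope_measurable [measurable]: "envelope \<in> borel_measurable borel"
  unfolding envelope_def[abs_def] by measurable

lemma envelope_nonneg: "0 \<le> envelope z"
  by (simp add: envelope_def)

lemma envelope_integrable: "integrable lborel (\<lambda>z. envelope z * (1 + norm z) ^ N)"
proof -
  define \<kappa> where "\<kappa> = a / \<sigma>\<^sup>2"
  define c where "c = (pi * \<sigma>\<^sup>2 / a) powr (- (real CARD('n) / 2))"
  have c: "c > 0" unfolding c_def using a \<sigma> by simp
  have \<kappa>: "\<kappa> > 0" unfolding \<kappa>_def using a \<sigma> by simp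
  have "integrable (density lborel (\<lambda>y. ennreal (c * exp (- (a * (norm y)\<^sup>2 / \<sigma>\<^sup>2))))) (\<lambda>y. (f y)\<^sup>2)"
    using f_L2 unfolding L2_space_def equilibrium_def c_def by simp
  then have "integrable lborel (\<lambda>y. (c * exp (- (a * (norm y)\<^sup>2 / \<sigma>\<^sup>2))) *\<^sub>R (f y)\<^sup>2)"
    using c by (subst (asm) integrable_density) auto
  then have "integrable lborel (\<lambda>y. (1 / c) * ((c * exp (- (a * (norm y)\<^sup>2 / \<sigma>\<^sup>2))) *\<^sub>R (f y)\<^sup>2))"
    by (rule integrable_mult_right)
  then have i1: "integrable lborel (\<lambda>y. exp (- \<kappa> * (norm y)\<^sup>2) * (f y)\<^sup>2)"
    using c by (simp add: \<kappa>_def)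
  have i2: "integrable lborel (\<lambda>z :: real^'n. (1 + norm z) ^ (2 * N) * exp (- (\<kappa> / 2) * (norm z)\<^sup>2))"
    using \<kappa> by (intro integrable_power_mult_gauss) simp
  show ?thesis
  proof (rule Bochner_Integration.integrable_bound[OF Bochner_Integration.integrable_add[OF i1 i2]])
    show "AE z in lborel. norm (envelope z * (1 + norm z) ^ N)
      \<le> norm (exp (- \<kappa> * (norm z)\<^sup>2) * (f z)\<^sup>2 + (1 + norm z) ^ (2 * N) * exp (- (\<kappa> / 2) * (norm z)\<^sup>2))"
    proof (rule AE_I2)
      fix z :: "real ^ 'n"
      have sq: "(exp u)\<^sup>2 = exp (2 * u)" for u :: real by (simp add: exp_double)
      \<comment> \<open>Separate a square-integrable factor from a polynomial times a Gaussian.\<close>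
      have "envelope z * (1 + norm z) ^ N
        = (\<bar>f z\<bar> * exp (- (\<kappa> / 2) * (norm z)\<^sup>2)) * ((1 + norm z) ^ N * exp (- (\<kappa> / 4) * (norm z)\<^sup>2))"
        unfolding envelope_def \<kappa>_def by (simp add: mult_exp_exp ac_simps)
      also have "\<dots> \<le> (\<bar>f z\<bar> * exp (- (\<kappa> / 2) * (norm z)\<^sup>2))\<^sup>2 + ((1 + norm z) ^ N * exp (- (\<kappa> / 4) * (norm z)\<^sup>2))\<^sup>2"
        by (rule mult_le_sum_squares)
      also have "\<dots> = exp (- \<kappa> * (norm z)\<^sup>2) * (f z)\<^sup>2 + (1 + norm z) ^ (2 * N) * exp (- (\<kappa> / 2) * (norm z)\<^sup>2)"
        by (simp add: power_mult_distrib sq power_mult[symmetric] mult.commute)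
      finally show "norm (envelope z * (1 + norm z) ^ N)
        \<le> norm (exp (- \<kappa> * (norm z)\<^sup>2) * (f z)\<^sup>2 + (1 + norm z) ^ (2 * N) * exp (- (\<kappa> / 2) * (norm z)\<^sup>2))"
        using envelope_nonneg[of z] by simp
    qed
  qed measurable
qed

lemma e_bounds: "0 < e" "e \<le> 1"
  using a t by auto

lemma gdens_bound:
  fixes x z :: "real ^ 'n"
  assumes "norm x \<le> r"
  shows "gdens v (z - e *\<^sub>R x) \<le> (1 / sqrt (2 * pi * v)) ^ CARD('n) * exp (3 * (a / \<sigma>\<^sup>2) * r\<^sup>2) * exp (- (3 / 4 * (a / \<sigma>\<^sup>2)) * (norm z)\<^sup>2)"
proof -
  define \<kappa> where "\<kappa> = a / \<sigma>\<^sup>2"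
  have \<kappa>: "\<kappa> > 0" unfolding \<kappa>_def using a \<sigma> by simp
  have \<kappa>v: "\<kappa> \<le> 1 / (2 * v)"
  proof -
    have "2 * v = (\<sigma>\<^sup>2 / a) * (1 - exp (- 2 * a * t))" unfolding var_def using a by (simp add: field_simps)
    also have "\<dots> \<le> (\<sigma>\<^sup>2 / a) * 1" using a \<sigma> by (intro mult_left_mono) auto
    finally have "2 * v \<le> \<sigma>\<^sup>2 / a" by simp
    then have "1 / (\<sigma>\<^sup>2 / a) \<le> 1 / (2 * v)" using v by (intro divide_left_mono) (use a \<sigma> in auto)
    then show ?thesis by (simp add: \<kappa>_def)
  qed
  define y where "y = e *\<^sub>R x"
  have "norm y \<le> r" unfolding y_def using e_bounds assms mult_mono[of e 1 "norm x" r] by simp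
  then have y: "(norm y)\<^sup>2 \<le> r\<^sup>2" by (intro power_mono) auto
  have "0 \<le> (norm ((1 / 2) *\<^sub>R z - 2 *\<^sub>R y))\<^sup>2" by simp
  also have "(norm ((1 / 2) *\<^sub>R z - 2 *\<^sub>R y))\<^sup>2 = (norm z)\<^sup>2 / 4 - 2 * (z \<bullet> y) + 4 * (norm y)\<^sup>2"
    unfolding power2_norm_eq_inner by (simp add: inner_diff_left inner_diff_right inner_commute)
  finally have "3 / 4 * (norm z)\<^sup>2 - 3 * (norm y)\<^sup>2 \<le> (norm (z - y))\<^sup>2"
    unfolding power2_norm_eq_inner by (simp add: inner_diff_left inner_diff_right inner_commute)
  then have "3 / 4 * (norm z)\<^sup>2 - 3 * r\<^sup>2 \<le> (norm (z - y))\<^sup>2" using y by linarith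
  then have "\<kappa> * (3 / 4 * (norm z)\<^sup>2 - 3 * r\<^sup>2) \<le> \<kappa> * (norm (z - y))\<^sup>2"
    using \<kappa> by (intro mult_left_mono) auto
  also have "\<dots> \<le> 1 / (2 * v) * (norm (z - y))\<^sup>2" using \<kappa>v by (intro mult_right_mono) auto
  finally have "- (norm (z - y))\<^sup>2 / (2 * v) \<le> 3 * \<kappa> * r\<^sup>2 + - (3 / 4 * \<kappa>) * (norm z)\<^sup>2"
    by (simp add: algebra_simps)
  then have "exp (- (norm (z - y))\<^sup>2 / (2 * v)) \<le> exp (3 * \<kappa> * r\<^sup>2) * exp (- (3 / 4 * \<kappa>) * (norm z)\<^sup>2)"
    unfolding exp_add[symmetric] by simp
  then show ?thesis
    unfolding gdens_eq[OF v] y_def[symmetric] \<kappa>_def[symmetric] mult.assoc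
    using v by (intro mult_left_mono) auto
qed

lemma dens_bound:
  obtains K where "K > 0" "\<And>x p. norm x \<le> r \<Longrightarrow> p \<in> space \<mu> \<Longrightarrow> \<bar>dens x p\<bar> \<le> K * envelope (fst p)"
proof -
  obtain b where b: "\<And>y. b \<le> V y" using V_bdd by (auto simp: bdd_below_def)
  define K1 where "K1 = (1 / sqrt (2 * pi * v)) ^ CARD('n) * exp (3 * (a / \<sigma>\<^sup>2) * r\<^sup>2)"
  have K1: "K1 > 0" unfolding K1_def using v by simp
  have "\<bar>dens x p\<bar> \<le> (K1 * exp (- (t * b))) * envelope (fst p)" if x: "norm x \<le> r" and p: "p \<in> space \<mu>" for x p
  proof -
    have "t * b = (LBINT s:{0..t}. b)" using t by (simp add: set_integral_const)
    also have "\<dots> \<le> potential x p"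
      unfolding potential_def
    proof (rule set_integral_mono)
      show "set_integrable lborel {0..t} (\<lambda>s. V (bridged_path x p s))"
        using path_integrable(2)[OF V_continuous continuous_on_const p, of 1] by simp
    qed (use b in \<open>auto intro: borel_integrable_atLeastAtMost'\<close>)
    finally have "exp (- potential x p) \<le> exp (- (t * b))" by simp
    then have "gdens v (fst p - e *\<^sub>R x) * (\<bar>f (fst p)\<bar> * exp (- potential x p))
      \<le> (K1 * exp (- (3 / 4 * (a / \<sigma>\<^sup>2)) * (norm (fst p))\<^sup>2)) * (\<bar>f (fst p)\<bar> * exp (- (t * b)))"
      using gdens_bound[OF x, of "fst p"] K1 unfolding K1_def by (intro mult_mono) auto
    then show ?thesis
      unfolding dens_def weight_def envelope_def by (simp add: abs_mult ac_simps)
  qed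
  moreover have "K1 * exp (- (t * b)) > 0" using K1 by simp
  ultimately show thesis using that by blast
qed

lemma path_bound:
  assumes "s \<in> {0..t}"
  shows "1 + norm (bridged_path x p s) \<le> (1 + norm x) * (1 + norm (fst p)) * (1 + norm (bridge s (snd p)))"
proof -
  have "norm (bridged_path x p s) \<le> norm (\<alpha> s *\<^sub>R x) + (norm (\<beta> s t *\<^sub>R fst p) + norm (bridge s (snd p)))"
    unfolding bridged_path_def by (intro order_trans[OF norm_triangle_ineq] add_left_mono norm_triangle_ineq)
  also have "norm (\<alpha> s *\<^sub>R x) \<le> 1 * norm x"
    unfolding norm_scaleR using \<alpha>_bounds[OF assms] by (intro mult_right_mono) auto
  also have "norm (\<beta> s t *\<^sub>R fst p) \<le> 1 * norm (fst p)"
    unfolding norm_scaleR using \<beta>_bounds[OF assms] by (intro mult_right_mono) auto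
  finally have "1 + norm (bridged_path x p s) \<le> 1 + norm x + norm (fst p) + norm (bridge s (snd p))" by simp
  also have "\<dots> \<le> (1 + norm x) * (1 + norm (fst p)) * (1 + norm (bridge s (snd p)))"
    by (simp add: algebra_simps add_increasing2)
  finally show ?thesis .
qed

text \<open>One integrable function dominates, for all \<open>x\<close> near \<open>x0\<close>, everything that occurs in the first two
  derivatives of \<open>dens\<close>. The starting point, the endpoint and the bridge are separated by
  \<open>1 + |x + z + y| \<le> (1 + |x|) (1 + |z|) (1 + |y|)\<close>.\<close>

lemma domination:
  obtains D where "integrable \<mu> D"
    "\<forall>x\<in>ball x0 1. \<forall>p\<in>space \<mu>.
      \<bar>dens x p\<bar> * growth x p \<le> D p"
proof -
  obtain C m where C: "C > 0" "\<And>y. norm (grad V y) \<le> C * (1 + norm y) ^ m" "\<And>y. norm (Hess V y) \<le> C * (1 + norm y) ^ m"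
    using D_class_2(4)[OF V_D] by blast
  define q where "q = 2 + norm x0"
  obtain K2 where K2: "K2 > 0" "\<And>x p. norm x \<le> q \<Longrightarrow> p \<in> space \<mu> \<Longrightarrow> \<bar>dens x p\<bar> \<le> K2 * envelope (fst p)"
    using dens_bound by blast
  define u where "u p = (1 + norm (fst p)) ^ (m + 1) * (1 + bridge_integral m (snd p))" for p :: "(real^'n) \<times> 'w"
  define K1 where "K1 = C * q ^ m + (e / v) * q"
  define K3 where "K3 = 1 + K1 + K1\<^sup>2 + K1 + e\<^sup>2 / v"
  have q: "q \<ge> 1" unfolding q_def by simp
  have K1: "0 \<le> C * q ^ m" "0 \<le> (e / v) * q" "0 \<le> K1" unfolding K1_def using C q v by auto
  have K3: "K3 \<ge> 0" unfolding K3_def using K1 v by simp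
  define D where "D p = K2 * K3 * ((envelope (fst p) * (1 + norm (fst p)) ^ (2 * (m + 1))) * (1 + bridge_integral m (snd p))\<^sup>2)" for p
  show thesis
  proof (rule that)
    show "integrable \<mu> D"
      unfolding D_def[abs_def] \<mu>_def
      by (intro integrable_mult_right \<mu>.integrable_mult_prod envelope_integrable bridge_integral_square_integrable)
  next
    show "\<forall>x\<in>ball x0 1. \<forall>p\<in>space \<mu>.
      \<bar>dens x p\<bar> * growth x p \<le> D p"
    proof (intro ballI)
      fix x p assume x: "x \<in> ball x0 1" and p: "p \<in> space \<mu>"
      have xq: "1 + norm x \<le> q"
        unfolding q_def using x norm_triangle_ineq2[of x x0] by (auto simp: dist_norm norm_minus_commute)
      define P where "P = 1 + norm (fst p)"
      define W where "W = 1 + bridge_integral m (snd p)"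
      have P: "P \<ge> 1" unfolding P_def by simp
      have W: "W \<ge> 1" "bridge_integral m (snd p) \<le> W" unfolding W_def using bridge_integral_nonneg by auto
      have uPW: "u p = P ^ (m + 1) * W" unfolding u_def P_def W_def ..
      have Pm: "1 \<le> P ^ m" using P by simp
      have Pm1: "P ^ m \<le> P ^ (m + 1)" "P \<le> P ^ (m + 1)" "1 \<le> P ^ (m + 1)"
        using P power_increasing[of m "m + 1" P] power_increasing[of 1 "m + 1" P] one_le_power[of P "m + 1"] by auto
      have u1: "1 \<le> u p" "P \<le> u p" "P ^ m * bridge_integral m (snd p) \<le> u p"
      proof -
        show "1 \<le> u p" unfolding uPW using mult_mono[of 1 "P ^ (m + 1)" 1 W] Pm1 W by simp
        show "P \<le> u p" unfolding uPW using mult_mono[of P "P ^ (m + 1)" 1 W] Pm1 W P by simp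
        show "P ^ m * bridge_integral m (snd p) \<le> u p" unfolding uPW
          using Pm Pm1 W bridge_integral_nonneg by (intro mult_mono) auto
      qed
      have \<omega>: "snd p \<in> space M" using p by (auto simp: space_\<mu>)
      have gb: "(LBINT s:{0..t}. C * (q * P * (1 + norm (bridge s (snd p)))) ^ m) \<le> C * q ^ m * u p"
      proof -
        have "(LBINT s:{0..t}. C * (q * P * (1 + norm (bridge s (snd p)))) ^ m) = (LBINT s:{0..t}. (C * q ^ m * P ^ m) * (1 + norm (bridge s (snd p))) ^ m)"
          by (simp add: power_mult_distrib ac_simps)
        also have "\<dots> = C * q ^ m * (P ^ m * bridge_integral m (snd p))"
          unfolding bridge_integral_def by simp
        also have "\<dots> \<le> C * q ^ m * u p" using K1 u1 by (intro mult_left_mono) auto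
        finally show ?thesis .
      qed
      have ub: "continuous_on {0..t} (\<lambda>s. C * (q * P * (1 + norm (bridge s (snd p)))) ^ m)"
        by (intro continuous_intros bridge_continuous \<omega>)
      have bs: "C * (1 + norm (bridged_path x p s)) ^ m \<le> C * (q * P * (1 + norm (bridge s (snd p)))) ^ m" if s: "s \<in> {0..t}" for s
      proof -
        have "(1 + norm x) * (1 + norm (fst p)) * (1 + norm (bridge s (snd p))) \<le> q * P * (1 + norm (bridge s (snd p)))"
          unfolding P_def using xq by (intro mult_right_mono) auto
        then show ?thesis
          using path_bound[OF s, of x p] C by (intro mult_left_mono power_mono) auto
      qed
      have "norm (grad_potential x p) \<le> (LBINT s:{0..t}. C * (q * P * (1 + norm (bridge s (snd p)))) ^ m)"
        unfolding grad_potential_def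
      proof (rule norm_set_integral_le[OF path_integrable(1)[OF grad_V_continuous \<alpha>_continuous p] ub])
        fix s assume s: "s \<in> {0..t}"
        have "norm (\<alpha> s *\<^sub>R grad V (bridged_path x p s)) \<le> 1 * norm (grad V (bridged_path x p s))"
          unfolding norm_scaleR using \<alpha>_bounds[OF s] by (intro mult_right_mono) auto
        also have "\<dots> \<le> C * (q * P * (1 + norm (bridge s (snd p)))) ^ m"
          using C(2)[of "bridged_path x p s"] bs[OF s] by simp
        finally show "norm (\<alpha> s *\<^sub>R grad V (bridged_path x p s)) \<le> C * (q * P * (1 + norm (bridge s (snd p)))) ^ m" .
      qed
      then have G: "norm (grad_potential x p) \<le> C * q ^ m * u p" using gb by linarith
      have "Hess_norm x p \<le> (LBINT s:{0..t}. C * (q * P * (1 + norm (bridge s (snd p)))) ^ m)"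
      proof (intro set_integral_mono borel_integrable_atLeastAtMost' ub continuous_on_norm path_integrable(1)[OF Hess_V_continuous _ p] continuous_intros)
        fix s assume s: "s \<in> {0..t}"
        have "(\<alpha> s)\<^sup>2 \<le> 1" using \<alpha>_bounds[OF s] by (simp add: power_le_one)
        then have "norm ((\<alpha> s)\<^sup>2 *\<^sub>R Hess V (bridged_path x p s)) \<le> 1 * norm (Hess V (bridged_path x p s))"
          unfolding norm_scaleR by (intro mult_right_mono) auto
        also have "\<dots> \<le> C * (q * P * (1 + norm (bridge s (snd p)))) ^ m"
          using C(3)[of "bridged_path x p s"] bs[OF s] by simp
        finally show "norm ((\<alpha> s)\<^sup>2 *\<^sub>R Hess V (bridged_path x p s)) \<le> C * (q * P * (1 + norm (bridge s (snd p)))) ^ m" .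
      qed
      then have H: "Hess_norm x p \<le> K1 * u p"
        using gb K1 u1 mult_nonneg_nonneg[of "(e / v) * q" "u p"] unfolding K1_def by (simp add: distrib_right)
      have "norm (fst p - e *\<^sub>R x) \<le> norm (fst p) + norm (e *\<^sub>R x)" by (rule norm_triangle_ineq4)
      also have "norm (e *\<^sub>R x) \<le> 1 * norm x" unfolding norm_scaleR using e_bounds by (intro mult_right_mono) auto
      also have "norm (fst p) + 1 * norm x \<le> (1 + norm x) * P" unfolding P_def by (simp add: algebra_simps)
      also have "\<dots> \<le> q * u p" using xq u1 q P by (intro mult_mono) auto
      finally have "norm ((e / v) *\<^sub>R (fst p - e *\<^sub>R x)) \<le> (e / v) * (q * u p)"
        unfolding norm_scaleR using v by (intro mult_mono) auto
      then have S: "norm (score x p) \<le> K1 * u p"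
        unfolding score_def K1_def using G norm_triangle_ineq[of "- grad_potential x p" "(e / v) *\<^sub>R (fst p - e *\<^sub>R x)"]
        by (simp add: distrib_right mult.assoc)
      have uu: "u p \<le> (u p)\<^sup>2" using u1 by (simp add: power2_eq_square)
      have "growth x p
          \<le> 1 * (u p)\<^sup>2 + K1 * (u p)\<^sup>2 + K1\<^sup>2 * (u p)\<^sup>2 + K1 * (u p)\<^sup>2 + e\<^sup>2 / v * (u p)\<^sup>2"
      proof (intro add_mono)
        show "1 \<le> 1 * (u p)\<^sup>2" using u1 uu by linarith
        show "norm (score x p) \<le> K1 * (u p)\<^sup>2" using S mult_left_mono[OF uu K1(3)] by linarith
        show "(norm (score x p))\<^sup>2 \<le> K1\<^sup>2 * (u p)\<^sup>2" unfolding power_mult_distrib[symmetric] using S by (intro power_mono) auto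
        show "Hess_norm x p \<le> K1 * (u p)\<^sup>2" using H mult_left_mono[OF uu K1(3)] by linarith
        have "e\<^sup>2 / v * 1 \<le> e\<^sup>2 / v * (u p)\<^sup>2" using u1 uu v by (intro mult_left_mono) auto
        then show "e\<^sup>2 / v \<le> e\<^sup>2 / v * (u p)\<^sup>2" by simp
      qed
      also have "\<dots> = K3 * (u p)\<^sup>2" unfolding K3_def by (simp add: distrib_right)
      finally have B: "growth x p \<le> K3 * (u p)\<^sup>2" .
      have J: "0 \<le> Hess_norm x p"
        unfolding set_lebesgue_integral_def by (rule integral_nonneg_AE) simp
      have "\<bar>dens x p\<bar> * growth x p
         \<le> (K2 * envelope (fst p)) * (K3 * (u p)\<^sup>2)"
        using K2(2)[OF _ p, of x] xq B J K2(1) envelope_nonneg v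
        by (intro mult_mono) (auto intro!: add_nonneg_nonneg)
      also have "\<dots> = D p"
      proof -
        have "(u p)\<^sup>2 = P ^ (2 * (m + 1)) * W\<^sup>2"
          unfolding uPW power_mult_distrib by (simp only: power_mult[symmetric] mult.commute)
        then show ?thesis unfolding D_def P_def W_def by (simp only: ac_simps)
      qed
      finally show "\<bar>dens x p\<bar> * growth x p \<le> D p" .
    qed
  qed
qed

section \<open>Differentiation under the integral\<close>

lemma integrable_dominated:
  fixes g :: "_ \<Rightarrow> 'b::{banach, second_countable_topology}"
  assumes "integrable \<mu> D" "g \<in> borel_measurable \<G>"
    and "\<And>p. p \<in> space \<mu> \<Longrightarrow> norm (g p) \<le> D p"
  shows "integrable \<mu> g"
proof (rule Bochner_Integration.integrable_bound[OF assms(1)])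
  show "g \<in> borel_measurable \<mu>" using assms(2) by measurable
  show "AE p in \<mu>. norm (g p) \<le> norm (D p)"
  proof (rule AE_I2)
    fix p assume "p \<in> space \<mu>"
    from assms(3)[OF this] show "norm (g p) \<le> norm (D p)" by simp
  qed
qed

lemma Hess_potential_norm:
  "norm (Hess_potential x p) \<le> Hess_norm x p"
proof -
  have "norm (Hess_potential x p) \<le> (\<integral>s. norm (indicator {0..t} s *\<^sub>R ((\<alpha> s)\<^sup>2 *\<^sub>R Hess V (bridged_path x p s))) \<partial>lborel)"
    unfolding Hess_potential_def set_lebesgue_integral_def by (rule integral_norm_bound)
  then show ?thesis unfolding set_lebesgue_integral_def by (simp add: mult.assoc)
qed

text \<open>The consequences of \<open>domination\<close> in the form in which they are used.\<close>

definition dominates :: "(_ \<Rightarrow> real) \<Rightarrow> real ^ 'n \<Rightarrow> bool" where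
  "dominates D x0 \<longleftrightarrow> integrable \<mu> D \<and> (\<forall>x\<in>ball x0 1. \<forall>p\<in>space \<mu>.
    norm (dens x p) \<le> D p \<and> norm (dens x p *\<^sub>R score x p) \<le> D p \<and>
    norm (dens x p) * (norm (score x p))\<^sup>2 \<le> D p \<and>
    norm (dens x p) * Hess_norm x p \<le> D p \<and>
    norm (dens x p) * ((norm (score x p))\<^sup>2 + norm (Hess_potential x p) + e\<^sup>2 / v) \<le> D p)"

lemma dominating_function:
  obtains D where "dominates D x0"
proof -
  obtain D where D: "integrable \<mu> D"
    "\<forall>x\<in>ball x0 1. \<forall>p\<in>space \<mu>.
      \<bar>dens x p\<bar> * growth x p \<le> D p"
    by (rule domination)
  have J: "0 \<le> Hess_norm x p" for x p
    unfolding set_lebesgue_integral_def by (rule integral_nonneg_AE) simp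
  have ev: "0 \<le> e\<^sup>2 / v" using v by simp
  have le: "norm (dens x p) * c \<le> D p"
    if "x \<in> ball x0 1" "p \<in> space \<mu>"
      "c \<le> growth x p" for x p c
    using order_trans[OF mult_left_mono[OF that(3), of "\<bar>dens x p\<bar>"] D(2)[rule_format, OF that(1,2)]] by simp
  show thesis
  proof (rule that, unfold dominates_def, intro conjI ballI)
    fix x p assume xp: "x \<in> ball x0 1" "p \<in> space \<mu>"
    have nn: "0 \<le> norm (score x p)" "0 \<le> (norm (score x p))\<^sup>2" by auto
    show "norm (dens x p) \<le> D p" using le[OF xp, of 1] J[of x p] ev nn by simp
    show "norm (dens x p *\<^sub>R score x p) \<le> D p" using le[OF xp, of "norm (score x p)"] J[of x p] ev nn by simp
    show "norm (dens x p) * (norm (score x p))\<^sup>2 \<le> D p" using J[of x p] ev nn by (intro le[OF xp]) linarith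
    show "norm (dens x p) * Hess_norm x p \<le> D p"
      using ev nn by (intro le[OF xp]) linarith
    show "norm (dens x p) * ((norm (score x p))\<^sup>2 + norm (Hess_potential x p) + e\<^sup>2 / v) \<le> D p"
      using ev nn Hess_potential_norm[of x p] by (intro le[OF xp]) linarith
  qed (rule D(1))
qed

lemma dens_integrable: "integrable \<mu> (dens x)"
proof -
  obtain D where "dominates D x" by (rule dominating_function)
  then have D: "integrable \<mu> D" "\<And>x' p. x' \<in> ball x 1 \<Longrightarrow> p \<in> space \<mu> \<Longrightarrow> norm (dens x' p) \<le> D p"
    by (auto simp: dominates_def)
  show ?thesis by (rule integrable_dominated[OF D(1)]) (use D(2)[of x] in auto)
qed

lemma dens_score_integrable: "integrable \<mu> (\<lambda>p. dens x p *\<^sub>R score x p)"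
proof -
  obtain D where "dominates D x" by (rule dominating_function)
  then have D: "integrable \<mu> D" "\<And>x' p. x' \<in> ball x 1 \<Longrightarrow> p \<in> space \<mu> \<Longrightarrow> norm (dens x' p *\<^sub>R score x' p) \<le> D p"
    by (auto simp: dominates_def)
  show ?thesis by (rule integrable_dominated[OF D(1)]) (use D(2)[of x] in auto)
qed

lemma dens_outer_integrable: "integrable \<mu> (\<lambda>p. dens x p *\<^sub>R (score x p \<otimes>\<^sub>v score x p))"
proof -
  obtain D where "dominates D x" by (rule dominating_function)
  then have D: "integrable \<mu> D" "\<And>x' p. x' \<in> ball x 1 \<Longrightarrow> p \<in> space \<mu> \<Longrightarrow> norm (dens x' p) * (norm (score x' p))\<^sup>2 \<le> D p"
    by (auto simp: dominates_def)
  note outer_measurable[OF score_measurable, measurable]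
  show ?thesis by (rule integrable_dominated[OF D(1)]) (use D(2)[of x] in \<open>auto simp: norm_outer power2_eq_square\<close>)
qed

lemma dens_Hess_integrable: "integrable \<mu> (\<lambda>p. dens x p *\<^sub>R Hess_potential x p)"
proof -
  obtain D where "dominates D x" by (rule dominating_function)
  then have D: "integrable \<mu> D" "\<And>x' p. x' \<in> ball x 1 \<Longrightarrow> p \<in> space \<mu> \<Longrightarrow> norm (dens x' p) * Hess_norm x' p \<le> D p"
    by (auto simp: dominates_def)
  show ?thesis
  proof (rule integrable_dominated[OF D(1)])
    show "norm (dens x p *\<^sub>R Hess_potential x p) \<le> D p" if "p \<in> space \<mu>" for p
      using order_trans[OF mult_left_mono[OF Hess_potential_norm[of x p]] D(2)[of x p]] that by simp
  qed measurable
qed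

lemma integral_dens_derivative:
  "((\<lambda>x. \<integral>p. dens x p \<partial>\<mu>) has_derivative (\<lambda>k. (\<integral>p. dens x0 p *\<^sub>R score x0 p \<partial>\<mu>) \<bullet> k)) (at x0)"
proof -
  obtain D where "dominates D x0" by (rule dominating_function)
  then have D: "integrable \<mu> D" "\<And>x p. x \<in> ball x0 1 \<Longrightarrow> p \<in> space \<mu> \<Longrightarrow> norm (dens x p *\<^sub>R score x p) \<le> D p"
    by (auto simp: dominates_def)
  have "((\<lambda>x. \<integral>p. dens x p \<partial>\<mu>) has_derivative (\<lambda>k. \<integral>p. dens x0 p * (score x0 p \<bullet> k) \<partial>\<mu>)) (at x0)"
  proof (rule has_derivative_integral_dominated[OF zero_less_one dens_integrable dens_derivative _ _ D(1)])
    show "(\<lambda>p. dens x0 p * (score x0 p \<bullet> k)) \<in> borel_measurable \<mu>" for k by measurable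
    fix p x k assume px: "p \<in> space \<mu>" "x \<in> ball x0 1"
    have "norm (dens x p * (score x p \<bullet> k)) = \<bar>(dens x p *\<^sub>R score x p) \<bullet> k\<bar>" by simp
    also have "\<dots> \<le> norm (dens x p *\<^sub>R score x p) * norm k" by (rule Cauchy_Schwarz_ineq2)
    also have "\<dots> \<le> D p * norm k" using D(2)[OF px(2,1)] by (intro mult_right_mono) auto
    finally show "norm (dens x p * (score x p \<bullet> k)) \<le> D p * norm k" .
  qed
  moreover have "(\<integral>p. dens x0 p * (score x0 p \<bullet> k) \<partial>\<mu>) = (\<integral>p. dens x0 p *\<^sub>R score x0 p \<partial>\<mu>) \<bullet> k" for k
    using dens_score_integrable[of x0] by (subst integral_inner_left[symmetric]) auto
  ultimately show ?thesis by simp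
qed

lemma integral_dens_score_derivative:
  "((\<lambda>x. \<integral>p. dens x p *\<^sub>R score x p \<partial>\<mu>) has_derivative
    (\<lambda>k. ((\<integral>p. dens x0 p *\<^sub>R (score x0 p \<otimes>\<^sub>v score x0 p) \<partial>\<mu>) - (\<integral>p. dens x0 p *\<^sub>R Hess_potential x0 p \<partial>\<mu>)
       - ((e\<^sup>2 / v) * (\<integral>p. dens x0 p \<partial>\<mu>)) *\<^sub>R mat 1) *v k)) (at x0)"
proof -
  let ?d = "\<lambda>x p k. dens x p *\<^sub>R ((score x p \<bullet> k) *\<^sub>R score x p - Hess_potential x p *v k - (e\<^sup>2 / v) *\<^sub>R k)"
  obtain D where "dominates D x0" by (rule dominating_function)
  then have D: "integrable \<mu> D" "\<And>x p. x \<in> ball x0 1 \<Longrightarrow> p \<in> space \<mu> \<Longrightarrow>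
      norm (dens x p) * ((norm (score x p))\<^sup>2 + norm (Hess_potential x p) + e\<^sup>2 / v) \<le> D p"
    by (auto simp: dominates_def)
  have d: "?d x p k = (dens x p *\<^sub>R (score x p \<otimes>\<^sub>v score x p)) *v k - (dens x p *\<^sub>R Hess_potential x p) *v k - dens x p *\<^sub>R ((e\<^sup>2 / v) *\<^sub>R k)" for x p k
    by (simp add: scaleR_matrix_vector_assoc[symmetric] outer_mult_vec scaleR_diff_right)
  have i: "integrable \<mu> (\<lambda>p. (dens x p *\<^sub>R (score x p \<otimes>\<^sub>v score x p)) *v k)"
    "integrable \<mu> (\<lambda>p. (dens x p *\<^sub>R Hess_potential x p) *v k)" "integrable \<mu> (\<lambda>p. dens x p *\<^sub>R ((e\<^sup>2 / v) *\<^sub>R k))" for x k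
    using integrable_bounded_linear[OF bounded_linear_matrix_vector_mult_left dens_outer_integrable]
      integrable_bounded_linear[OF bounded_linear_matrix_vector_mult_left dens_Hess_integrable] dens_integrable by auto
  have "((\<lambda>x. \<integral>p. dens x p *\<^sub>R score x p \<partial>\<mu>) has_derivative (\<lambda>k. \<integral>p. ?d x0 p k \<partial>\<mu>)) (at x0)"
  proof (rule has_derivative_integral_dominated[OF zero_less_one dens_score_integrable dens_score_derivative _ _ D(1)])
    have "integrable \<mu> (\<lambda>p. ?d x0 p k)" for k
      unfolding d by (intro Bochner_Integration.integrable_diff i)
    then show "(\<lambda>p. ?d x0 p k) \<in> borel_measurable \<mu>" for k by (rule borel_measurable_integrable)
    fix p x k assume px: "p \<in> space \<mu>" "x \<in> ball x0 1"
    have "norm ((score x p \<bullet> k) *\<^sub>R score x p - Hess_potential x p *v k - (e\<^sup>2 / v) *\<^sub>R k)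
      \<le> norm ((score x p \<bullet> k) *\<^sub>R score x p) + norm (Hess_potential x p *v k) + norm ((e\<^sup>2 / v) *\<^sub>R k)"
      by (intro order_trans[OF norm_triangle_ineq4] add_right_mono norm_triangle_ineq4)
    also have "\<dots> \<le> (norm (score x p))\<^sup>2 * norm k + norm (Hess_potential x p) * norm k + e\<^sup>2 / v * norm k"
    proof (intro add_mono norm_matrix_vector_mult_le)
      have "\<bar>score x p \<bullet> k\<bar> * norm (score x p) \<le> (norm (score x p) * norm k) * norm (score x p)"
        by (intro mult_right_mono Cauchy_Schwarz_ineq2) simp
      then show "norm ((score x p \<bullet> k) *\<^sub>R score x p) \<le> (norm (score x p))\<^sup>2 * norm k"
        by (simp add: power2_eq_square ac_simps)
      show "norm ((e\<^sup>2 / v) *\<^sub>R k) \<le> e\<^sup>2 / v * norm k" using v by simp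
    qed
    finally have "norm (?d x p k) \<le> norm (dens x p) * (((norm (score x p))\<^sup>2 + norm (Hess_potential x p) + e\<^sup>2 / v) * norm k)"
      unfolding norm_scaleR real_norm_def by (intro mult_left_mono) (auto simp: distrib_right)
    also have "\<dots> \<le> D p * norm k"
      unfolding mult.assoc[symmetric] using D(2)[OF px(2,1)] by (intro mult_right_mono) auto
    finally show "norm (?d x p k) \<le> D p * norm k" .
  qed
  moreover have "(\<integral>p. ?d x0 p k \<partial>\<mu>) = ((\<integral>p. dens x0 p *\<^sub>R (score x0 p \<otimes>\<^sub>v score x0 p) \<partial>\<mu>) - (\<integral>p. dens x0 p *\<^sub>R Hess_potential x0 p \<partial>\<mu>)
       - ((e\<^sup>2 / v) * (\<integral>p. dens x0 p \<partial>\<mu>)) *\<^sub>R mat 1) *v k" for k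
  proof -
    have "(\<integral>p. ?d x0 p k \<partial>\<mu>) = (\<integral>p. (dens x0 p *\<^sub>R (score x0 p \<otimes>\<^sub>v score x0 p)) *v k \<partial>\<mu>)
       - (\<integral>p. (dens x0 p *\<^sub>R Hess_potential x0 p) *v k \<partial>\<mu>) - (\<integral>p. dens x0 p *\<^sub>R ((e\<^sup>2 / v) *\<^sub>R k) \<partial>\<mu>)"
      unfolding d by (subst Bochner_Integration.integral_diff, intro Bochner_Integration.integrable_diff i, intro i)
        (subst Bochner_Integration.integral_diff, intro i, intro i, rule refl)
    also have "(\<integral>p. (dens x0 p *\<^sub>R (score x0 p \<otimes>\<^sub>v score x0 p)) *v k \<partial>\<mu>) = (\<integral>p. dens x0 p *\<^sub>R (score x0 p \<otimes>\<^sub>v score x0 p) \<partial>\<mu>) *v k"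
      by (rule integral_bounded_linear[OF bounded_linear_matrix_vector_mult_left dens_outer_integrable])
    also have "(\<integral>p. (dens x0 p *\<^sub>R Hess_potential x0 p) *v k \<partial>\<mu>) = (\<integral>p. dens x0 p *\<^sub>R Hess_potential x0 p \<partial>\<mu>) *v k"
      by (rule integral_bounded_linear[OF bounded_linear_matrix_vector_mult_left dens_Hess_integrable])
    also have "(\<integral>p. dens x0 p *\<^sub>R ((e\<^sup>2 / v) *\<^sub>R k) \<partial>\<mu>) = (((e\<^sup>2 / v) * (\<integral>p. dens x0 p \<partial>\<mu>)) *\<^sub>R mat 1) *v k"
      using dens_integrable[of x0] by (simp add: scaleR_matrix_vector_assoc[symmetric] mult.commute)
    finally show ?thesis by (simp add: matrix_vector_mult_diff_rdistrib)
  qed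
  ultimately show ?thesis by simp
qed

section \<open>Conditioning on the endpoint\<close>

lemma endpoint_measurable: "(\<lambda>\<omega>. (X x t \<omega>, \<omega>)) \<in> measurable M \<G>"
proof -
  have [measurable]: "X x t \<in> borel_measurable M" using t by (intro X_measurable) simp
  have [measurable]: "(\<lambda>\<omega>. \<omega>) \<in> measurable M (bridge_algebra t)"
    by (rule measurable_subalgebra_ident[OF subalgebra_bridge])
  show ?thesis by measurable
qed

text \<open>Joint law of the endpoint and the bridge. It turns expectations of functions of the two into
  integrals in which \<open>x\<close> no longer enters through a random variable.\<close>

lemma distr_endpoint:
  "distr M \<G> (\<lambda>\<omega>. (X x t \<omega>, \<omega>)) = density \<mu> (\<lambda>p. ennreal (gdens v (fst p - e *\<^sub>R x)))"
proof (rule measure_eqI)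
  show "sets (distr M \<G> (\<lambda>\<omega>. (X x t \<omega>, \<omega>))) = sets (density \<mu> (\<lambda>p. ennreal (gdens v (fst p - e *\<^sub>R x))))"
    by (simp add: sets_\<mu>)
  fix C assume "C \<in> sets (distr M \<G> (\<lambda>\<omega>. (X x t \<omega>, \<omega>)))"
  then have C[measurable]: "C \<in> sets \<G>" by simp
  have ae: "AE \<omega> in M. X x t \<omega> = e *\<^sub>R x + Y t \<omega>"
    using X_eq_Y[of x] by eventually_elim (use t in auto)
  have "emeasure (distr M \<G> (\<lambda>\<omega>. (X x t \<omega>, \<omega>))) C
    = (\<integral>\<^sup>+q. indicator C q \<partial>distr M \<G> (\<lambda>\<omega>. (X x t \<omega>, \<omega>)))"
    by simp
  also have "\<dots> = (\<integral>\<^sup>+\<omega>. indicator C (X x t \<omega>, \<omega>) \<partial>M)"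
    by (rule nn_integral_distr[OF endpoint_measurable]) measurable
  also have "\<dots> = (\<integral>\<^sup>+\<omega>. indicator C (e *\<^sub>R x + Y t \<omega>, \<omega>) \<partial>M)"
    by (rule nn_integral_cong_AE) (use ae in \<open>eventually_elim, simp\<close>)
  also have "\<dots> = (\<integral>\<^sup>+y. (\<integral>\<^sup>+\<omega>. indicator C (e *\<^sub>R x + y, \<omega>) \<partial>M) * gdens v y \<partial>lborel)"
    using nn_integral_gauss_indep[OF gauss_indep_bridge[OF t] subalgebra_bridge prob_M, of "\<lambda>q. indicator C (e *\<^sub>R x + fst q, snd q)"]
    by simp
  also have "\<dots> = (\<integral>\<^sup>+y. (\<integral>\<^sup>+\<omega>. indicator C (y + e *\<^sub>R x, \<omega>) \<partial>MG) * gdens v (y + e *\<^sub>R x - e *\<^sub>R x) \<partial>lborel)"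
    by (intro nn_integral_cong) (simp add: nn_integral_MG add.commute)
  also have "\<dots> = (\<integral>\<^sup>+z. (\<integral>\<^sup>+\<omega>. indicator C (z, \<omega>) \<partial>MG) * gdens v (z - e *\<^sub>R x) \<partial>lborel)"
    by (rule nn_integral_lborel_translate[symmetric]) measurable
  also have "\<dots> = (\<integral>\<^sup>+z. \<integral>\<^sup>+\<omega>. ennreal (gdens v (z - e *\<^sub>R x)) * indicator C (z, \<omega>) \<partial>MG \<partial>lborel)"
    by (intro nn_integral_cong) (subst nn_integral_cmult, measurable, simp only: mult.commute)
  also have "\<dots> = (\<integral>\<^sup>+p. ennreal (gdens v (fst p - e *\<^sub>R x)) * indicator C p \<partial>\<mu>)"
    unfolding \<mu>_def by (subst MG.nn_integral_fst[symmetric]) simp_all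
  also have "\<dots> = emeasure (density \<mu> (\<lambda>p. ennreal (gdens v (fst p - e *\<^sub>R x)))) C"
  proof (rule emeasure_density[symmetric])
    show "(\<lambda>p. ennreal (gdens v (fst p - e *\<^sub>R x))) \<in> borel_measurable \<mu>"
      unfolding measurable_cong_sets[OF sets_\<mu> refl] by measurable
    show "C \<in> sets \<mu>" using C by (simp add: sets_\<mu>)
  qed
  finally show "emeasure (distr M \<G> (\<lambda>\<omega>. (X x t \<omega>, \<omega>))) C
    = emeasure (density \<mu> (\<lambda>p. ennreal (gdens v (fst p - e *\<^sub>R x)))) C" .
qed

lemma integral_endpoint:
  fixes \<psi> :: "_ \<Rightarrow> 'b::{banach, second_countable_topology}"
  assumes [measurable]: "\<psi> \<in> borel_measurable \<G>"
  shows "integrable M (\<lambda>\<omega>. \<psi> (X x t \<omega>, \<omega>)) \<longleftrightarrow> integrable \<mu> (\<lambda>p. gdens v (fst p - e *\<^sub>R x) *\<^sub>R \<psi> p)"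
    and "(\<integral>\<omega>. \<psi> (X x t \<omega>, \<omega>) \<partial>M) = (\<integral>p. gdens v (fst p - e *\<^sub>R x) *\<^sub>R \<psi> p \<partial>\<mu>)"
proof -
  have [measurable]: "\<psi> \<in> borel_measurable \<mu>" by measurable
  show "integrable M (\<lambda>\<omega>. \<psi> (X x t \<omega>, \<omega>)) \<longleftrightarrow> integrable \<mu> (\<lambda>p. gdens v (fst p - e *\<^sub>R x) *\<^sub>R \<psi> p)"
    using integrable_distr_eq[OF endpoint_measurable assms, of x] unfolding distr_endpoint
    by (subst (asm) integrable_density) auto
  show "(\<integral>\<omega>. \<psi> (X x t \<omega>, \<omega>) \<partial>M) = (\<integral>p. gdens v (fst p - e *\<^sub>R x) *\<^sub>R \<psi> p \<partial>\<mu>)"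
    using integral_distr[OF endpoint_measurable assms, of x] unfolding distr_endpoint
    by (subst (asm) integral_density) auto
qed

text \<open>The process passes through its endpoint along the bridged trajectory.\<close>

lemma AE_path: "AE \<omega> in M. \<forall>s\<in>{0..t}. X x s \<omega> = bridged_path x (X x t \<omega>, \<omega>) s"
  using X_eq_Y[of x]
proof eventually_elim
  fix \<omega> assume *: "\<forall>s\<ge>0. X x s \<omega> = exp (- a * s) *\<^sub>R x + Y s \<omega>"
  show "\<forall>s\<in>{0..t}. X x s \<omega> = bridged_path x (X x t \<omega>, \<omega>) s"
  proof
    fix s assume s: "s \<in> {0..t}"
    have "bridged_path x (X x t \<omega>, \<omega>) s = \<alpha> s *\<^sub>R x + (\<beta> s t *\<^sub>R (e *\<^sub>R x + Y t \<omega>) + (Y s \<omega> - \<beta> s t *\<^sub>R Y t \<omega>))"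
      using * t s by (simp add: bridged_path_def bridge_def Z_def)
    also have "\<dots> = (\<alpha> s + \<beta> s t * e) *\<^sub>R x + Y s \<omega>" by (simp add: algebra_simps)
    finally show "X x s \<omega> = bridged_path x (X x t \<omega>, \<omega>) s" using * s unfolding \<alpha>_\<beta> by simp
  qed
qed

lemma AE_FK_weight: "AE \<omega> in M. FK_weight X V t f x \<omega> = weight x (X x t \<omega>, \<omega>)"
  using AE_path[of x]
proof eventually_elim
  fix \<omega> assume *: "\<forall>s\<in>{0..t}. X x s \<omega> = bridged_path x (X x t \<omega>, \<omega>) s"
  have "(LBINT s:{0..t}. V (X x s \<omega>)) = potential x (X x t \<omega>, \<omega>)"
    unfolding potential_def
    by (rule set_lebesgue_integral_cong, simp, intro allI impI arg_cong[where f = V], rule bspec[OF *])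
  then show "FK_weight X V t f x \<omega> = weight x (X x t \<omega>, \<omega>)"
    by (simp add: FK_weight_def weight_def)
qed

lemma e_over_v: "2 * a * exp (- a * t) / (\<sigma>\<^sup>2 * (1 - exp (- 2 * a * t))) = e / v"
  by (simp add: var_def)

lemma AE_A_process: "AE \<omega> in M. A_process X V a \<sigma> t x \<omega> = score x (X x t \<omega>, \<omega>)"
  using AE_path[of x]
proof eventually_elim
  fix \<omega> assume *: "\<forall>s\<in>{0..t}. X x s \<omega> = bridged_path x (X x t \<omega>, \<omega>) s"
  have "(LBINT s:{0..t}. (sinh (a * (t - s)) / sinh (a * t)) *\<^sub>R grad V (X x s \<omega>)) = grad_potential x (X x t \<omega>, \<omega>)"
    unfolding grad_potential_def \<alpha>_def
    by (rule set_lebesgue_integral_cong, simp, intro allI impI arg_cong[where f = "\<lambda>y. _ *\<^sub>R grad V y"], rule bspec[OF *])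
  then show "A_process X V a \<sigma> t x \<omega> = score x (X x t \<omega>, \<omega>)"
    unfolding A_process_def score_def e_over_v by simp
qed

lemma X_joint [measurable]: "(\<lambda>q. X x (clamp_time (snd q)) (fst q)) \<in> borel_measurable (M \<Otimes>\<^sub>M borel)"
proof -
  have "(\<lambda>q. X x (clamp_time (fst q)) (snd q)) \<in> borel_measurable (borel \<Otimes>\<^sub>M M)"
  proof (rule measurable_continuous_process)
    show "X x (clamp_time s) \<in> borel_measurable M" for s
      using clamp_time_Icc[of s] by (intro X_measurable) auto
    show "continuous_on UNIV (\<lambda>s. X x (clamp_time s) \<omega>)" if "\<omega> \<in> space M" for \<omega>
    proof (rule continuous_on_compose2[OF X_continuous[OF that]])
      show "continuous_on UNIV clamp_time" unfolding clamp_time_def[abs_def] by (intro continuous_intros)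
    qed (use clamp_time_Icc in auto)
  qed
  from measurable_compose[OF measurable_Pair[OF measurable_snd measurable_fst] this]
  show ?thesis by simp
qed

lemma FK_weight_measurable [measurable]: "FK_weight X V t f x \<in> borel_measurable M"
proof -
  have [measurable]: "X x t \<in> borel_measurable M" using t by (intro X_measurable) simp
  have [measurable]: "(\<lambda>\<omega>. LBINT s:{0..t}. V (X x (clamp_time s) \<omega>)) \<in> borel_measurable M"
    by (rule measurable_set_integral_Icc) measurable
  have "(LBINT s:{0..t}. V (X x s \<omega>)) = (LBINT s:{0..t}. V (X x (clamp_time s) \<omega>))" for \<omega>
    by (rule set_lebesgue_integral_cong) auto
  then show ?thesis unfolding FK_weight_def[abs_def] by simp
qed

lemma A_process_measurable [measurable]: "A_process X V a \<sigma> t x \<in> borel_measurable M"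
proof -
  have [measurable]: "X x t \<in> borel_measurable M" using t by (intro X_measurable) simp
  have [measurable]: "(\<lambda>\<omega>. LBINT s:{0..t}. \<alpha> s *\<^sub>R grad V (X x (clamp_time s) \<omega>)) \<in> borel_measurable M"
    by (rule measurable_set_integral_Icc) measurable
  have "(LBINT s:{0..t}. \<alpha> s *\<^sub>R grad V (X x s \<omega>)) = (LBINT s:{0..t}. \<alpha> s *\<^sub>R grad V (X x (clamp_time s) \<omega>))" for \<omega>
    by (rule set_lebesgue_integral_cong) auto
  then show ?thesis unfolding A_process_def[abs_def] \<alpha>_def[symmetric] by simp
qed

lemma FK_semigroup_eq: "FK_semigroup M X V t f x = (\<integral>p. dens x p \<partial>\<mu>)"
proof -
  have "FK_semigroup M X V t f x = (\<integral>\<omega>. weight x (X x t \<omega>, \<omega>) \<partial>M)"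
    unfolding FK_semigroup_def
    by (rule integral_cong_AE) (use AE_FK_weight measurable_compose[OF endpoint_measurable weight_measurable] in auto)
  also have "\<dots> = (\<integral>p. dens x p \<partial>\<mu>)"
    unfolding integral_endpoint(2)[OF weight_measurable] dens_def by simp
  finally show ?thesis .
qed

end

section \<open>The logarithmic derivatives\<close>

text \<open>Non-negative and non-zero \<open>f\<close>, for which the logarithm and the measure \<open>Q\<close> below make sense.\<close>

locale feynman_kac_nonneg = feynman_kac M F B X a \<sigma> V f t
  for M :: "'w measure" and F :: "real \<Rightarrow> 'w measure"
    and B :: "real \<Rightarrow> 'w \<Rightarrow> real ^ 'n"
    and X :: "real ^ 'n \<Rightarrow> real \<Rightarrow> 'w \<Rightarrow> real ^ 'n" and a \<sigma> :: real
    and V f :: "real ^ 'n \<Rightarrow> real" and t :: real +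
  assumes f_nonneg: "AE y in equilibrium a \<sigma>. 0 \<le> f y"
    and f_nonzero: "\<not> (AE y in equilibrium a \<sigma>. f y = 0)"
begin

lemma AE_equilibrium: "(AE y in equilibrium a \<sigma>. P y) \<longleftrightarrow> (AE y in lborel. P (y :: real ^ 'n))"
  unfolding equilibrium_def using a \<sigma> by (subst AE_density) auto

lemma AE_\<mu>_nonneg: "AE p in \<mu>. 0 \<le> f (fst p)"
  unfolding \<mu>_def
proof (rule \<mu>.AE_pair_measure)
  show "{p \<in> space (lborel \<Otimes>\<^sub>M MG). 0 \<le> f (fst p)} \<in> sets (lborel \<Otimes>\<^sub>M MG)" by measurable
  show "AE y in lborel. AE \<omega> in MG. 0 \<le> f (fst (y, \<omega>))"
    using f_nonneg unfolding AE_equilibrium by eventually_elim simp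
qed

lemma AE_dens_nonneg: "AE p in \<mu>. 0 \<le> dens x p"
  using AE_\<mu>_nonneg by eventually_elim (simp add: dens_def weight_def)

lemma AE_FK_weight_nonneg: "AE \<omega> in M. 0 \<le> FK_weight X V t f x \<omega>"
proof -
  have "AE p in density \<mu> (\<lambda>p. ennreal (gdens v (fst p - e *\<^sub>R x))). 0 \<le> f (fst p)"
  proof (subst AE_density)
    show "(\<lambda>p. ennreal (gdens v (fst p - e *\<^sub>R x))) \<in> borel_measurable \<mu>"
      unfolding measurable_cong_sets[OF sets_\<mu> refl] by measurable
  qed (use AE_\<mu>_nonneg in auto)
  then have "AE \<omega> in M. 0 \<le> f (fst (X x t \<omega>, \<omega>))"
    unfolding distr_endpoint[symmetric] by (rule AE_distrD[OF endpoint_measurable])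
  then show ?thesis by eventually_elim (simp add: FK_weight_def)
qed

abbreviation P :: "real ^ 'n \<Rightarrow> real" where "P \<equiv> FK_semigroup M X V t f"

lemma P_pos: "P x > 0"
proof -
  have "P x \<ge> 0" unfolding FK_semigroup_eq by (rule integral_nonneg_AE[OF AE_dens_nonneg])
  moreover have "P x \<noteq> 0"
  proof
    assume "P x = 0"
    then have "AE p in \<mu>. dens x p = 0"
      unfolding FK_semigroup_eq using integral_nonneg_eq_0_iff_AE[OF dens_integrable AE_dens_nonneg] by blast
    then have "AE p in lborel \<Otimes>\<^sub>M MG. f (fst p) = 0"
      unfolding \<mu>_def
    proof eventually_elim
      fix p assume "dens x p = 0"
      moreover have "gdens v (fst p - e *\<^sub>R x) > 0" by (rule gdens_pos[OF v])
      ultimately show "f (fst p) = 0" by (simp add: dens_def weight_def)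
    qed
    from \<mu>.AE_pair[OF this] have "AE y in lborel. f y = 0" by simp
    then show False using f_nonzero unfolding AE_equilibrium by simp
  qed
  ultimately show ?thesis by simp
qed

abbreviation A :: "real ^ 'n \<Rightarrow> 'w \<Rightarrow> real ^ 'n" where "A x \<equiv> A_process X V a \<sigma> t x"

abbreviation Q :: "real ^ 'n \<Rightarrow> 'w measure" where "Q x \<equiv> FK_measure M X V t f x"

lemma AE_Q_density: "AE \<omega> in M. 0 \<le> FK_weight X V t f x \<omega> / P x"
  using AE_FK_weight_nonneg[of x] by eventually_elim (use P_pos[of x] in simp)

text \<open>Expectations under the weighted measure as integrals against \<open>dens\<close>.\<close>

lemma integral_Q:
  fixes \<phi> :: "'w \<Rightarrow> 'b::{banach, second_countable_topology}"
  assumes [measurable]: "\<phi> \<in> borel_measurable M" and \<psi>[measurable]: "\<psi> \<in> borel_measurable \<G>"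
    and eq: "AE \<omega> in M. \<phi> \<omega> = \<psi> (X x t \<omega>, \<omega>)"
  shows "integrable (Q x) \<phi> \<longleftrightarrow> integrable \<mu> (\<lambda>p. dens x p *\<^sub>R \<psi> p)"
    and "(\<integral>\<omega>. \<phi> \<omega> \<partial>Q x) = inverse (P x) *\<^sub>R (\<integral>p. dens x p *\<^sub>R \<psi> p \<partial>\<mu>)"
proof -
  define W where "W p = inverse (P x) *\<^sub>R (weight x p *\<^sub>R \<psi> p)" for p
  have W[measurable]: "W \<in> borel_measurable \<G>" unfolding W_def[abs_def] by measurable
  have WM: "(\<lambda>\<omega>. W (X x t \<omega>, \<omega>)) \<in> borel_measurable M"
    by (rule measurable_compose[OF endpoint_measurable W])
  have ae: "AE \<omega> in M. (FK_weight X V t f x \<omega> / P x) *\<^sub>R \<phi> \<omega> = W (X x t \<omega>, \<omega>)"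
    using eq AE_FK_weight[of x] by eventually_elim (simp add: W_def divide_inverse mult.commute)
  have g: "gdens v (fst p - e *\<^sub>R x) *\<^sub>R W p = inverse (P x) *\<^sub>R (dens x p *\<^sub>R \<psi> p)" for p
    by (simp add: W_def dens_def mult.commute mult.left_commute)
  have "integrable (Q x) \<phi> \<longleftrightarrow> integrable M (\<lambda>\<omega>. (FK_weight X V t f x \<omega> / P x) *\<^sub>R \<phi> \<omega>)"
    unfolding FK_measure_def by (rule integrable_density[OF _ _ AE_Q_density]) measurable
  also have "\<dots> \<longleftrightarrow> integrable M (\<lambda>\<omega>. W (X x t \<omega>, \<omega>))"
    by (rule integrable_cong_AE[OF _ WM ae]) measurable
  also have "\<dots> \<longleftrightarrow> integrable \<mu> (\<lambda>p. dens x p *\<^sub>R \<psi> p)"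
    unfolding integral_endpoint(1)[OF W] g using P_pos[of x] by (intro integrable_scaleR_iff) simp
  finally show "integrable (Q x) \<phi> \<longleftrightarrow> integrable \<mu> (\<lambda>p. dens x p *\<^sub>R \<psi> p)" .
  have "(\<integral>\<omega>. \<phi> \<omega> \<partial>Q x) = (\<integral>\<omega>. (FK_weight X V t f x \<omega> / P x) *\<^sub>R \<phi> \<omega> \<partial>M)"
    unfolding FK_measure_def by (rule integral_density[OF _ _ AE_Q_density]) measurable
  also have "\<dots> = (\<integral>\<omega>. W (X x t \<omega>, \<omega>) \<partial>M)"
    by (rule integral_cong_AE[OF _ WM ae]) measurable
  also have "\<dots> = inverse (P x) *\<^sub>R (\<integral>p. dens x p *\<^sub>R \<psi> p \<partial>\<mu>)"
    unfolding integral_endpoint(2)[OF W] g by (rule integral_scaleR_right)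
  finally show "(\<integral>\<omega>. \<phi> \<omega> \<partial>Q x) = inverse (P x) *\<^sub>R (\<integral>p. dens x p *\<^sub>R \<psi> p \<partial>\<mu>)" .
qed

lemma prob_space_Q: "prob_space (Q x)"
proof (rule prob_spaceI)
  have i: "integrable M (FK_weight X V t f x)"
  proof -
    have "integrable M (\<lambda>\<omega>. weight x (X x t \<omega>, \<omega>))"
      unfolding integral_endpoint(1)[OF weight_measurable] using dens_integrable[of x] by (simp add: dens_def[abs_def])
    then show ?thesis
      by (rule integrable_cong_AE_imp) (use AE_FK_weight[of x] in auto)
  qed
  have "emeasure (Q x) (space (Q x)) = (\<integral>\<^sup>+\<omega>. ennreal (FK_weight X V t f x \<omega> / P x) \<partial>M)"
    unfolding FK_measure_def by (simp add: emeasure_density cong: nn_integral_cong)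
  also have "\<dots> = ennreal (\<integral>\<omega>. FK_weight X V t f x \<omega> / P x \<partial>M)"
    by (rule nn_integral_eq_integral[OF _ AE_Q_density]) (use i in simp)
  also have "(\<integral>\<omega>. FK_weight X V t f x \<omega> / P x \<partial>M) = 1"
    using P_pos[of x] by (simp add: FK_semigroup_def)
  finally show "emeasure (Q x) (space (Q x)) = 1" by simp
qed

lemma Q_A:
  shows "integrable (Q x) (A x)"
    and "(\<integral>\<omega>. A x \<omega> \<partial>Q x) = inverse (P x) *\<^sub>R (\<integral>p. dens x p *\<^sub>R score x p \<partial>\<mu>)"
  using integral_Q[OF A_process_measurable score_measurable AE_A_process] dens_score_integrable by auto

lemma Q_A_outer:
  shows "integrable (Q x) (\<lambda>\<omega>. A x \<omega> \<otimes>\<^sub>v A x \<omega>)"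
    and "(\<integral>\<omega>. A x \<omega> \<otimes>\<^sub>v A x \<omega> \<partial>Q x)
      = inverse (P x) *\<^sub>R (\<integral>p. dens x p *\<^sub>R (score x p \<otimes>\<^sub>v score x p) \<partial>\<mu>)"
proof -
  have ae: "AE \<omega> in M. A x \<omega> \<otimes>\<^sub>v A x \<omega> = score x (X x t \<omega>, \<omega>) \<otimes>\<^sub>v score x (X x t \<omega>, \<omega>)"
    using AE_A_process[of x] by eventually_elim simp
  note * = integral_Q[OF outer_measurable[OF A_process_measurable] outer_measurable[OF score_measurable] ae]
  show "integrable (Q x) (\<lambda>\<omega>. A x \<omega> \<otimes>\<^sub>v A x \<omega>)"
    unfolding *(1) by (rule dens_outer_integrable)
  show "(\<integral>\<omega>. A x \<omega> \<otimes>\<^sub>v A x \<omega> \<partial>Q x)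
      = inverse (P x) *\<^sub>R (\<integral>p. dens x p *\<^sub>R (score x p \<otimes>\<^sub>v score x p) \<partial>\<mu>)"
    by (rule *(2))
qed

lemma path_measurable_single [measurable]: "(\<lambda>p. bridged_path x p s) \<in> borel_measurable \<G>"
proof -
  have "(\<lambda>p. (p, s)) \<in> measurable \<G> (\<G> \<Otimes>\<^sub>M borel)" by measurable
  from measurable_compose[OF this path_joint] show ?thesis by simp
qed

lemma dens_Hess_path_integrable:
  assumes s: "s \<in> {0..t}"
  shows "integrable \<mu> (\<lambda>p. dens x p *\<^sub>R Hess V (bridged_path x p s))"
proof -
  obtain C m where C: "C > 0" "\<And>y. norm (Hess V y) \<le> C * (1 + norm y) ^ m"
    using D_class_2(4)[OF V_D] by blast
  obtain K where K: "K > 0" "\<And>y p. norm y \<le> norm x \<Longrightarrow> p \<in> space \<mu> \<Longrightarrow> \<bar>dens y p\<bar> \<le> K * envelope (fst p)"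
    using dens_bound by blast
  let ?D = "\<lambda>p. K * C * (1 + norm x) ^ m * ((envelope (fst p) * (1 + norm (fst p)) ^ m) * (1 + norm (bridge s (snd p))) ^ m)"
  show ?thesis
  proof (rule integrable_dominated[where D = ?D])
    show "integrable \<mu> ?D"
      unfolding \<mu>_def by (intro integrable_mult_right \<mu>.integrable_mult_prod envelope_integrable bridge_moment_integrable)
    fix p assume p: "p \<in> space \<mu>"
    have "norm (Hess V (bridged_path x p s)) \<le> C * (1 + norm (bridged_path x p s)) ^ m" by (rule C)
    also have "\<dots> \<le> C * ((1 + norm x) * (1 + norm (fst p)) * (1 + norm (bridge s (snd p)))) ^ m"
      using path_bound[OF s, of x p] C by (intro mult_left_mono power_mono) auto
    finally have "norm (dens x p *\<^sub>R Hess V (bridged_path x p s)) \<le> (K * envelope (fst p)) * (C * ((1 + norm x) * (1 + norm (fst p)) * (1 + norm (bridge s (snd p)))) ^ m)"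
      unfolding norm_scaleR using K(2)[OF order_refl p] K(1) envelope_nonneg by (intro mult_mono) auto
    also have "\<dots> = ?D p" by (simp add: power_mult_distrib ac_simps)
    finally show "norm (dens x p *\<^sub>R Hess V (bridged_path x p s)) \<le> ?D p" .
  qed measurable
qed

lemma Q_Hess:
  assumes s: "s \<in> {0..t}"
  shows "integrable (Q x) (\<lambda>\<omega>. Hess V (X x s \<omega>))"
    and "(\<integral>\<omega>. Hess V (X x s \<omega>) \<partial>Q x) = inverse (P x) *\<^sub>R (\<integral>p. dens x p *\<^sub>R Hess V (bridged_path x p s) \<partial>\<mu>)"
proof -
  have X: "X x s \<in> borel_measurable M" using s by (intro X_measurable) simp
  have ae: "AE \<omega> in M. Hess V (X x s \<omega>) = Hess V (bridged_path x (X x t \<omega>, \<omega>) s)"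
    using AE_path[of x]
  proof eventually_elim
    fix \<omega> assume *: "\<forall>s\<in>{0..t}. X x s \<omega> = bridged_path x (X x t \<omega>, \<omega>) s"
    show "Hess V (X x s \<omega>) = Hess V (bridged_path x (X x t \<omega>, \<omega>) s)" by (rule arg_cong[OF bspec[OF * s]])
  qed
  have m: "(\<lambda>p. Hess V (bridged_path x p s)) \<in> borel_measurable \<G>" by measurable
  note * = integral_Q[OF measurable_compose[OF X Hess_V_measurable] m ae]
  show "integrable (Q x) (\<lambda>\<omega>. Hess V (X x s \<omega>))" unfolding *(1) by (rule dens_Hess_path_integrable[OF s])
  show "(\<integral>\<omega>. Hess V (X x s \<omega>) \<partial>Q x) = inverse (P x) *\<^sub>R (\<integral>p. dens x p *\<^sub>R Hess V (bridged_path x p s) \<partial>\<mu>)" by (rule *(2))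
qed

text \<open>By Fubini, the time integral of the expected Hessians is the expected Hessian of the potential.\<close>

lemma time_integral_Hess:
  shows "set_integrable lborel {0..t} (\<lambda>s. (\<alpha> s)\<^sup>2 *\<^sub>R (\<integral>\<omega>. Hess V (X x s \<omega>) \<partial>Q x))"
    and "(LBINT s:{0..t}. (\<alpha> s)\<^sup>2 *\<^sub>R (\<integral>\<omega>. Hess V (X x s \<omega>) \<partial>Q x)) = inverse (P x) *\<^sub>R (\<integral>p. dens x p *\<^sub>R Hess_potential x p \<partial>\<mu>)"
proof -
  interpret \<mu>\<sigma>: sigma_finite_measure \<mu>
    unfolding \<mu>_def by (intro sigma_finite_pair_measure lborel.sigma_finite_measure_axioms MG.sigma_finite_measure_axioms)
  interpret \<mu>l: pair_sigma_finite \<mu> lborel ..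
  define g where "g p s = indicator {0..t} s *\<^sub>R (dens x p *\<^sub>R ((\<alpha> s)\<^sup>2 *\<^sub>R Hess V (bridged_path x p s)))" for p s
  have gi: "integrable lborel (g p)" if "p \<in> space \<mu>" for p
  proof -
    have "set_integrable lborel {0..t} (\<lambda>s. (\<alpha> s)\<^sup>2 *\<^sub>R Hess V (bridged_path x p s))"
      by (intro path_integrable(2)[OF Hess_V_continuous _ that] continuous_intros)
    from integrable_scaleR_right[OF this[unfolded set_integrable_def], of "dens x p"]
    show ?thesis unfolding g_def[abs_def] by (simp add: mult.commute mult.left_commute)
  qed
  have gm: "(\<lambda>q. g (fst q) (snd q)) \<in> borel_measurable (\<G> \<Otimes>\<^sub>M borel)"
    unfolding g_def by measurable
  have gm': "case_prod g \<in> borel_measurable (\<mu> \<Otimes>\<^sub>M lborel)"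
    unfolding case_prod_unfold using gm
    by (simp cong: measurable_cong_sets sets_pair_measure_cong add: sets_\<mu>)
  have norm_g: "(\<integral>s. norm (g p s) \<partial>lborel) = norm (dens x p) * Hess_norm x p" for p
  proof -
    have "(\<integral>s. norm (g p s) \<partial>lborel) = (\<integral>s. norm (dens x p) * (indicator {0..t} s *\<^sub>R norm ((\<alpha> s)\<^sup>2 *\<^sub>R Hess V (bridged_path x p s))) \<partial>lborel)"
      unfolding g_def by (simp add: abs_mult mult.commute mult.left_commute)
    then show ?thesis unfolding set_lebesgue_integral_def by simp
  qed
  have gint: "integrable (\<mu> \<Otimes>\<^sub>M lborel) (case_prod g)"
  proof (rule \<mu>l.Fubini_integrable[OF gm'])
    obtain D where "dominates D x" by (rule dominating_function)
    then have D: "integrable \<mu> D" "\<And>p. p \<in> space \<mu> \<Longrightarrow> norm (dens x p) * Hess_norm x p \<le> D p"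
      by (auto simp: dominates_def)
    show "integrable \<mu> (\<lambda>p. \<integral>s. norm (case_prod g (p, s)) \<partial>lborel)"
    proof (rule Bochner_Integration.integrable_bound[OF D(1)])
      show "(\<lambda>p. \<integral>s. norm (case_prod g (p, s)) \<partial>lborel) \<in> borel_measurable \<mu>"
        using gm' by measurable
      show "AE p in \<mu>. norm (\<integral>s. norm (case_prod g (p, s)) \<partial>lborel) \<le> norm (D p)"
      proof (rule AE_I2)
        fix p assume p: "p \<in> space \<mu>"
        have "0 \<le> (\<integral>s. norm (g p s) \<partial>lborel)" by (rule integral_nonneg_AE) simp
        then show "norm (\<integral>s. norm (case_prod g (p, s)) \<partial>lborel) \<le> norm (D p)"
          using D(2)[OF p] unfolding norm_g[symmetric] by simp
      qed
    qed
    show "AE p in \<mu>. integrable lborel (\<lambda>s. case_prod g (p, s))"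
      using gi by (intro AE_I2) simp
  qed
  have inner: "(\<integral>p. g p s \<partial>\<mu>) = indicator {0..t} s *\<^sub>R ((\<alpha> s)\<^sup>2 *\<^sub>R (P x *\<^sub>R (\<integral>\<omega>. Hess V (X x s \<omega>) \<partial>Q x)))" for s
  proof (cases "s \<in> {0..t}")
    case True
    have "(\<integral>p. g p s \<partial>\<mu>) = (\<integral>p. (\<alpha> s)\<^sup>2 *\<^sub>R (dens x p *\<^sub>R Hess V (bridged_path x p s)) \<partial>\<mu>)"
      unfolding g_def using True by (simp add: mult.commute)
    also have "\<dots> = (\<alpha> s)\<^sup>2 *\<^sub>R (\<integral>p. dens x p *\<^sub>R Hess V (bridged_path x p s) \<partial>\<mu>)" by (rule integral_scaleR_right)
    finally show ?thesis using True P_pos[of x] by (simp add: Q_Hess(2))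
  qed (simp add: g_def)
  have "integrable lborel (\<lambda>s. \<integral>p. g p s \<partial>\<mu>)"
    using \<mu>l.integrable_snd[OF gint] .
  then have "integrable lborel (\<lambda>s. inverse (P x) *\<^sub>R (\<integral>p. g p s \<partial>\<mu>))" by simp
  moreover have pg: "inverse (P x) *\<^sub>R (\<integral>p. g p s \<partial>\<mu>) = indicator {0..t} s *\<^sub>R ((\<alpha> s)\<^sup>2 *\<^sub>R (\<integral>\<omega>. Hess V (X x s \<omega>) \<partial>Q x))" for s
    unfolding inner using P_pos[of x] by (simp add: mult.commute mult.left_commute)
  ultimately show "set_integrable lborel {0..t} (\<lambda>s. (\<alpha> s)\<^sup>2 *\<^sub>R (\<integral>\<omega>. Hess V (X x s \<omega>) \<partial>Q x))"
    unfolding set_integrable_def by simp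
  have "(LBINT s:{0..t}. (\<alpha> s)\<^sup>2 *\<^sub>R (\<integral>\<omega>. Hess V (X x s \<omega>) \<partial>Q x)) = inverse (P x) *\<^sub>R (\<integral>s. (\<integral>p. g p s \<partial>\<mu>) \<partial>lborel)"
    unfolding set_lebesgue_integral_def pg[symmetric] by simp
  also have "(\<integral>s. (\<integral>p. g p s \<partial>\<mu>) \<partial>lborel) = (\<integral>p. (\<integral>s. g p s \<partial>lborel) \<partial>\<mu>)"
    by (rule \<mu>l.Fubini_integral[OF gint])
  also have "\<dots> = (\<integral>p. dens x p *\<^sub>R Hess_potential x p \<partial>\<mu>)"
  proof (rule Bochner_Integration.integral_cong[OF refl])
    fix p
    have "(\<integral>s. g p s \<partial>lborel) = (\<integral>s. dens x p *\<^sub>R (indicator {0..t} s *\<^sub>R ((\<alpha> s)\<^sup>2 *\<^sub>R Hess V (bridged_path x p s))) \<partial>lborel)"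
      unfolding g_def by (simp add: mult.commute mult.left_commute)
    then show "(\<integral>s. g p s \<partial>lborel) = dens x p *\<^sub>R Hess_potential x p"
      unfolding Hess_potential_def set_lebesgue_integral_def by (simp only: integral_scaleR_right)
  qed
  finally show "(LBINT s:{0..t}. (\<alpha> s)\<^sup>2 *\<^sub>R (\<integral>\<omega>. Hess V (X x s \<omega>) \<partial>Q x)) = inverse (P x) *\<^sub>R (\<integral>p. dens x p *\<^sub>R Hess_potential x p \<partial>\<mu>)" .
qed

lemma P_derivative: "(P has_derivative (\<lambda>k. (\<integral>p. dens x p *\<^sub>R score x p \<partial>\<mu>) \<bullet> k)) (at x)"
  using integral_dens_derivative unfolding FK_semigroup_eq[symmetric] .

lemma ln_P_derivative:
  "((\<lambda>y. ln (P y)) has_derivative (\<lambda>k. (\<integral>\<omega>. A x \<omega> \<partial>Q x) \<bullet> k)) (at x)"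
proof -
  have "((\<lambda>y. ln (P y)) has_derivative (\<lambda>k. ((\<integral>p. dens x p *\<^sub>R score x p \<partial>\<mu>) \<bullet> k) * inverse (P x))) (at x)"
    by (rule derivative_eq_intros P_derivative P_pos refl)+
  then show ?thesis by (simp add: Q_A(2) mult.commute)
qed

lemma grad_ln_P: "grad (\<lambda>y. ln (P y)) x = (\<integral>\<omega>. A x \<omega> \<partial>Q x)"
  by (rule grad_eq[OF ln_P_derivative])

lemma grad_ln_P_derivative:
  "(grad (\<lambda>y. ln (P y)) has_derivative
    (\<lambda>k. (- (LBINT s:{0..t}. (\<alpha> s)\<^sup>2 *\<^sub>R (\<integral>\<omega>. Hess V (X x s \<omega>) \<partial>Q x))
       + (\<integral>\<omega>. A x \<omega> \<otimes>\<^sub>v A x \<omega> \<partial>Q x)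
       - (\<integral>\<omega>. A x \<omega> \<partial>Q x) \<otimes>\<^sub>v (\<integral>\<omega>. A x \<omega> \<partial>Q x)
       - (e\<^sup>2 / v) *\<^sub>R mat 1) *v k)) (at x)"
proof -
  let ?u = "\<lambda>y. \<integral>p. dens y p *\<^sub>R score y p \<partial>\<mu>"
  let ?S = "\<integral>p. dens x p *\<^sub>R (score x p \<otimes>\<^sub>v score x p) \<partial>\<mu>"
  let ?H = "\<integral>p. dens x p *\<^sub>R Hess_potential x p \<partial>\<mu>"
  have gr: "grad (\<lambda>y. ln (P y)) = (\<lambda>y. inverse (P y) *\<^sub>R ?u y)"
    by (rule HOL.ext) (simp add: grad_ln_P Q_A(2))
  have inv: "((\<lambda>y. inverse (P y)) has_derivative (\<lambda>k. - (inverse (P x) * (?u x \<bullet> k) * inverse (P x)))) (at x)"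
    using P_pos[of x] by (intro Deriv.has_derivative_inverse[OF _ P_derivative]) simp
  have "((\<lambda>y. inverse (P y) *\<^sub>R ?u y) has_derivative
    (\<lambda>k. inverse (P x) *\<^sub>R ((?S - ?H - ((e\<^sup>2 / v) * P x) *\<^sub>R mat 1) *v k)
       + (- (inverse (P x) * (?u x \<bullet> k) * inverse (P x))) *\<^sub>R ?u x)) (at x)"
    using has_derivative_scaleR[OF inv integral_dens_score_derivative] unfolding FK_semigroup_eq .
  moreover have "inverse (P x) *\<^sub>R ((?S - ?H - ((e\<^sup>2 / v) * P x) *\<^sub>R mat 1) *v k)
       + (- (inverse (P x) * (?u x \<bullet> k) * inverse (P x))) *\<^sub>R ?u x
     = (- (inverse (P x) *\<^sub>R ?H) + inverse (P x) *\<^sub>R ?S - (inverse (P x) *\<^sub>R ?u x) \<otimes>\<^sub>v (inverse (P x) *\<^sub>R ?u x) - (e\<^sup>2 / v) *\<^sub>R mat 1) *v k" for k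
    using P_pos[of x]
    by (simp add: matrix_vector_mult_diff_rdistrib matrix_vector_mult_add_rdistrib outer_mult_vec
        scaleR_matrix_vector_assoc[symmetric] scaleR_diff_right flip: scaleR_minus_left)
  ultimately show ?thesis
    unfolding gr time_integral_Hess(2) Q_A(2) Q_A_outer(2) by simp
qed

end

theorem theorem2p10:
  fixes M :: "'w measure" and F :: "real \<Rightarrow> 'w measure"
    and B :: "real \<Rightarrow> 'w \<Rightarrow> real ^ 'n"
    and X :: "real ^ 'n \<Rightarrow> real \<Rightarrow> 'w \<Rightarrow> real ^ 'n"
    and V f :: "real ^ 'n \<Rightarrow> real"
    and a \<sigma> t :: real and x :: "real ^ 'n"
  defines "Pf \<equiv> FK_semigroup M X V t f"
    and "Q \<equiv> FK_measure M X V t f x"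
    and "A \<equiv> A_process X V a \<sigma> t x"
  assumes "a > 0" and "\<sigma> > 0"
    and "brownian_motion M F B"
    and "\<And>y. OU_solution M F B a \<sigma> y (X y)"
    and "bdd_below (range V)" and "D_class 2 V"
    and "t > 0"
    and "f \<in> L2_space (equilibrium a \<sigma>)"
    and "AE y in equilibrium a \<sigma>. 0 \<le> f y"
    and "\<not> (AE y in equilibrium a \<sigma>. f y = 0)"
  shows
    "prob_space Q \<and>
     integrable Q A \<and>
     integrable Q (\<lambda>\<omega>. A \<omega> \<otimes>\<^sub>v A \<omega>) \<and>
     (\<forall>s\<in>{0..t}. integrable Q (\<lambda>\<omega>. Hess V (X x s \<omega>))) \<and>
     set_integrable lborel {0..t}
       (\<lambda>s. (sinh (a * (t - s)) / sinh (a * t))\<^sup>2 *\<^sub>R (\<integral>\<omega>. Hess V (X x s \<omega>) \<partial>Q)) \<and>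
     (\<lambda>y. ln (Pf y)) differentiable at x \<and>
     grad (\<lambda>y. ln (Pf y)) x = (\<integral>\<omega>. A \<omega> \<partial>Q) \<and>
     grad (\<lambda>y. ln (Pf y)) differentiable at x \<and>
     Hess (\<lambda>y. ln (Pf y)) x
       + (2 * a * exp (- 2 * a * t) / (\<sigma>\<^sup>2 * (1 - exp (- 2 * a * t)))) *\<^sub>R mat 1
     = - (LBINT s:{0..t}.
            (sinh (a * (t - s)) / sinh (a * t))\<^sup>2 *\<^sub>R (\<integral>\<omega>. Hess V (X x s \<omega>) \<partial>Q))
       + (\<integral>\<omega>. A \<omega> \<otimes>\<^sub>v A \<omega> \<partial>Q)
       - (\<integral>\<omega>. A \<omega> \<partial>Q) \<otimes>\<^sub>v (\<integral>\<omega>. A \<omega> \<partial>Q)"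
proof -
  interpret feynman_kac_nonneg M F B X a \<sigma> V f t
    by unfold_locales (use assms in auto)
  have c: "2 * a * exp (- 2 * a * t) / (\<sigma>\<^sup>2 * (1 - exp (- 2 * a * t))) = (exp (- a * t))\<^sup>2 / var t"
    using assms(4) by (simp add: var_def exp_double[symmetric])
  show ?thesis
    unfolding Pf_def Q_def A_def c
  proof (intro conjI ballI)
    show "prob_space (FK_measure M X V t f x)" by (rule prob_space_Q)
    show "integrable (FK_measure M X V t f x) (A_process X V a \<sigma> t x)" by (rule Q_A(1))
    show "integrable (FK_measure M X V t f x) (\<lambda>\<omega>. A_process X V a \<sigma> t x \<omega> \<otimes>\<^sub>v A_process X V a \<sigma> t x \<omega>)"
      by (rule Q_A_outer(1))
    show "integrable (FK_measure M X V t f x) (\<lambda>\<omega>. Hess V (X x s \<omega>))" if "s \<in> {0..t}" for s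
      by (rule Q_Hess(1)[OF that])
    show "set_integrable lborel {0..t} (\<lambda>s. (sinh (a * (t - s)) / sinh (a * t))\<^sup>2 *\<^sub>R (\<integral>\<omega>. Hess V (X x s \<omega>) \<partial>FK_measure M X V t f x))"
      using time_integral_Hess(1) unfolding \<alpha>_def .
    show "(\<lambda>y. ln (FK_semigroup M X V t f y)) differentiable at x"
      using ln_P_derivative by (rule differentiableI)
    show "grad (\<lambda>y. ln (FK_semigroup M X V t f y)) x = (\<integral>\<omega>. A_process X V a \<sigma> t x \<omega> \<partial>FK_measure M X V t f x)"
      by (rule grad_ln_P)
    show "grad (\<lambda>y. ln (FK_semigroup M X V t f y)) differentiable at x"
      using grad_ln_P_derivative by (rule differentiableI)
  qed (simp add: Hess_eq[OF grad_ln_P_derivative] \<alpha>_def)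
qed

end
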